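(* Let $\Omega_p\subset\mathbb{C}^2$ be a domain of the class $\Omega^{(2)}$. Then the multiplication pair $M_{\sigma_p,z}=(M_{\sigma_p,z_1},M_{\sigma_p,z_2})$ on the Hardy space $H^2(\sigma_p)$ is essentially normal.
   Context: Class $\Omega^{(2)}$: let $p=(p_1,p_2)$, where for $i=1,2$, $p_i=(p_{i,1},\ldots,p_{i,m_i})$ is an $m_i$-tuple of positive integers with $m_i\ge 2$ and $\gcd\{p_{i,1},\ldots,p_{i,m_i}\}=1$. Put $\Omega_p=\{z\in\mathbb{C}^2:\sum_{i=1}^2\sum_{j=1}^{m_i}|z_i|^{2p_{i,j}}<1\}$, with closure $\overline{\Omega}_p$ (defined by $\le 1$) and topological boundary $\partial\Omega_p$ (defined by $=1$). $\Omega^{(2)}$ is the class of all such $\Omega_p$. $A(\Omega_p)=\{f\in C(\overline{\Omega}_p): f \text{ is holomorphic on } \Omega_p\}$. $\sigma_p$ is the normalized surface area measure on $\partial\Omega_p$. The Hardy space $H^2(\sigma_p)$ is the closure of (the restrictions to $\partial\Omega_p$ of functions in) $A(\Omega_p)$ in $L^2(\sigma_p)$. $M_{\sigma_p,z_i}$ is the operator of multiplication by the coordinate function $z_i$ on $H^2(\sigma_p)$. A tuple $T=(T_1,\ldots,T_n)$ of commuting bounded operators on a Hilbert space is essentially normal if $T_i^*T_j-T_jT_i^*$ is compact for all $i,j$. *)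

theory Defs
  imports "HOL-Analysis.Analysis"
begin

section \<open>Operators on Hilbert spaces with explicit carriers\<close>

text \<open>
  The Hilbert space below depends on the parameter \<open>p\<close>, so it cannot be a type. The notions are
  stated for a complex inner product space given by a carrier set and its operations; the inner
  product is linear in the first argument.
\<close>

record 'a inner_space =
  hcarrier :: "'a set"
  hadd :: "'a \<Rightarrow> 'a \<Rightarrow> 'a"
  hscale :: "complex \<Rightarrow> 'a \<Rightarrow> 'a"
  hinner :: "'a \<Rightarrow> 'a \<Rightarrow> complex"

definition hdiff :: "'a inner_space \<Rightarrow> 'a \<Rightarrow> 'a \<Rightarrow> 'a" where
  "hdiff H x y = hadd H x (hscale H (-1) y)"

definition hnorm :: "'a inner_space \<Rightarrow> 'a \<Rightarrow> real" where
  "hnorm H x = sqrt (Re (hinner H x x))"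

definition hclosure :: "'a inner_space \<Rightarrow> 'a set \<Rightarrow> 'a set" where
  "hclosure H S = {x \<in> hcarrier H. \<forall>e>0. \<exists>y\<in>S. hnorm H (hdiff H x y) < e}"

definition linear_op :: "'a inner_space \<Rightarrow> ('a \<Rightarrow> 'a) \<Rightarrow> bool" where
  "linear_op H T \<longleftrightarrow>
     (\<forall>x\<in>hcarrier H. T x \<in> hcarrier H) \<and>
     (\<forall>x\<in>hcarrier H. \<forall>y\<in>hcarrier H. T (hadd H x y) = hadd H (T x) (T y)) \<and>
     (\<forall>c. \<forall>x\<in>hcarrier H. T (hscale H c x) = hscale H c (T x))"

definition bounded_op :: "'a inner_space \<Rightarrow> ('a \<Rightarrow> 'a) \<Rightarrow> bool" where
  "bounded_op H T \<longleftrightarrow>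
     linear_op H T \<and> (\<exists>C. \<forall>x\<in>hcarrier H. hnorm H (T x) \<le> C * hnorm H x)"

definition adjoint_op :: "'a inner_space \<Rightarrow> ('a \<Rightarrow> 'a) \<Rightarrow> 'a \<Rightarrow> 'a" where
  "adjoint_op H T y =
     (THE w. w \<in> hcarrier H \<and> (\<forall>x\<in>hcarrier H. hinner H (T x) y = hinner H x w))"

definition compact_op :: "'a inner_space \<Rightarrow> ('a \<Rightarrow> 'a) \<Rightarrow> bool" where
  "compact_op H T \<longleftrightarrow>
     linear_op H T \<and>
     (\<forall>x :: nat \<Rightarrow> 'a.
        (\<forall>n. x n \<in> hcarrier H) \<and> (\<exists>B. \<forall>n. hnorm H (x n) \<le> B) \<longrightarrow>
        (\<exists>r y. strict_mono r \<and> y \<in> hcarrier H \<and>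
               (\<lambda>n. hnorm H (hdiff H (T (x (r n))) y)) \<longlonglongrightarrow> 0))"

definition essentially_normal :: "'a inner_space \<Rightarrow> ('i::finite \<Rightarrow> 'a \<Rightarrow> 'a) \<Rightarrow> bool" where
  "essentially_normal H T \<longleftrightarrow>
     (\<forall>i. bounded_op H (T i)) \<and>
     (\<forall>i j. \<forall>x\<in>hcarrier H. T i (T j x) = T j (T i x)) \<and>
     (\<forall>i j. compact_op H
        (\<lambda>x. hdiff H (adjoint_op H (T i) (T j x)) (T j (adjoint_op H (T i) x))))"


section \<open>The space of square integrable functions modulo equality almost everywhere\<close>

definition square_integrable :: "'a measure \<Rightarrow> ('a \<Rightarrow> complex) set" where
  "square_integrable M =
     {f \<in> borel_measurable M. integrable M (\<lambda>x. (norm (f x))\<^sup>2)}"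

definition ae_class :: "'a measure \<Rightarrow> ('a \<Rightarrow> complex) \<Rightarrow> ('a \<Rightarrow> complex) set" where
  "ae_class M f = {g \<in> square_integrable M. AE x in M. g x = f x}"

definition representative :: "('a \<Rightarrow> complex) set \<Rightarrow> 'a \<Rightarrow> complex" where
  "representative F = (SOME f. f \<in> F)"

definition L2_space :: "'a measure \<Rightarrow> ('a \<Rightarrow> complex) set inner_space" where
  "L2_space M =
     \<lparr> hcarrier = ae_class M ` square_integrable M,
       hadd = (\<lambda>F G. ae_class M (\<lambda>x. representative F x + representative G x)),
       hscale = (\<lambda>c F. ae_class M (\<lambda>x. c * representative F x)),
       hinner = (\<lambda>F G. \<integral>x. representative F x * cnj (representative G x) \<partial>M) \<rparr>"


section \<open>Surface area measure\<close>

text \<open>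
  Surface area on a smooth hypersurface is the Hausdorff measure of codimension one for the
  Euclidean metric. The usual constant factor, which makes the \<open>k\<close>-dimensional Hausdorff measure
  agree with Lebesgue measure on \<open>k\<close>-dimensional Euclidean space, is omitted because it cancels
  in the normalized measure. The definitions are meant for \<open>k > 0\<close>.
\<close>

definition hausdorff_content :: "nat \<Rightarrow> real \<Rightarrow> 'a::metric_space set \<Rightarrow> ennreal" where
  "hausdorff_content k \<delta> A =
     (INF C \<in> {C :: nat \<Rightarrow> 'a set.
                 A \<subseteq> (\<Union>n. C n) \<and> (\<forall>n. bounded (C n) \<and> diameter (C n) \<le> \<delta>)}.
        \<Sum>n. ennreal (diameter (C n) ^ k))"

definition hausdorff_outer :: "nat \<Rightarrow> 'a::metric_space set \<Rightarrow> ennreal" where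
  "hausdorff_outer k A = (SUP \<delta>\<in>{0<..}. hausdorff_content k \<delta> A)"

definition hausdorff_measure :: "nat \<Rightarrow> 'a::metric_space measure" where
  "hausdorff_measure k = measure_of UNIV (sets borel) (hausdorff_outer k)"

definition normalized_surface_measure :: "'a::euclidean_space set \<Rightarrow> 'a measure" where
  "normalized_surface_measure S =
     uniform_measure (restrict_space (hausdorff_measure (DIM('a) - 1)) S) S"


section \<open>The domains and their Hardy spaces\<close>

definition Omega :: "(2 \<Rightarrow> nat list) \<Rightarrow> (complex^2) set" where
  "Omega p = {z. (\<Sum>i\<in>UNIV. \<Sum>k\<leftarrow>p i. norm (z $ i) ^ (2 * k)) < 1}"

definition \<sigma> :: "(2 \<Rightarrow> nat list) \<Rightarrow> (complex^2) measure" where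
  "\<sigma> p = normalized_surface_measure (frontier (Omega p))"

definition holomorphic_several :: "(complex^'n) set \<Rightarrow> (complex^'n \<Rightarrow> complex) \<Rightarrow> bool" where
  "holomorphic_several U f \<longleftrightarrow>
     (\<forall>z\<in>U. \<exists>D. (f has_derivative D) (at z) \<and> (\<forall>c v. D (c *s v) = c * D v))"

definition A_algebra :: "(complex^'n) set \<Rightarrow> (complex^'n \<Rightarrow> complex) set" where
  "A_algebra U = {f. continuous_on (closure U) f \<and> holomorphic_several U f}"

text \<open>
  The space of \<open>\<sigma> p\<close> is the boundary of \<open>Omega p\<close>, so \<open>ae_class (\<sigma> p) f\<close> depends only on the
  restriction of \<open>f\<close> to the boundary.
\<close>

definition Hardy_space :: "(2 \<Rightarrow> nat list) \<Rightarrow> (complex^2 \<Rightarrow> complex) set inner_space" where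
  "Hardy_space p =
     (L2_space (\<sigma> p))
       \<lparr> hcarrier := hclosure (L2_space (\<sigma> p)) (ae_class (\<sigma> p) ` A_algebra (Omega p)) \<rparr>"

definition mult_coord ::
  "(2 \<Rightarrow> nat list) \<Rightarrow> 2 \<Rightarrow> (complex^2 \<Rightarrow> complex) set \<Rightarrow> (complex^2 \<Rightarrow> complex) set" where
  "mult_coord p i F = ae_class (\<sigma> p) (\<lambda>z. z $ i * representative F z)"


text \<open>The topological closure and boundary of the domain have the expected descriptions.\<close>

lemma closure_frontier_Omega:
  assumes "\<And>i. \<forall>k\<in>set (p i). 0 < k"
  shows "closure (Omega p) = {z. (\<Sum>i\<in>UNIV. \<Sum>k\<leftarrow>p i. norm (z $ i) ^ (2 * k)) \<le> 1}"
    and "frontier (Omega p) = {z. (\<Sum>i\<in>UNIV. \<Sum>k\<leftarrow>p i. norm (z $ i) ^ (2 * k)) = 1}"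
proof -
  define \<rho> :: "complex^2 \<Rightarrow> real"
    where "\<rho> = (\<lambda>z. \<Sum>i\<in>UNIV. \<Sum>k\<leftarrow>p i. norm (z $ i) ^ (2 * k))"
  have cont_list: "continuous_on UNIV (\<lambda>z :: complex^2. \<Sum>k\<leftarrow>ks. norm (z $ i) ^ (2 * k))"
    for ks :: "nat list" and i
    by (induction ks) (auto intro!: continuous_intros)
  have cont: "continuous_on UNIV \<rho>"
    unfolding \<rho>_def by (intro continuous_on_sum cont_list)
  have Omega: "Omega p = {z. \<rho> z < 1}"
    by (simp add: Omega_def \<rho>_def)
  have open_Omega: "open (Omega p)"
    unfolding Omega by (intro open_Collect_less cont continuous_intros)
  have closed: "closed {z. \<rho> z \<le> 1}"
    by (intro closed_Collect_le cont continuous_intros)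
  have scale_list: "(\<Sum>k\<leftarrow>ks. (t * a) ^ (2 * k)) \<le> t * (\<Sum>k\<leftarrow>ks. a ^ (2 * k))"
    if "0 \<le> t" "t \<le> 1" "\<forall>k\<in>set ks. 0 < k" for t a :: real and ks :: "nat list"
    using that(3)
  proof (induction ks)
    case (Cons k ks)
    have "t ^ (2 * k) \<le> t ^ 1"
      using that Cons.prems by (intro power_decreasing) auto
    then have "t ^ (2 * k) * a ^ (2 * k) \<le> t * a ^ (2 * k)"
      by (intro mult_right_mono) auto
    then show ?case
      using Cons by (simp add: power_mult_distrib distrib_left)
  qed simp
  have scale: "\<rho> (t *\<^sub>R z) \<le> t * \<rho> z" if "0 \<le> t" "t \<le> 1" for t z
    unfolding \<rho>_def sum_distrib_left
    using scale_list[OF that] assms that by (intro sum_mono) simp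
  have "z \<in> closure (Omega p)" if "\<rho> z \<le> 1" for z
  proof -
    define t :: "nat \<Rightarrow> real" where "t = (\<lambda>n. 1 - 1 / real (n + 1))"
    have t: "0 \<le> t n" "t n < 1" for n
      by (auto simp: t_def field_simps)
    have "t n *\<^sub>R z \<in> Omega p" for n
    proof -
      have "\<rho> (t n *\<^sub>R z) \<le> t n * \<rho> z"
        using scale t[of n] by simp
      also have "\<dots> \<le> t n * 1"
        using that t[of n] by (intro mult_left_mono) auto
      finally show ?thesis
        using t[of n] by (simp add: Omega)
    qed
    moreover have "t \<longlonglongrightarrow> 1 - 0"
      unfolding t_def
      by (intro tendsto_diff tendsto_const LIMSEQ_ignore_initial_segment[OF lim_1_over_n, of 1])
    then have "(\<lambda>n. t n *\<^sub>R z) \<longlonglongrightarrow> (1 - 0) *\<^sub>R z"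
      by (intro tendsto_intros)
    ultimately show ?thesis
      unfolding closure_sequential by (intro exI[of _ "\<lambda>n. t n *\<^sub>R z"]) simp
  qed
  moreover have "closure (Omega p) \<subseteq> {z. \<rho> z \<le> 1}"
    by (intro closure_minimal closed) (auto simp: Omega)
  ultimately have closure: "closure (Omega p) = {z. \<rho> z \<le> 1}"
    by blast
  then show "closure (Omega p) = {z. (\<Sum>i\<in>UNIV. \<Sum>k\<leftarrow>p i. norm (z $ i) ^ (2 * k)) \<le> 1}"
    by (simp add: \<rho>_def)
  have "frontier (Omega p) = {z. \<rho> z = 1}"
    unfolding frontier_def interior_open[OF open_Omega] closure by (auto simp: Omega)
  then show "frontier (Omega p) = {z. (\<Sum>i\<in>UNIV. \<Sum>k\<leftarrow>p i. norm (z $ i) ^ (2 * k)) = 1}"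
    by (simp add: \<rho>_def)
qed

end

theory Submission
  imports Defs "HOL-Complex_Analysis.Cauchy_Integral_Formula"
begin

text \<open>
  The surface measure is invariant under rotation of each coordinate, so the monomials are
  orthogonal and, normalized, form an orthonormal basis \<open>e \<alpha>\<close> of the Hardy space. By orthogonality of the
  functions \<open>(1 - P) (cnj z\<^sub>i * e \<alpha>)\<close>, where \<open>P\<close> is the projection onto the Hardy space, the
  operator \<open>f \<mapsto> (1 - P) (cnj z\<^sub>i * f)\<close> is compact as soon as their norms tend to \<open>0\<close>, and
  then so is every commutator \<open>M\<^sub>i\<^sup>* M\<^sub>j - M\<^sub>j M\<^sub>i\<^sup>*\<close>. The square of this norm is the difference of the
  mean values of \<open>\<bar>z\<^sub>i\<bar>\<^sup>2\<close> for two neighbouring weights \<open>\<bar>z\<^sup>\<alpha>\<bar>\<^sup>2\<close>. These weights concentrate: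
  the domain is logarithmically convex, with a strict inequality away from the diagonal, and the
  measure charges every piece of the boundary that is cut out by \<open>\<bar>z\<^sub>1\<bar>\<close> lying in an interval.
  No asymptotic formula for the moments is needed.
\<close>

section \<open>Square integrable functions\<close>

text \<open>With \<open>X = |z_i|^2\<close> and \<open>m n\<close> the moment of \<open>X^n\<close>
  against a fixed power of \<open>|z_j|^2\<close>, the two mean values of the overview are
  \<open>m (n+2) / m (n+1)\<close> and \<open>m (n+1) / m n\<close>. Cleared of denominators, their
  difference is an iterated integral of \<open>X' * (X' - X)\<close> against the weights at two
  boundary points. The product of these weights is the square of the weight at the geometric mean of
  the points. If the \<open>X\<close>-values differ clearly, this mean lies well inside the domain,
  and pushing it outward by \<open>1/q\<close> gains \<open>q^-(k+l)\<close>. Moments are bounded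
  below up to a loss \<open>s^(k+l)\<close> with \<open>s < 1\<close> as close to 1 as wanted, so
  the gain wins; such a crude bound asks only for positive mass of bands of the boundary. The other
  obstacle is density of the monomials: a function in \<open>A_algebra\<close> has a power series
  inside the domain only, but approximation is needed on the boundary. It is obtained one coordinate
  at a time, along discs that shrink this coordinate and stay in the closed domain. Projections are
  built on functions, where they are determined almost everywhere; classes appear at the
  end.\<close>

lemma borel_measurable_cnj [measurable]: "cnj \<in> borel_measurable borel"
  by (intro borel_measurable_continuous_onI continuous_intros)

definition L2_inner :: "'a measure \<Rightarrow> ('a \<Rightarrow> complex) \<Rightarrow> ('a \<Rightarrow> complex) \<Rightarrow> complex" where
  "L2_inner M f g = (\<integral>x. f x * cnj (g x) \<partial>M)"

definition L2_norm :: "'a measure \<Rightarrow> ('a \<Rightarrow> complex) \<Rightarrow> real" where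
  "L2_norm M f = sqrt (\<integral>x. (norm (f x))\<^sup>2 \<partial>M)"

lemma L2_measurable: "f \<in> square_integrable M \<Longrightarrow> f \<in> borel_measurable M"
  by (simp add: square_integrable_def)

lemma L2_integrable:
  "f \<in> square_integrable M \<Longrightarrow> integrable M (\<lambda>x. (norm (f x))\<^sup>2)"
  by (simp add: square_integrable_def)

lemma L2_bounded_mult:
  assumes f: "f \<in> square_integrable M" and b: "b \<in> borel_measurable M"
    and C: "\<And>x. x \<in> space M \<Longrightarrow> norm (b x) \<le> C"
  shows "(\<lambda>x. b x * f x) \<in> square_integrable M"
proof -
  note [measurable] = L2_measurable[OF f] b
  have "integrable M (\<lambda>x. (norm (b x * f x))\<^sup>2)"
  proof (rule Bochner_Integration.integrable_bound)
    show "integrable M (\<lambda>x. C\<^sup>2 * (norm (f x))\<^sup>2)"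
      using L2_integrable[OF f] by simp
    show "AE x in M. norm ((norm (b x * f x))\<^sup>2) \<le> norm (C\<^sup>2 * (norm (f x))\<^sup>2)"
      using C by (intro AE_I2)
        (auto simp: norm_mult power_mult_distrib intro!: mult_right_mono power_mono)
  qed simp
  then show ?thesis by (simp add: square_integrable_def)
qed

lemma L2_cmult:
  assumes "f \<in> square_integrable M" shows "(\<lambda>x. c * f x) \<in> square_integrable M"
  by (rule L2_bounded_mult[OF assms, where C = "norm c"]) auto

lemma L2_add:
  assumes f: "f \<in> square_integrable M" and g: "g \<in> square_integrable M"
  shows "(\<lambda>x. f x + g x) \<in> square_integrable M"
proof -
  note [measurable] = L2_measurable[OF f] L2_measurable[OF g]
  have "(norm (a + b))\<^sup>2 \<le> 2 * (norm a)\<^sup>2 + 2 * (norm b)\<^sup>2" for a b :: complex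
  proof -
    have "(norm (a + b))\<^sup>2 \<le> (norm a + norm b)\<^sup>2"
      by (intro power_mono norm_triangle_ineq) simp
    also have "\<dots> = (norm a)\<^sup>2 + (norm b)\<^sup>2 + 2 * norm a * norm b"
      by (rule power2_sum)
    finally show ?thesis
      using sum_squares_bound[of "norm a" "norm b"] by linarith
  qed
  then have le: "AE x in M. norm ((norm (f x + g x))\<^sup>2) \<le> norm (2 * (norm (f x))\<^sup>2 + 2 * (norm (g x))\<^sup>2)"
    by (intro AE_I2) (smt (verit) real_norm_def zero_le_power2)
  have "integrable M (\<lambda>x. 2 * (norm (f x))\<^sup>2 + 2 * (norm (g x))\<^sup>2)"
    by (simp add: L2_integrable f g)
  then have "integrable M (\<lambda>x. (norm (f x + g x))\<^sup>2)"
    by (rule Bochner_Integration.integrable_bound[OF _ _ le]) simp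
  then show ?thesis by (simp add: square_integrable_def)
qed

lemma L2_diff:
  assumes "f \<in> square_integrable M" "g \<in> square_integrable M"
  shows "(\<lambda>x. f x - g x) \<in> square_integrable M"
  using L2_add[OF assms(1) L2_cmult[OF assms(2), of "-1"]] by simp

lemma L2_sum:
  assumes "\<And>i. i \<in> A \<Longrightarrow> f i \<in> square_integrable M"
  shows "(\<lambda>x. \<Sum>i\<in>A. f i x) \<in> square_integrable M"
proof (cases "finite A")
  case True
  then show ?thesis using assms
  proof (induction A)
    case (insert a A)
    then show ?case by (simp add: L2_add)
  qed (simp add: square_integrable_def)
qed (simp add: square_integrable_def)

lemma L2_bounded:
  assumes "finite_measure M" "b \<in> borel_measurable M" "\<And>x. x \<in> space M \<Longrightarrow> norm (b x) \<le> C"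
  shows "b \<in> square_integrable M"
proof -
  have "(\<lambda>_. 1) \<in> square_integrable M"
    using assms(1) by (simp add: square_integrable_def finite_measure.integrable_const)
  from L2_bounded_mult[OF this assms(2,3)] show ?thesis by simp
qed

lemma L2_integrable_mult:
  assumes f: "f \<in> square_integrable M" and g: "g \<in> square_integrable M"
  shows "integrable M (\<lambda>x. f x * cnj (g x))"
proof -
  note [measurable] = L2_measurable[OF f] L2_measurable[OF g]
  have "norm a * norm b \<le> (norm a)\<^sup>2 + (norm b)\<^sup>2" for a b :: complex
  proof -
    have "2 * norm a * norm b \<le> (norm a)\<^sup>2 + (norm b)\<^sup>2" by (rule sum_squares_bound)
    moreover have "0 \<le> norm a * norm b" by simp
    ultimately show ?thesis by linarith
  qed
  then have le: "AE x in M. norm (f x * cnj (g x)) \<le> norm ((norm (f x))\<^sup>2 + (norm (g x))\<^sup>2)"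
    by (intro AE_I2) (simp add: norm_mult)
  have "integrable M (\<lambda>x. (norm (f x))\<^sup>2 + (norm (g x))\<^sup>2)"
    by (simp add: L2_integrable f g)
  then show ?thesis
    by (rule Bochner_Integration.integrable_bound[OF _ _ le]) simp
qed

lemma L2_norm_nonneg [simp]: "0 \<le> L2_norm M f"
  by (simp add: L2_norm_def)

lemma L2_norm_square: "(L2_norm M f)\<^sup>2 = (\<integral>x. (norm (f x))\<^sup>2 \<partial>M)"
  by (simp add: L2_norm_def)

lemma L2_inner_self: "L2_inner M f f = of_real ((L2_norm M f)\<^sup>2)"
proof -
  have "L2_inner M f f = (\<integral>x. complex_of_real ((norm (f x))\<^sup>2) \<partial>M)"
    unfolding L2_inner_def by (intro Bochner_Integration.integral_cong refl)
      (simp add: complex_norm_square del: of_real_power)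
  then show ?thesis by (simp only: integral_complex_of_real L2_norm_square)
qed

lemma L2_inner_cnj: "cnj (L2_inner M f g) = L2_inner M g f"
proof -
  have "cnj (L2_inner M f g) = (\<integral>x. cnj (f x * cnj (g x)) \<partial>M)"
    unfolding L2_inner_def by (rule Bochner_Integration.integral_cnj[symmetric])
  then show ?thesis by (simp add: L2_inner_def mult.commute)
qed

lemma L2_norm_minus_commute: "L2_norm M (\<lambda>x. f x - g x) = L2_norm M (\<lambda>x. g x - f x)"
  by (simp add: L2_norm_def norm_minus_commute)

context
  fixes M :: "'a measure" and f g h :: "'a \<Rightarrow> complex"
  assumes f: "f \<in> square_integrable M" and g: "g \<in> square_integrable M"
    and h: "h \<in> square_integrable M"
begin

lemma L2_inner_add_left: "L2_inner M (\<lambda>x. f x + g x) h = L2_inner M f h + L2_inner M g h"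
  using L2_integrable_mult[OF f h] L2_integrable_mult[OF g h]
  by (simp add: L2_inner_def distrib_right)

lemma L2_inner_diff_left: "L2_inner M (\<lambda>x. f x - g x) h = L2_inner M f h - L2_inner M g h"
  using L2_integrable_mult[OF f h] L2_integrable_mult[OF g h]
  by (simp add: L2_inner_def left_diff_distrib)

lemma L2_inner_diff_right: "L2_inner M h (\<lambda>x. f x - g x) = L2_inner M h f - L2_inner M h g"
  using L2_integrable_mult[OF h f] L2_integrable_mult[OF h g]
  by (simp add: L2_inner_def right_diff_distrib)

end

lemma L2_inner_cmult_left: "L2_inner M (\<lambda>x. c * f x) h = c * L2_inner M f h"
  by (simp add: L2_inner_def mult.assoc)

lemma L2_inner_sum_left:
  assumes "\<And>i. i \<in> A \<Longrightarrow> f i \<in> square_integrable M" "h \<in> square_integrable M"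
  shows "L2_inner M (\<lambda>x. \<Sum>i\<in>A. f i x) h = (\<Sum>i\<in>A. L2_inner M (f i) h)"
  using L2_integrable_mult[OF assms] by (simp add: L2_inner_def sum_distrib_right)

lemma L2_norm_cmult: "L2_norm M (\<lambda>x. c * f x) = norm c * L2_norm M f"
  by (simp add: L2_norm_def norm_mult power_mult_distrib real_sqrt_mult)

text \<open>The absolute values stay inside the integral so that the choice \<open>g = 1\<close>
  bounds an \<open>L^1\<close> norm by an \<open>L^2\<close> norm, as completeness requires.\<close>

lemma L2_cauchy_schwarz:
  assumes f: "f \<in> square_integrable M" and g: "g \<in> square_integrable M"
  shows "(\<integral>x. norm (f x) * norm (g x) \<partial>M) \<le> L2_norm M f * L2_norm M g"
proof -
  note [measurable] = L2_measurable[OF f] L2_measurable[OF g]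
  have int: "integrable M (\<lambda>x. norm (f x) * norm (g x))"
    using integrable_norm[OF L2_integrable_mult[OF f g]] by (simp add: norm_mult)
  have sq: "(\<integral>\<^sup>+x. (ennreal (norm (h x)))\<^sup>2 \<partial>M) = ennreal ((L2_norm M h)\<^sup>2)"
    if "h \<in> square_integrable M" for h
    using nn_integral_eq_integral[OF L2_integrable[OF that]]
    by (simp add: L2_norm_square ennreal_power)
  have "(ennreal (\<integral>x. norm (f x) * norm (g x) \<partial>M))\<^sup>2
      = (\<integral>\<^sup>+x. ennreal (norm (f x)) * ennreal (norm (g x)) \<partial>M)\<^sup>2"
    using nn_integral_eq_integral[OF int] by (simp add: ennreal_mult')
  also have "\<dots> \<le> (\<integral>\<^sup>+x. (ennreal (norm (f x)))\<^sup>2 \<partial>M) * (\<integral>\<^sup>+x. (ennreal (norm (g x)))\<^sup>2 \<partial>M)"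
    by (rule Cauchy_Schwarz_nn_integral) simp_all
  also have "\<dots> = ennreal ((L2_norm M f)\<^sup>2 * (L2_norm M g)\<^sup>2)"
    unfolding sq[OF f] sq[OF g] by (rule ennreal_mult'[symmetric]) simp
  finally have "ennreal ((\<integral>x. norm (f x) * norm (g x) \<partial>M)\<^sup>2)
      \<le> ennreal ((L2_norm M f)\<^sup>2 * (L2_norm M g)\<^sup>2)"
    by (subst (asm) ennreal_power) simp_all
  then have "(\<integral>x. norm (f x) * norm (g x) \<partial>M)\<^sup>2 \<le> (L2_norm M f * L2_norm M g)\<^sup>2"
    unfolding power_mult_distrib by (subst (asm) ennreal_le_iff) simp_all
  then show ?thesis
    by (rule power2_le_imp_le) simp
qed

lemma L2_inner_le:
  assumes f: "f \<in> square_integrable M" and g: "g \<in> square_integrable M"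
  shows "norm (L2_inner M f g) \<le> L2_norm M f * L2_norm M g"
proof -
  have "norm (L2_inner M f g) \<le> (\<integral>x. norm (f x * cnj (g x)) \<partial>M)"
    unfolding L2_inner_def by (rule integral_norm_bound)
  with L2_cauchy_schwarz[OF assms] show ?thesis by (simp add: norm_mult)
qed

text \<open>For vanishing inner product this is Pythagoras, the form used for orthogonal sums and
  for nearest points.\<close>

lemma L2_norm_add_square:
  assumes f: "f \<in> square_integrable M" and g: "g \<in> square_integrable M"
  shows "(L2_norm M (\<lambda>x. f x + g x))\<^sup>2
    = (L2_norm M f)\<^sup>2 + (L2_norm M g)\<^sup>2 + 2 * Re (L2_inner M f g)"
proof -
  have "(norm (a + b))\<^sup>2 = (norm a)\<^sup>2 + (norm b)\<^sup>2 + 2 * Re (a * cnj b)" for a b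
    unfolding cmod_power2 by (simp add: power2_eq_square algebra_simps)
  then have "(L2_norm M (\<lambda>x. f x + g x))\<^sup>2
      = (\<integral>x. (norm (f x))\<^sup>2 + (norm (g x))\<^sup>2 + 2 * Re (f x * cnj (g x)) \<partial>M)"
    by (simp add: L2_norm_square)
  also have "\<dots> = (L2_norm M f)\<^sup>2 + (L2_norm M g)\<^sup>2 + 2 * Re (L2_inner M f g)"
    unfolding L2_norm_square L2_inner_def
    using L2_integrable_mult[OF f g] L2_integrable[OF f]
      L2_integrable[OF g]
    by (subst Bochner_Integration.integral_add; (subst Bochner_Integration.integral_add)?)
      (auto simp del: times_complex.simps complex_cnj_mult)
  finally show ?thesis .
qed

lemma L2_norm_triangle:
  assumes f: "f \<in> square_integrable M" and g: "g \<in> square_integrable M"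
  shows "L2_norm M (\<lambda>x. f x + g x) \<le> L2_norm M f + L2_norm M g"
proof (rule power2_le_imp_le)
  have "Re (L2_inner M f g) \<le> L2_norm M f * L2_norm M g"
    using L2_inner_le[OF assms] complex_Re_le_cmod[of "L2_inner M f g"] by linarith
  then show "(L2_norm M (\<lambda>x. f x + g x))\<^sup>2 \<le> (L2_norm M f + L2_norm M g)\<^sup>2"
    unfolding L2_norm_add_square[OF assms] power2_sum by linarith
qed simp

lemma L2_norm_triangle3:
  assumes "f \<in> square_integrable M" "g \<in> square_integrable M" "h \<in> square_integrable M"
  shows "L2_norm M (\<lambda>x. f x - h x) \<le> L2_norm M (\<lambda>x. f x - g x) + L2_norm M (\<lambda>x. g x - h x)"
  using L2_norm_triangle[OF L2_diff[OF assms(1,2)] L2_diff[OF assms(2,3)]]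
  by simp

lemma L2_norm_sum_le:
  assumes "\<And>i. i \<in> A \<Longrightarrow> f i \<in> square_integrable M"
  shows "L2_norm M (\<lambda>x. \<Sum>i\<in>A. f i x) \<le> (\<Sum>i\<in>A. L2_norm M (f i))"
proof (cases "finite A")
  case True
  then show ?thesis using assms
  proof (induction A)
    case (insert a A)
    have "L2_norm M (\<lambda>x. f a x + (\<Sum>i\<in>A. f i x)) \<le> L2_norm M (f a) + L2_norm M (\<lambda>x. \<Sum>i\<in>A. f i x)"
      by (intro L2_norm_triangle L2_sum) (auto intro: insert.prems)
    with insert show ?case by fastforce
  qed (simp add: L2_norm_def)
qed (simp add: L2_norm_def)

lemma L2_norm_bounded_mult:
  assumes f: "f \<in> square_integrable M" and b: "b \<in> borel_measurable M"
    and C: "\<And>x. x \<in> space M \<Longrightarrow> norm (b x) \<le> C" "0 \<le> C"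
  shows "L2_norm M (\<lambda>x. b x * f x) \<le> C * L2_norm M f"
proof -
  have "(\<integral>x. (norm (b x * f x))\<^sup>2 \<partial>M) \<le> (\<integral>x. C\<^sup>2 * (norm (f x))\<^sup>2 \<partial>M)"
    using L2_integrable[OF f]
      L2_integrable[OF L2_bounded_mult[OF f b C(1)]] C
    by (intro integral_mono) (auto simp: norm_mult power_mult_distrib intro!: mult_right_mono power_mono)
  then have "sqrt (\<integral>x. (norm (b x * f x))\<^sup>2 \<partial>M) \<le> sqrt (C\<^sup>2 * (\<integral>x. (norm (f x))\<^sup>2 \<partial>M))"
    by simp
  then show ?thesis
    using C(2) by (simp only: L2_norm_def real_sqrt_mult real_sqrt_abs abs_of_nonneg)
qed

lemma L2_norm_uniform_bound:
  assumes "finite_measure M" and [measurable]: "f \<in> borel_measurable M"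
    and C: "\<And>x. x \<in> space M \<Longrightarrow> norm (f x) \<le> C" "0 \<le> C"
  shows "L2_norm M f \<le> C * sqrt (measure M (space M))"
proof -
  have "(\<lambda>_. 1) \<in> square_integrable M"
    using assms(1) by (simp add: square_integrable_def finite_measure.integrable_const)
  from L2_norm_bounded_mult[OF this assms(2) C] show ?thesis
    by (simp add: L2_norm_def)
qed

lemma L2_norm_eq_0_iff:
  assumes f: "f \<in> square_integrable M"
  shows "L2_norm M f = 0 \<longleftrightarrow> (AE x in M. f x = 0)"
  using integral_nonneg_eq_0_iff_AE[OF L2_integrable[OF f]]
  by (simp add: L2_norm_def)

lemma L2_inner_cong_AE:
  assumes [measurable]: "f \<in> borel_measurable M" "f' \<in> borel_measurable M"
      "g \<in> borel_measurable M" "g' \<in> borel_measurable M"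
    and "AE x in M. f x = f' x" "AE x in M. g x = g' x"
  shows "L2_inner M f g = L2_inner M f' g'"
  unfolding L2_inner_def using assms(5,6) by (intro integral_cong_AE) auto

text \<open>Riesz-Fischer: a subsequence with differences below \<open>(1/2)^k\<close> converges
  almost everywhere, because finiteness of the measure makes these differences summable in
  \<open>L^1\<close>. Fatou's lemma turns the pointwise limit into a limit in norm of the whole
  sequence.\<close>

lemma L2_complete:
  fixes u :: "nat \<Rightarrow> 'a \<Rightarrow> complex"
  assumes "finite_measure M" and u: "\<And>n. u n \<in> square_integrable M"
    and Cauchy: "\<And>e. e > 0 \<Longrightarrow> \<exists>N. \<forall>m\<ge>N. \<forall>n\<ge>N. L2_norm M (\<lambda>x. u m x - u n x) < e"
  obtains f where "f \<in> square_integrable M" "(\<lambda>n. L2_norm M (\<lambda>x. u n x - f x)) \<longlonglongrightarrow> 0"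
proof -
  interpret finite_measure M by fact
  have [measurable]: "u n \<in> borel_measurable M" for n
    using u by (rule L2_measurable)
  note si = L2_diff[OF u u]
  have nn: "(\<integral>\<^sup>+x. ennreal ((norm (u m x - u n x))\<^sup>2) \<partial>M)
      = ennreal ((L2_norm M (\<lambda>x. u m x - u n x))\<^sup>2)" for m n
    unfolding L2_norm_square
    by (rule nn_integral_eq_integral[OF L2_integrable[OF si]]) simp
  have "\<forall>k. \<exists>N. \<forall>m\<ge>N. \<forall>n\<ge>N. L2_norm M (\<lambda>x. u m x - u n x) < (1/2)^k"
    using Cauchy by simp
  then obtain N where "\<forall>k. \<forall>m\<ge>N k. \<forall>n\<ge>N k. L2_norm M (\<lambda>x. u m x - u n x) < (1/2)^k"
    by (rule choice[THEN exE])
  then have N: "L2_norm M (\<lambda>x. u m x - u n x) < (1/2)^k" if "m \<ge> N k" "n \<ge> N k" for k m n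
    using that by blast
  \<comment> \<open>The partial sum dominates \<open>N k\<close>; the summand \<open>k\<close> makes
    the sequence strictly increasing.\<close>
  define r where "r k = (\<Sum>i\<le>k. N i) + k" for k
  have rN: "r k \<ge> N k" for k
    unfolding r_def using member_le_sum[of k "{..k}" N] by simp
  have r: "strict_mono r"
    by (rule strict_monoI_Suc) (simp add: r_def)
  define d where "d k x = u (r (Suc k)) x - u (r k) x" for k x
  have [measurable]: "d k \<in> borel_measurable M" for k
    unfolding d_def by simp
  have d: "(\<integral>x. norm (d k x) \<partial>M) \<le> (1/2)^k * L2_norm M (\<lambda>_. 1)" for k
  proof -
    have one: "(\<lambda>_. 1) \<in> square_integrable M"
      by (simp add: square_integrable_def)
    have "L2_norm M (d k) < (1/2)^k"
      unfolding d_def using rN r strict_monoD[OF r, of k "Suc k"]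
      by (intro N) (auto intro: order_trans[OF rN])
    then have "L2_norm M (d k) * L2_norm M (\<lambda>_. 1) \<le> (1/2)^k * L2_norm M (\<lambda>_. 1)"
      by (intro mult_right_mono) auto
    moreover have "(\<integral>x. norm (d k x) \<partial>M) \<le> L2_norm M (d k) * L2_norm M (\<lambda>_. 1)"
      using L2_cauchy_schwarz[of "d k" M "\<lambda>_. 1"] one si by (simp add: d_def[abs_def])
    ultimately show ?thesis by linarith
  qed
  have dint: "integrable M (\<lambda>x. norm (d k x))" for k
    using L2_integrable_mult[of "d k" M "\<lambda>_. 1"] si
    by (intro integrable_norm) (auto simp: d_def[abs_def] square_integrable_def)
  have "(\<integral>\<^sup>+x. (\<Sum>k. ennreal (norm (d k x))) \<partial>M) = (\<Sum>k. \<integral>\<^sup>+x. ennreal (norm (d k x)) \<partial>M)"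
    by (rule nn_integral_suminf) simp
  also have "\<dots> \<le> (\<Sum>k. ennreal ((1/2)^k * L2_norm M (\<lambda>_. 1)))"
    using d by (intro suminf_le) (auto simp: nn_integral_eq_integral[OF dint] ennreal_leI)
  also have "\<dots> < \<infinity>"
    by (subst suminf_ennreal2) (auto intro!: summable_mult2 summable_geometric)
  finally have "AE x in M. (\<Sum>k. ennreal (norm (d k x))) \<noteq> \<infinity>"
    by (intro nn_integral_PInf_AE) auto
  then have conv: "AE x in M. convergent (\<lambda>k. u (r k) x)"
  proof (rule AE_mp, intro AE_I2 impI)
    fix x assume "(\<Sum>k. ennreal (norm (d k x))) \<noteq> \<infinity>"
    then have "summable (\<lambda>k. norm (d k x))"
      by (intro summable_suminf_not_top) auto
    then have "convergent (\<lambda>n. \<Sum>k<n. d k x)"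
      by (simp add: summable_iff_convergent[symmetric] summable_norm_cancel)
    moreover have "(\<Sum>k<n. d k x) = u (r n) x - u (r 0) x" for n
      unfolding d_def by (rule sum_lessThan_telescope)
    ultimately show "convergent (\<lambda>k. u (r k) x)"
      by (simp add: convergent_diff_const_right_iff)
  qed
  \<comment> \<open>Where the subsequence diverges, \<open>lim\<close> returns an unspecified value;
    this happens on a null set only.\<close>
  define f where "f x = lim (\<lambda>k. u (r k) x)" for x
  have [measurable]: "f \<in> borel_measurable M"
    unfolding f_def by (rule borel_measurable_lim_metric) simp
  have bound: "(\<integral>\<^sup>+x. ennreal ((norm (u m x - f x))\<^sup>2) \<partial>M) \<le> ennreal (((1/2)^k)\<^sup>2)" if m: "m \<ge> N k" for m k
  proof -
    have "(\<integral>\<^sup>+x. ennreal ((norm (u m x - f x))\<^sup>2) \<partial>M)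
        = (\<integral>\<^sup>+x. liminf (\<lambda>n. ennreal ((norm (u m x - u (r n) x))\<^sup>2)) \<partial>M)"
    proof (rule nn_integral_cong_AE, rule AE_mp[OF conv], intro AE_I2 impI)
      fix x assume "convergent (\<lambda>k. u (r k) x)"
      then have "(\<lambda>n. ennreal ((norm (u m x - u (r n) x))\<^sup>2)) \<longlonglongrightarrow> ennreal ((norm (u m x - f x))\<^sup>2)"
        unfolding f_def convergent_LIMSEQ_iff by (intro tendsto_intros)
      then show "ennreal ((norm (u m x - f x))\<^sup>2) = liminf (\<lambda>n. ennreal ((norm (u m x - u (r n) x))\<^sup>2))"
        by (rule lim_imp_Liminf[OF trivial_limit_sequentially, symmetric])
    qed
    \<comment> \<open>Fatou's lemma, with \<open>m\<close> fixed while the subsequence runs.\<close>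
    also have "\<dots> \<le> liminf (\<lambda>n. \<integral>\<^sup>+x. ennreal ((norm (u m x - u (r n) x))\<^sup>2) \<partial>M)"
      by (rule nn_integral_liminf) simp
    also have "\<dots> \<le> liminf (\<lambda>n. ennreal (((1/2)^k)\<^sup>2))"
    proof (rule Liminf_mono, rule eventually_sequentiallyI)
      fix n assume "N k \<le> n"
      then have "N k \<le> r n" using seq_suble[OF r, of n] by simp
      then show "(\<integral>\<^sup>+x. ennreal ((norm (u m x - u (r n) x))\<^sup>2) \<partial>M) \<le> ennreal (((1/2)^k)\<^sup>2)"
        unfolding nn using N[OF m] by (intro ennreal_leI power_mono) (auto intro: less_imp_le)
    qed
    also have "\<dots> = ennreal (((1/2)^k)\<^sup>2)"
      by (simp add: Liminf_const)
    finally show ?thesis .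
  qed
  have diff: "(\<lambda>x. u m x - f x) \<in> square_integrable M" if "m \<ge> N k" for m k
  proof -
    have "integrable M (\<lambda>x. (norm (u m x - f x))\<^sup>2)"
      using bound[OF that] by (intro integrableI_bounded) (auto intro: le_less_trans)
    then show ?thesis by (simp add: square_integrable_def)
  qed
  have norm: "L2_norm M (\<lambda>x. u m x - f x) \<le> (1/2)^k" if "m \<ge> N k" for m k
  proof -
    have "ennreal ((L2_norm M (\<lambda>x. u m x - f x))\<^sup>2) \<le> ennreal (((1/2)^k)\<^sup>2)"
      using bound[OF that] nn_integral_eq_integral[OF L2_integrable[OF diff[OF that]]]
      by (simp add: L2_norm_square)
    then have "(L2_norm M (\<lambda>x. u m x - f x))\<^sup>2 \<le> ((1/2)^k)\<^sup>2"
      by (subst (asm) ennreal_le_iff) simp_all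
    then show ?thesis by (rule power2_le_imp_le) simp
  qed
  have "f \<in> square_integrable M"
    using L2_diff[OF u diff[OF order_refl], of "N 0" 0] by simp
  moreover have "(\<lambda>n. L2_norm M (\<lambda>x. u n x - f x)) \<longlonglongrightarrow> 0"
  proof (rule LIMSEQ_I)
    fix e :: real assume "e > 0"
    then obtain k where "(1/2)^k < e"
      using real_arch_pow_inv[of e "1/2"] by auto
    then show "\<exists>no. \<forall>n\<ge>no. norm (L2_norm M (\<lambda>x. u n x - f x) - 0) < e"
      using norm[of k] by (intro exI[of _ "N k"]) (auto intro: le_less_trans)
  qed
  ultimately show thesis by (rule that)
qed

text \<open>The combinations are functions and not classes, so that the same notion serves uniform
  approximation on the closed domain and approximation in \<open>L^2\<close>.\<close>

definition function_span :: "('i \<Rightarrow> 'a \<Rightarrow> complex) \<Rightarrow> ('a \<Rightarrow> complex) set" where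
  "function_span e = {f. \<exists>A c. finite A \<and> f = (\<lambda>x. \<Sum>i\<in>A. c i * e i x)}"

lemma function_span_0: "(\<lambda>_. 0) \<in> function_span e"
  unfolding function_span_def by (intro CollectI exI[of _ "{}"]) simp

lemma function_span_base: "(\<lambda>x. c * e i x) \<in> function_span e"
  unfolding function_span_def by (intro CollectI exI[of _ "{i}"] exI[of _ "\<lambda>_. c"]) simp

lemma function_span_cmult: "f \<in> function_span e \<Longrightarrow> (\<lambda>x. c * f x) \<in> function_span e"
proof -
  assume "f \<in> function_span e"
  then obtain A b where "finite A" "f = (\<lambda>x. \<Sum>i\<in>A. b i * e i x)"
    by (auto simp: function_span_def)
  then show ?thesis
    unfolding function_span_def
    by (intro CollectI exI[of _ A] exI[of _ "\<lambda>i. c * b i"]) (simp add: sum_distrib_left mult.assoc)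
qed

lemma function_span_add:
  assumes "f \<in> function_span e" "g \<in> function_span e"
  shows "(\<lambda>x. f x + g x) \<in> function_span e"
proof -
  obtain A b B c where A: "finite A" "f = (\<lambda>x. \<Sum>i\<in>A. b i * e i x)"
    and B: "finite B" "g = (\<lambda>x. \<Sum>i\<in>B. c i * e i x)"
    using assms by (auto simp: function_span_def)
  have "f x + g x = (\<Sum>i\<in>A \<union> B. ((if i \<in> A then b i else 0) + (if i \<in> B then c i else 0)) * e i x)" for x
    using A B by (simp add: distrib_right sum.distrib if_distribR sum.If_cases Int_absorb1 Int_absorb2
        Un_Int_eq if_distrib[where f = "\<lambda>y. y * _"] cong: if_cong)
  then show ?thesis
    using A B unfolding function_span_def
    by (intro CollectI exI[of _ "A \<union> B"]
        exI[of _ "\<lambda>i. (if i \<in> A then b i else 0) + (if i \<in> B then c i else 0)"]) auto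
qed

lemma function_span_sum:
  "(\<And>i. i \<in> A \<Longrightarrow> f i \<in> function_span e) \<Longrightarrow> (\<lambda>x. \<Sum>i\<in>A. f i x) \<in> function_span e"
  by (induction A rule: infinite_finite_induct) (auto intro: function_span_0 function_span_add)

text \<open>The factor \<open>b = 1\<close> yields inclusions between spans, a coordinate function
  as \<open>b\<close> yields invariance under multiplication.\<close>

lemma function_span_linear_image:
  assumes "f \<in> function_span e"
    and "\<And>i. (\<lambda>x. b x * e i x) \<in> function_span e'"
  shows "(\<lambda>x. b x * f x) \<in> function_span e'"
proof -
  obtain A c where f: "f = (\<lambda>x. \<Sum>i\<in>A. c i * e i x)"
    using assms by (auto simp: function_span_def)
  have "b x * f x = (\<Sum>i\<in>A. c i * (b x * e i x))" for x
    by (simp add: f sum_distrib_left mult_ac)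
  then show ?thesis
    using assms(2) by (simp add: function_span_sum function_span_cmult)
qed

section \<open>Hausdorff measure\<close>

text \<open>The images of the pieces of a covering cover the image and have no larger
  diameter.\<close>

lemma hausdorff_content_lipschitz_le:
  fixes f :: "'a::metric_space \<Rightarrow> 'b::metric_space"
  assumes lip: "\<And>x y. dist (f x) (f y) \<le> dist x y"
  shows "hausdorff_content k \<delta> (f ` A) \<le> hausdorff_content k \<delta> A"
  unfolding hausdorff_content_def
proof (rule INF_greatest)
  fix C :: "nat \<Rightarrow> 'a set"
  assume "C \<in> {C. A \<subseteq> (\<Union>n. C n) \<and> (\<forall>n. bounded (C n) \<and> diameter (C n) \<le> \<delta>)}"
  then have C: "A \<subseteq> (\<Union>n. C n)" "\<And>n. bounded (C n)" "\<And>n. diameter (C n) \<le> \<delta>" by auto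
  have diam: "diameter (f ` C n) \<le> diameter (C n)" for n
  proof (cases "C n = {}")
    case False
    have "dist (f x) (f y) \<le> diameter (C n)" if "x \<in> C n" "y \<in> C n" for x y
      using lip[of x y] diameter_bounded_bound[OF C(2) that] by linarith
    with False show ?thesis
      by (auto simp: diameter_def[of "f ` C n"] intro!: cSUP_least)
  qed simp
  have bnd: "bounded (f ` C n)" for n
  proof -
    obtain e x where "\<And>y. y \<in> C n \<Longrightarrow> dist x y \<le> e"
      using C(2)[of n] by (auto simp: bounded_def)
    then show ?thesis
      unfolding bounded_def by (intro exI[of _ "f x"] exI[of _ e]) (auto intro: order_trans[OF lip])
  qed
  have "(\<lambda>n. f ` C n) \<in> {C. f ` A \<subseteq> (\<Union>n. C n) \<and> (\<forall>n. bounded (C n) \<and> diameter (C n) \<le> \<delta>)}"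
  proof (intro CollectI conjI allI)
    show "f ` A \<subseteq> (\<Union>n. f ` C n)" using C(1) by blast
    show "bounded (f ` C n)" "diameter (f ` C n) \<le> \<delta>" for n
      using bnd order_trans[OF diam C(3)] by simp_all
  qed
  moreover have "(\<Sum>n. ennreal (diameter (f ` C n) ^ k)) \<le> (\<Sum>n. ennreal (diameter (C n) ^ k))"
    using diam bnd by (intro suminf_le ennreal_leI power_mono) (auto intro: diameter_ge_0)
  ultimately show "(INF C\<in>{C. f ` A \<subseteq> (\<Union>n. C n) \<and> (\<forall>n. bounded (C n) \<and> diameter (C n) \<le> \<delta>)}.
      \<Sum>n. ennreal (diameter (C n) ^ k)) \<le> (\<Sum>n. ennreal (diameter (C n) ^ k))"
    by - (rule INF_lower2[of "\<lambda>n. f ` C n"])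
qed

lemma hausdorff_outer_lipschitz_le:
  assumes "\<And>x y. dist (f x) (f y) \<le> dist x y"
  shows "hausdorff_outer k (f ` A) \<le> hausdorff_outer k A"
  unfolding hausdorff_outer_def by (intro SUP_mono) (use hausdorff_content_lipschitz_le[OF assms] in blast)

lemma hausdorff_outer_mono:
  assumes "A \<subseteq> B" shows "hausdorff_outer k A \<le> hausdorff_outer k B"
proof -
  have "hausdorff_content k \<delta> A \<le> hausdorff_content k \<delta> B" for \<delta>
    unfolding hausdorff_content_def using assms by (intro INF_superset_mono) auto
  then show ?thesis
    unfolding hausdorff_outer_def by (intro SUP_mono) blast
qed

text \<open>An isometry and its inverse are both contractions, which gives the two
  inequalities.\<close>

lemma hausdorff_outer_isometry:
  assumes iso: "\<And>x y. dist (f x) (f y) = dist x y" and g: "\<And>x. g (f x) = x" "\<And>y. f (g y) = y"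
  shows "hausdorff_outer k (f ` A) = hausdorff_outer k A"
proof (rule antisym)
  have "dist (g x) (g y) = dist x y" for x y
    using iso[of "g x" "g y"] g by simp
  then have "hausdorff_outer k (g ` f ` A) \<le> hausdorff_outer k (f ` A)"
    by (intro hausdorff_outer_lipschitz_le) simp
  then show "hausdorff_outer k A \<le> hausdorff_outer k (f ` A)"
    by (simp add: image_image g)
  show "hausdorff_outer k (f ` A) \<le> hausdorff_outer k A"
    using iso by (intro hausdorff_outer_lipschitz_le) simp
qed

text \<open>A bounded set of diameter \<open>d\<close> lies in the ball of radius \<open>d\<close>
  about any of its points, so the cost of a covering is at least the volume divided by that of the
  unit ball. Radius \<open>d\<close> instead of \<open>d/2\<close> loses a constant, which is
  harmless for positivity.\<close>

lemma lborel_le_hausdorff_outer: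
  fixes U :: "'a::euclidean_space set"
  assumes U: "U \<in> sets borel"
  shows "emeasure lborel U / ennreal (unit_ball_vol DIM('a)) \<le> hausdorff_outer DIM('a) U"
proof -
  define v where "v = unit_ball_vol (real DIM('a))"
  have v: "0 < v" by (simp add: v_def)
  have "emeasure lborel U / ennreal v \<le> hausdorff_content DIM('a) 1 U"
    unfolding hausdorff_content_def
  proof (rule INF_greatest)
    fix C :: "nat \<Rightarrow> 'a set"
    assume "C \<in> {C. U \<subseteq> (\<Union>n. C n) \<and> (\<forall>n. bounded (C n) \<and> diameter (C n) \<le> 1)}"
    then have C: "U \<subseteq> (\<Union>n. C n)" "\<And>n. bounded (C n)" by auto
    \<comment> \<open>For empty \<open>C n\<close> the centre is arbitrary and the radius is 0, so
      the ball adds no volume.\<close>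
    define B where "B n = cball (SOME x. x \<in> C n) (diameter (C n))" for n
    have CB: "C n \<subseteq> B n" for n
    proof
      fix y assume y: "y \<in> C n"
      then have "(SOME x. x \<in> C n) \<in> C n" by (rule someI)
      with y show "y \<in> B n"
        using diameter_bounded_bound[OF C(2)] by (simp add: B_def)
    qed
    have "B n \<in> sets borel" for n by (simp add: B_def)
    moreover have "U \<subseteq> (\<Union>n. B n)" using C(1) CB by blast
    ultimately have "emeasure lborel U \<le> emeasure lborel (\<Union>n. B n)"
      by (intro emeasure_mono) auto
    also have "\<dots> \<le> (\<Sum>n. emeasure lborel (B n))"
      by (rule emeasure_subadditive_countably) (auto simp: B_def)
    also have "\<dots> = (\<Sum>n. ennreal v * ennreal (diameter (C n) ^ DIM('a)))"
      using C(2) v unfolding B_def v_def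
      by (intro suminf_cong) (simp add: emeasure_cball diameter_ge_0 ennreal_mult')
    also have "\<dots> = ennreal v * (\<Sum>n. ennreal (diameter (C n) ^ DIM('a)))"
      by (rule ennreal_suminf_cmult)
    finally show "emeasure lborel U / ennreal v \<le> (\<Sum>n. ennreal (diameter (C n) ^ DIM('a)))"
      using v by (intro divide_le_posI_ennreal) (auto simp: mult.commute)
  qed
  also have "\<dots> \<le> hausdorff_outer DIM('a) U"
    unfolding hausdorff_outer_def by (rule SUP_upper) simp
  finally show ?thesis by (simp add: v_def)
qed

text \<open>The type of the target fixes the dimension: a contraction to a Euclidean space of
  dimension \<open>k\<close> whose image has interior detects positive \<open>k\<close>-dimensional
  measure of a subset of a larger space.\<close>

lemma hausdorff_outer_pos:
  fixes f :: "'a::metric_space \<Rightarrow> 'b::euclidean_space"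
  assumes lip: "\<And>x y. dist (f x) (f y) \<le> dist x y"
    and U: "open U" "U \<noteq> {}" "U \<subseteq> f ` A"
  shows "0 < hausdorff_outer DIM('b) A"
proof -
  obtain x r where x: "0 < r" "cball x r \<subseteq> U"
    using U(1,2) open_contains_cball by blast
  have "0 < emeasure lborel (cball x r)"
    using x by (simp add: emeasure_cball)
  also have "\<dots> \<le> emeasure lborel U"
    using x U by (intro emeasure_mono) auto
  finally have "0 < emeasure lborel U / ennreal (unit_ball_vol DIM('b))"
    by (simp add: ennreal_zero_less_divide)
  also have "\<dots> \<le> hausdorff_outer DIM('b) U"
    using U by (intro lborel_le_hausdorff_outer) auto
  also have "\<dots> \<le> hausdorff_outer DIM('b) (f ` A)"
    using U by (intro hausdorff_outer_mono)
  also have "\<dots> \<le> hausdorff_outer DIM('b) A"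
    by (intro hausdorff_outer_lipschitz_le lip)
  finally show ?thesis .
qed

section \<open>The Hausdorff measure on Borel sets and its normalization\<close>

lemma sets_hausdorff_measure [simp, measurable_cong]: "sets (hausdorff_measure k) = sets borel"
  unfolding hausdorff_measure_def using sets.sigma_sets_eq[of borel] by (simp add: space_borel)

lemma space_hausdorff_measure [simp]: "space (hausdorff_measure k) = UNIV"
  by (simp add: hausdorff_measure_def space_measure_of_conv)

lemma emeasure_hausdorff_measure:
  fixes A :: "'a::metric_space set"
  assumes "A \<in> sets borel"
  shows "emeasure (hausdorff_measure k) A =
    (if measure_space UNIV (sets (borel :: 'a measure)) (hausdorff_outer k) then hausdorff_outer k A else 0)"
  unfolding hausdorff_measure_def using assms sets.sigma_sets_eq[of "borel :: 'a measure"]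
  by (simp add: emeasure_measure_of_conv space_borel)

context
  fixes S :: "'a::euclidean_space set"
  assumes S: "S \<in> sets borel"
begin

lemma space_normalized_surface_measure: "space (normalized_surface_measure S) = S"
  by (simp add: normalized_surface_measure_def space_restrict_space)

lemma sets_normalized_surface_measure:
  "sets (normalized_surface_measure S) = sets (restrict_space borel S)"
  by (simp add: normalized_surface_measure_def cong: sets_restrict_space_cong)

lemma sets_normalized_surface_measure_iff:
  "A \<in> sets (normalized_surface_measure S) \<longleftrightarrow> A \<subseteq> S \<and> A \<in> sets borel"
  using S by (simp add: sets_normalized_surface_measure sets_restrict_space_iff)

lemma emeasure_normalized_surface_measure:
  assumes "A \<subseteq> S" "A \<in> sets borel"
  shows "emeasure (normalized_surface_measure S) A
    = emeasure (hausdorff_measure (DIM('a) - 1)) A / emeasure (hausdorff_measure (DIM('a) - 1)) S"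
proof -
  have "S \<inter> A = A" using assms by auto
  then show ?thesis
    unfolding normalized_surface_measure_def using assms S
    by (subst emeasure_uniform_measure)
      (auto simp: sets_restrict_space_iff emeasure_restrict_space)
qed

text \<open>
  Countable additivity of the Hausdorff measure and \<open>0 < hausdorff_outer (DIM('a) - 1) S < \<infinity>\<close> need
  not be established: if one of them fails, then by the conventions of \<open>measure_of\<close> and of division
  in \<open>ennreal\<close> the normalized measure is the null measure.
\<close>

lemma normalized_surface_measure_cases:
  obtains "emeasure (normalized_surface_measure S) S = 0"
  | "emeasure (normalized_surface_measure S) S = 1"
    "\<And>A. A \<subseteq> S \<Longrightarrow> A \<in> sets borel \<Longrightarrow> 0 < hausdorff_outer (DIM('a) - 1) A \<Longrightarrow>
      0 < emeasure (normalized_surface_measure S) A"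
proof (cases "emeasure (normalized_surface_measure S) S = 0")
  case False
  let ?h = "emeasure (hausdorff_measure (DIM('a) - 1)) :: 'a set \<Rightarrow> ennreal"
  have eq: "emeasure (normalized_surface_measure S) S = ?h S / ?h S"
    using S by (intro emeasure_normalized_surface_measure) auto
  \<comment> \<open>Both \<open>0 / 0\<close> and \<open>top / top\<close> are 0 in
    \<open>ennreal\<close>, so a nonzero quotient excludes both values.\<close>
  with False have h: "?h S \<noteq> 0" "?h S \<noteq> top"
    by (auto simp: ennreal_divide_eq_0_iff)
  then have ms: "measure_space UNIV (sets (borel :: 'a measure)) (hausdorff_outer (DIM('a) - 1))"
    using S by (auto simp: emeasure_hausdorff_measure split: if_splits)
  show thesis
  proof (rule that(2))
    show "emeasure (normalized_surface_measure S) S = 1"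
      unfolding eq using h by (simp add: ennreal_divide_self less_top)
  next
    fix A assume A: "A \<subseteq> S" "A \<in> sets borel" "0 < hausdorff_outer (DIM('a) - 1) A"
    have "0 < ?h A" using A ms by (simp add: emeasure_hausdorff_measure)
    then show "0 < emeasure (normalized_surface_measure S) A"
      using A h by (simp add: emeasure_normalized_surface_measure ennreal_zero_less_divide less_top)
  qed
qed (rule that(1))

lemma distr_normalized_surface_measure_isometry:
  assumes iso: "\<And>x y. dist (f x) (f y) = dist x y" and g: "\<And>x. g (f x) = x" "\<And>y. f (g y) = y"
    and fS: "\<And>x. f x \<in> S \<longleftrightarrow> x \<in> S"
  defines "M \<equiv> normalized_surface_measure S"
  shows "f \<in> measurable M M" "distr M M f = M"
proof -
  have cont: "continuous_on UNIV f"
    by (rule continuous_onI) (use iso in auto)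
  have f: "f \<in> measurable borel borel"
    by (intro borel_measurable_continuous_onI cont)
  then have "f \<in> measurable (restrict_space borel S) (restrict_space borel S)"
    by (intro measurable_restrict_space3) (auto simp: fS)
  then show meas: "f \<in> measurable M M"
    unfolding M_def using sets_normalized_surface_measure by (simp cong: measurable_cong_sets)
  \<comment> \<open>Both sides fall under the same case of
    \<open>emeasure_hausdorff_measure\<close>, so equality of the outer measures settles it.\<close>
  have h_eq: "emeasure (hausdorff_measure k) (f -` A) = emeasure (hausdorff_measure k) A"
    if A: "A \<in> sets borel" for A k
  proof -
    have "f -` A \<in> sets borel" using measurable_sets[OF f A] by simp
    moreover have "f ` (f -` A) = A" using g(2) by (metis surj_def surj_image_vimage_eq)
    then have "hausdorff_outer k (f -` A) = hausdorff_outer k A"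
      using hausdorff_outer_isometry[OF iso g, of k "f -` A"] by simp
    ultimately show ?thesis using A by (simp add: emeasure_hausdorff_measure)
  qed
  show "distr M M f = M"
  proof (rule measure_eqI)
    fix A assume "A \<in> sets (distr M M f)"
    then have A: "A \<in> sets M" "A \<subseteq> S" "A \<in> sets borel"
      by (auto simp: M_def sets_normalized_surface_measure_iff)
    have "f -` A \<inter> space M = f -` A"
      using A fS by (auto simp: M_def space_normalized_surface_measure)
    then have "emeasure (distr M M f) A = emeasure M (f -` A)"
      using A meas by (simp add: emeasure_distr)
    also have "\<dots> = emeasure M A"
      unfolding M_def using A fS measurable_sets[OF f A(3)]
      by (subst (1 2) emeasure_normalized_surface_measure) (auto simp: h_eq)
    finally show "emeasure (distr M M f) A = emeasure M A" .
  qed simp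
qed

end

section \<open>Moments on a curve\<close>

text \<open>The variable is the squared modulus: \<open>norm z ^ (2 * k)\<close> is
  \<open>x ^ k\<close> for \<open>x = (norm z)^2\<close>. The boundary thereby becomes the curve
  \<open>power_sum ks x + power_sum ls y = 1\<close>.\<close>

definition power_sum :: "nat list \<Rightarrow> real \<Rightarrow> real" where
  "power_sum ks x = (\<Sum>k\<leftarrow>ks. x ^ k)"

lemma power_sum_simps [simp]:
  "power_sum [] x = 0" "power_sum (k # ks) x = x ^ k + power_sum ks x"
  by (simp_all add: power_sum_def)

lemma power_sum_nonneg: "0 \<le> x \<Longrightarrow> 0 \<le> power_sum ks x"
  by (induction ks) auto

lemma power_sum_mono: "0 \<le> x \<Longrightarrow> x \<le> y \<Longrightarrow> power_sum ks x \<le> power_sum ks y"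
  by (induction ks) (auto intro: add_mono power_mono)

lemma power_sum_0: "\<forall>k\<in>set ks. 0 < k \<Longrightarrow> power_sum ks 0 = 0"
  by (induction ks) auto

lemma continuous_on_power_sum [continuous_intros]:
  "continuous_on A f \<Longrightarrow> continuous_on A (\<lambda>x. power_sum ks (f x))"
  by (induction ks) (auto intro!: continuous_intros)

lemma power_sum_measurable [measurable]: "power_sum ks \<in> borel_measurable borel"
  by (intro borel_measurable_continuous_onI continuous_intros)

text \<open>Positive exponents give \<open>t ^ k \<le> t\<close> on the unit interval. Hence
  shrinking a point of the domain by \<open>t\<close> leaves room \<open>1 - t\<close> to the
  boundary.\<close>

lemma power_sum_scale_le:
  assumes "0 \<le> t" "t \<le> 1" "0 \<le> x" "\<forall>k\<in>set ks. 0 < k"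
  shows "power_sum ks (t * x) \<le> t * power_sum ks x"
  using assms(4)
proof (induction ks)
  case (Cons k ks)
  have "t ^ k \<le> t ^ 1"
    using assms Cons.prems by (intro power_decreasing) auto
  then have "t ^ k * x ^ k \<le> t * x ^ k"
    using assms by (intro mult_right_mono) auto
  then show ?case
    using Cons by (simp add: power_mult_distrib distrib_left)
qed simp

lemma power_sum_le_length:
  fixes x :: real
  assumes "0 \<le> x" "x \<le> 1" "\<forall>k\<in>set ks. 0 < k"
  shows "power_sum ks x \<le> length ks * x"
proof -
  have "power_sum ks (x * 1) \<le> x * power_sum ks 1"
    using assms by (intro power_sum_scale_le) auto
  moreover have "power_sum ks 1 = length ks"
    by (induction ks) auto
  ultimately show ?thesis by (simp add: mult.commute)
qed

text \<open>No exponent exceeds \<open>d\<close>, so dividing the argument by \<open>q\<close>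
  multiplies each term by at most \<open>q ^ -d\<close>.\<close>

lemma power_sum_expand_le:
  assumes "0 < q" "q \<le> 1" "0 \<le> x" "\<forall>k\<in>set ks. k \<le> d"
  shows "q ^ d * power_sum ks (x / q) \<le> power_sum ks x"
  using assms(4)
proof (induction ks)
  case (Cons k ks)
  have "q ^ d * (x / q) ^ k \<le> q ^ k * (x / q) ^ k"
    using assms Cons.prems by (intro mult_right_mono power_decreasing) auto
  also have "\<dots> = x ^ k"
    using assms by (simp add: power_divide)
  finally show ?case
    using Cons by (simp add: distrib_left add_mono)
qed simp

lemma power_sum_ge_hd:
  assumes "ks \<noteq> []" "0 \<le> x" shows "x ^ hd ks \<le> power_sum ks x"
  using assms power_sum_nonneg[of x "tl ks"] by (cases ks) auto

lemma power_sum_le_1_imp: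
  assumes "ks \<noteq> []" "\<forall>k\<in>set ks. 0 < k" "0 \<le> x" "power_sum ks x \<le> 1"
  shows "x \<le> 1"
proof (rule ccontr)
  assume "\<not> x \<le> 1"
  moreover have "0 < hd ks" using assms by simp
  ultimately have "1 < x ^ hd ks" by (intro one_less_power) auto
  with power_sum_ge_hd[OF assms(1,3)] assms(4) show False by simp
qed

lemma power_add_superadditive:
  fixes a b :: real
  assumes "0 \<le> a" "0 \<le> b" "0 < n"
  shows "a ^ n + b ^ n \<le> (a + b) ^ n"
  using assms(3)
proof (induction n rule: nat_induct_non_zero)
  case (Suc n)
  have "a ^ Suc n + b ^ Suc n \<le> a * (a + b) ^ n + b * (a + b) ^ n"
    using assms by (simp, intro add_mono mult_left_mono power_mono) auto
  then show ?case by (simp add: distrib_right)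
qed simp

text \<open>The inequality of arithmetic and geometric means, term by term; this is the logarithmic
  convexity of the domain.\<close>

lemma power_sum_geometric_mean:
  assumes "0 \<le> x" "0 \<le> y"
  shows "power_sum ks (sqrt (x * y)) \<le> (power_sum ks x + power_sum ks y) / 2"
proof (induction ks)
  case (Cons k ks)
  have "sqrt (x * y) ^ k \<le> (x ^ k + y ^ k) / 2"
    using arith_geo_mean_sqrt[of "x ^ k" "y ^ k"] assms
    by (metis power_mult_distrib real_sqrt_power zero_le_power)
  with Cons show ?case by (simp add: add_divide_distrib)
qed simp

text \<open>For \<open>a = sqrt (x ^ k)\<close> and \<open>b = sqrt (y ^ k)\<close> the defect is
  \<open>(b - a)^2 / 2\<close>. Superadditivity of powers and \<open>a + b \<le> 2\<close> give
  \<open>b - a \<ge> \<delta> ^ k / 2\<close>, whence the constant 8.\<close>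

lemma power_geometric_mean_gap:
  fixes x y \<delta> :: real
  assumes "0 \<le> x" "y \<le> 1" "0 \<le> \<delta>" "\<delta> \<le> y - x" "0 < k"
  shows "sqrt (x * y) ^ k \<le> (x ^ k + y ^ k) / 2 - \<delta> ^ (2 * k) / 8"
proof -
  define a b where "a = sqrt (x ^ k)" and "b = sqrt (y ^ k)"
  have y: "0 \<le> y" "x \<le> y" using assms by auto
  have sq: "a\<^sup>2 = x ^ k" "b\<^sup>2 = y ^ k" using assms y by (auto simp: a_def b_def)
  have le1: "0 \<le> a" "a \<le> b" "b \<le> 1"
    using assms y by (auto simp: a_def b_def intro: power_mono power_le_one)
  have "\<delta> ^ k + x ^ k \<le> (y - x) ^ k + x ^ k"
    using assms by (intro add_right_mono power_mono) auto
  also have "\<dots> \<le> y ^ k"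
    using power_add_superadditive[of "y - x" x k] assms y by simp
  finally have "\<delta> ^ k \<le> (b - a) * (b + a)"
    unfolding sq[symmetric] by (simp add: power2_eq_square algebra_simps)
  also have "\<dots> \<le> (b - a) * 2"
    using le1 by (intro mult_left_mono) auto
  finally have "(\<delta> ^ k / 2)\<^sup>2 \<le> (b - a)\<^sup>2"
    using assms by (intro power_mono) auto
  then have gap: "\<delta> ^ (2 * k) / 4 \<le> (b - a)\<^sup>2"
    by (simp add: power_divide power_mult[symmetric] mult.commute)
  have "sqrt (x * y) ^ k = a * b"
    using assms y by (simp add: a_def b_def real_sqrt_power real_sqrt_mult power_mult_distrib)
  also have "\<dots> = (a\<^sup>2 + b\<^sup>2) / 2 - (b - a)\<^sup>2 / 2"
    by (simp add: power2_eq_square field_simps)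
  finally show ?thesis using gap sq by simp
qed

text \<open>One strictly better term is enough: the first exponent supplies the gap, the others the
  plain inequality.\<close>

lemma power_sum_geometric_mean_gap:
  assumes "ks \<noteq> []" "\<forall>k\<in>set ks. 0 < k" "0 \<le> x" "y \<le> 1" "0 \<le> \<delta>" "\<delta> \<le> y - x"
  shows "power_sum ks (sqrt (x * y)) \<le> (power_sum ks x + power_sum ks y) / 2 - \<delta> ^ (2 * hd ks) / 8"
proof (cases ks)
  case (Cons k ks')
  have "sqrt (x * y) ^ k \<le> (x ^ k + y ^ k) / 2 - \<delta> ^ (2 * k) / 8"
    using assms Cons by (intro power_geometric_mean_gap) auto
  moreover have "power_sum ks' (sqrt (x * y)) \<le> (power_sum ks' x + power_sum ks' y) / 2"
    using assms by (intro power_sum_geometric_mean) auto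
  ultimately show ?thesis using Cons by (simp add: add_divide_distrib)
qed (use assms in simp)

text \<open>A point whose sum stays \<open>\<eta>\<close> below 1 can be pushed outward by a factor
  \<open>1 / q\<close> that depends on \<open>\<eta>\<close> and the exponents only: Bernoulli's
  inequality for \<open>q = 1 - \<eta> / (2 * d)\<close> yields
  \<open>1 - \<eta> \<le> q ^ d\<close>.\<close>

lemma power_sum_room:
  assumes "ks \<noteq> []" "0 < \<eta>" "\<eta> \<le> 1"
  obtains q where "0 < q" "q < 1"
    "\<And>x y. 0 \<le> x \<Longrightarrow> 0 \<le> y \<Longrightarrow> power_sum ks x + power_sum ls y \<le> 1 - \<eta> \<Longrightarrow>
      power_sum ks (x / q) + power_sum ls (y / q) \<le> 1"
proof -
  define d where "d = Suc (Max (insert 0 (set ks \<union> set ls)))"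
  have d: "\<forall>k\<in>set ks. k \<le> d" "\<forall>k\<in>set ls. k \<le> d" "0 < d"
    unfolding d_def by (auto intro!: le_SucI Max_ge)
  define q where "q = 1 - \<eta> / (2 * real d)"
  have q: "0 < q" "q < 1"
    using assms d by (auto simp: q_def field_simps)
  have "1 - \<eta> \<le> 1 + real d * (q - 1)"
    using assms d by (simp add: q_def field_simps)
  also have "\<dots> \<le> (1 + (q - 1)) ^ d"
    using q by (intro Bernoulli_inequality) auto
  finally have *: "1 - \<eta> \<le> q ^ d" by simp
  show thesis
  proof (rule that[OF q])
    fix x y assume xy: "0 \<le> x" "0 \<le> y" "power_sum ks x + power_sum ls y \<le> 1 - \<eta>"
    have "q ^ d * (power_sum ks (x / q) + power_sum ls (y / q)) \<le> power_sum ks x + power_sum ls y"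
      unfolding distrib_left using q d xy by (intro add_mono power_sum_expand_le) auto
    also have "\<dots> \<le> q ^ d * 1" using xy * by simp
    finally show "power_sum ks (x / q) + power_sum ls (y / q) \<le> 1"
      using q by (simp only: mult_le_cancel_left_pos zero_less_power)
  qed
qed

text \<open>An abstract pair \<open>X\<close>, \<open>Y\<close> allows either coordinate of the
  domain to take the part of \<open>X\<close>. Bands are described by \<open>power_sum ks X\<close>
  instead of \<open>X\<close>, because this quantity runs through the whole unit interval and turns
  the curve into a line.\<close>

locale power_curve_measure = finite_measure M for M :: "'a measure" +
  fixes X Y :: "'a \<Rightarrow> real" and ks ls :: "nat list"
  assumes X_measurable [measurable]: "X \<in> borel_measurable M"
    and Y_measurable [measurable]: "Y \<in> borel_measurable M"
    and X_nonneg: "w \<in> space M \<Longrightarrow> 0 \<le> X w"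
    and Y_nonneg: "w \<in> space M \<Longrightarrow> 0 \<le> Y w"
    and curve: "w \<in> space M \<Longrightarrow> power_sum ks (X w) + power_sum ls (Y w) = 1"
    and ks: "ks \<noteq> []" "\<forall>k\<in>set ks. 0 < k"
    and ls: "ls \<noteq> []" "\<forall>l\<in>set ls. 0 < l"
    and total: "measure M (space M) = 1"
    and support: "0 \<le> a \<Longrightarrow> a < b \<Longrightarrow> b \<le> 1 \<Longrightarrow>
      0 < measure M {w\<in>space M. a \<le> power_sum ks (X w) \<and> power_sum ks (X w) \<le> b}"
begin

definition moment :: "nat \<Rightarrow> nat \<Rightarrow> real" where
  "moment k l = (\<integral>w. X w ^ k * Y w ^ l \<partial>M)"

lemma X_le_1: "w \<in> space M \<Longrightarrow> X w \<le> 1"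
  using power_sum_le_1_imp[OF ks, of "X w"] curve[of w] X_nonneg power_sum_nonneg[OF Y_nonneg, of w ls]
  by auto

lemma Y_le_1: "w \<in> space M \<Longrightarrow> Y w \<le> 1"
  using power_sum_le_1_imp[OF ls, of "Y w"] curve[of w] Y_nonneg power_sum_nonneg[OF X_nonneg, of w ks]
  by auto

lemma monomial_bounds:
  "w \<in> space M \<Longrightarrow> 0 \<le> X w ^ k * Y w ^ l" "w \<in> space M \<Longrightarrow> X w ^ k * Y w ^ l \<le> 1"
  using X_nonneg X_le_1 Y_nonneg Y_le_1 by (auto intro!: mult_le_one power_le_one)

lemma integrable_monomial: "integrable M (\<lambda>w. X w ^ k * Y w ^ l)"
  using monomial_bounds[of _ k l] by (intro integrable_const_bound[of _ 1] AE_I2) auto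

text \<open>Uniformity in the position comes from a finite grid: for \<open>2 / n < \<eta>\<close>
  every interval of length at least \<open>\<eta>\<close> in the unit interval contains one of the
  \<open>n\<close> grid intervals, and the least of finitely many positive masses is
  positive.\<close>

lemma interval_mass:
  assumes "0 < \<eta>"
  obtains c where "0 < c"
    "\<And>a b. 0 \<le> a \<Longrightarrow> b \<le> 1 \<Longrightarrow> \<eta> \<le> b - a \<Longrightarrow>
      c \<le> measure M {w\<in>space M. a \<le> power_sum ks (X w) \<and> power_sum ks (X w) \<le> b}"
proof -
  define J where "J a b = {w\<in>space M. a \<le> power_sum ks (X w) \<and> power_sum ks (X w) \<le> b}" for a b
  have J: "J a b \<in> sets M" for a b
    unfolding J_def by measurable
  obtain n :: nat where n: "2 / \<eta> < n" using reals_Archimedean2 by blast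
  moreover have "0 < 2 / \<eta>" using assms by simp
  ultimately have n0: "0 < real n" by linarith
  with n assms have n\<eta>: "2 / n < \<eta>" by (simp add: field_simps)
  define c where "c = Min ((\<lambda>i. measure M (J (i / n) ((i + 1) / n))) ` {..<n})"
  have pos: "0 < measure M (J (i / n) ((i + 1) / n))" if "i < n" for i :: nat
    unfolding J_def by (rule support) (use that n0 in \<open>auto simp: field_simps\<close>)
  show thesis
  proof (rule that)
    show "0 < c"
      unfolding c_def using n0 pos by (subst Min_gr_iff) auto
  next
    fix a b :: real assume ab: "0 \<le> a" "b \<le> 1" "\<eta> \<le> b - a"
    \<comment> \<open>The first grid point not to the left of \<open>a\<close>; the following one is
      at most \<open>a + 2 / n\<close>.\<close>
    define i where "i = nat \<lceil>a * n\<rceil>"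
    have i: "a * n \<le> i" "i < a * n + 1"
      using ab n0 by (auto simp: i_def of_nat_nat) linarith+
    have up: "(real i + 1) / n \<le> b"
    proof -
      have "(real i + 1) / n \<le> (a * n + 2) / n" using i n0 by (intro divide_right_mono) auto
      also have "\<dots> = a + 2 / n" using n0 by (simp add: field_simps)
      finally show ?thesis using n\<eta> ab by linarith
    qed
    with ab have "(real i + 1) / n \<le> 1" by linarith
    then have "i < n" using n0 by (simp add: field_simps)
    then have "c \<le> measure M (J (i / n) ((i + 1) / n))"
      unfolding c_def by (intro Min_le) auto
    also have "\<dots> \<le> measure M (J a b)"
    proof (rule finite_measure_mono[OF _ J])
      have "a \<le> i / n" using i n0 by (simp add: field_simps)
      with up show "J (i / n) ((i + 1) / n) \<subseteq> J a b"
        by (auto simp: J_def add.commute intro: order_trans)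
    qed
    finally show "c \<le> measure M {w\<in>space M. a \<le> power_sum ks (X w) \<and> power_sum ks (X w) \<le> b}"
      by (simp add: J_def)
  qed
qed

text \<open>The point \<open>(q * x, q * y)\<close> lies inside the domain with room
  \<open>1 - q\<close>. A whole band of values of \<open>power_sum ks X\<close> therefore forces
  \<open>X \<ge> q * x\<close> and \<open>Y \<ge> q * y\<close>, and its mass is bounded below
  independently of the point and of the exponents. The same bound for \<open>k\<close> and
  \<open>Suc k\<close> allows a later estimate of the product of these two moments.\<close>

lemma moment_lower_bound:
  assumes q: "0 < q" "q < 1"
  obtains c where "0 < c"
    "\<And>x y k l. 0 \<le> x \<Longrightarrow> 0 \<le> y \<Longrightarrow> power_sum ks x + power_sum ls y \<le> 1 \<Longrightarrow>
      c * q ^ (k + l) * (x ^ k * y ^ l) \<le> moment k l \<and>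
      c * q ^ (k + l) * (x ^ k * y ^ l) \<le> moment (Suc k) l"
proof -
  \<comment> \<open>A third of the room for each of the two margins of the band and a third for its
    width.\<close>
  define \<eta> where "\<eta> = (1 - q) / 3"
  have \<eta>: "0 < \<eta>" using q by (simp add: \<eta>_def)
  obtain c where c: "0 < c"
    "\<And>a b. 0 \<le> a \<Longrightarrow> b \<le> 1 \<Longrightarrow> \<eta> \<le> b - a \<Longrightarrow>
      c \<le> measure M {w\<in>space M. a \<le> power_sum ks (X w) \<and> power_sum ks (X w) \<le> b}"
    using interval_mass[OF \<eta>] by blast
  \<comment> \<open>The lower margin gives \<open>\<eta> \<le> length ks * X\<close> on the band,
    hence a positive lower bound for the additional factor \<open>X\<close> in the moment at
    \<open>Suc k\<close>. The cap 1 keeps the constant valid for the moment at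
    \<open>k\<close>.\<close>
  define \<kappa> where "\<kappa> = min 1 (\<eta> / length ks)"
  have \<kappa>: "0 < \<kappa>" "\<kappa> \<le> 1" using \<eta> ks by (auto simp: \<kappa>_def)
  show thesis
  proof (rule that[of "\<kappa> * c"])
    fix x y :: real and k l :: nat
    assume xy: "0 \<le> x" "0 \<le> y" "power_sum ks x + power_sum ls y \<le> 1"
    define a b where "a = power_sum ks (q * x) + \<eta>" and "b = 1 - power_sum ls (q * y) - \<eta>"
    define J where "J = {w\<in>space M. a \<le> power_sum ks (X w) \<and> power_sum ks (X w) \<le> b}"
    have J [measurable]: "J \<in> sets M" unfolding J_def by measurable
    have "power_sum ks (q * x) + power_sum ls (q * y) \<le> q * power_sum ks x + q * power_sum ls y"
      using q xy ks ls by (intro add_mono power_sum_scale_le) auto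
    also have "\<dots> \<le> q" using mult_left_mono[OF xy(3), of q] q by (simp add: distrib_left)
    finally have ab: "\<eta> \<le> b - a" by (simp add: a_def b_def \<eta>_def field_simps)
    have nonneg: "0 \<le> power_sum ks (q * x)" "0 \<le> power_sum ls (q * y)"
      using q xy by (auto intro!: power_sum_nonneg)
    have mass: "c \<le> measure M J"
      unfolding J_def using nonneg \<eta> by (intro c ab) (auto simp: a_def b_def)
    have on_J: "q * x \<le> X w" "q * y \<le> Y w" "\<kappa> \<le> X w" if "w \<in> J" for w
    proof -
      have w: "w \<in> space M" "a \<le> power_sum ks (X w)" "power_sum ks (X w) \<le> b"
        using that by (auto simp: J_def)
      show "q * x \<le> X w"
      proof (rule ccontr)
        assume "\<not> ?thesis"
        with power_sum_mono[of "X w" "q * x" ks] X_nonneg[OF w(1)] w \<eta> show False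
          by (simp add: a_def)
      qed
      show "q * y \<le> Y w"
      proof (rule ccontr)
        assume "\<not> ?thesis"
        with power_sum_mono[of "Y w" "q * y" ls] Y_nonneg[OF w(1)] w \<eta> curve[OF w(1)] show False
          by (simp add: b_def)
      qed
      have "\<eta> \<le> length ks * X w"
        using power_sum_le_length[OF X_nonneg[OF w(1)] X_le_1[OF w(1)] ks(2)] w nonneg
        by (simp add: a_def)
      then have "\<eta> / length ks \<le> X w"
        using ks by (simp add: field_simps)
      then show "\<kappa> \<le> X w" by (simp add: \<kappa>_def)
    qed
    have le: "C * measure M J \<le> moment k' l" if "0 \<le> C" "\<And>w. w \<in> J \<Longrightarrow> C \<le> X w ^ k' * Y w ^ l" for C k'
    proof -
      have "C * measure M J = (\<integral>w. C * indicator J w \<partial>M)" by simp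
      also have "\<dots> \<le> moment k' l"
        unfolding moment_def
      proof (rule integral_mono[OF _ integrable_monomial])
        show "integrable M (\<lambda>w. C * indicator J w)"
          by (intro integrable_mult_right integrable_real_indicator J) (simp add: emeasure_eq_measure)
        show "C * indicator J w \<le> X w ^ k' * Y w ^ l" if "w \<in> space M" for w
          using \<open>\<And>w. w \<in> J \<Longrightarrow> C \<le> X w ^ k' * Y w ^ l\<close>[of w] monomial_bounds(1)[OF that, of k' l]
          by (cases "w \<in> J") simp_all
      qed
      finally show ?thesis .
    qed
    define D where "D = (q * x) ^ k * (q * y) ^ l"
    have D: "0 \<le> D" using q xy by (simp add: D_def)
    have D_le: "D \<le> X w ^ k * Y w ^ l" if "w \<in> J" for w
      unfolding D_def using on_J[OF that] q xy that X_nonneg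
      by (intro mult_mono power_mono) (auto simp: J_def)
    have D_eq: "q ^ (k + l) * (x ^ k * y ^ l) = D"
      by (simp add: D_def power_add power_mult_distrib)
    have "\<kappa> * D \<le> X w ^ k * Y w ^ l" "\<kappa> * D \<le> X w ^ Suc k * Y w ^ l" if "w \<in> J" for w
    proof -
      show "\<kappa> * D \<le> X w ^ k * Y w ^ l"
        using D_le[OF that] D \<kappa> mult_right_mono[of \<kappa> 1 D] by linarith
      have "\<kappa> * D \<le> X w * (X w ^ k * Y w ^ l)"
        using D_le[OF that] D \<kappa> on_J[OF that] that X_nonneg
        by (intro mult_mono) (auto simp: J_def)
      then show "\<kappa> * D \<le> X w ^ Suc k * Y w ^ l" by (simp add: mult.assoc)
    qed
    then have "\<kappa> * D * measure M J \<le> moment k l" "\<kappa> * D * measure M J \<le> moment (Suc k) l"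
      using D \<kappa> by (auto intro!: le)
    moreover have "\<kappa> * c * q ^ (k + l) * (x ^ k * y ^ l) \<le> \<kappa> * D * measure M J"
    proof -
      have "\<kappa> * D * c \<le> \<kappa> * D * measure M J"
        using mass D \<kappa> by (intro mult_left_mono) auto
      then show ?thesis using D_eq by (metis mult.assoc mult.commute)
    qed
    ultimately show "\<kappa> * c * q ^ (k + l) * (x ^ k * y ^ l) \<le> moment k l \<and>
        \<kappa> * c * q ^ (k + l) * (x ^ k * y ^ l) \<le> moment (Suc k) l"
      by linarith
  qed (use c \<kappa> in simp)
qed

lemma moment_pos: "0 < moment k l"
proof -
  have half: "(0::real) < 1/2" "(1/2::real) < 1" by simp_all
  obtain c where c: "0 < c"
    "\<And>x y k l. 0 \<le> x \<Longrightarrow> 0 \<le> y \<Longrightarrow> power_sum ks x + power_sum ls y \<le> 1 \<Longrightarrow>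
      c * (1/2) ^ (k + l) * (x ^ k * y ^ l) \<le> moment k l \<and>
      c * (1/2) ^ (k + l) * (x ^ k * y ^ l) \<le> moment (Suc k) l"
    using moment_lower_bound[OF half] by blast
  \<comment> \<open>Each positive power of \<open>t\<close> is at most \<open>t\<close>, so the
    point \<open>(t, t)\<close> belongs to the closed domain.\<close>
  define t where "t = 1 / (real (length ks) + real (length ls))"
  have "0 < length ks" "0 < length ls" using ks ls by blast+
  then have len: "1 \<le> real (length ks) + real (length ls)" by linarith
  then have t: "0 < t" "t \<le> 1" by (simp_all add: t_def)
  have "power_sum ks t + power_sum ls t \<le> length ks * t + length ls * t"
    using t ks ls by (intro add_mono power_sum_le_length) auto
  also have "\<dots> = (real (length ks) + real (length ls)) * t" by (simp add: distrib_right)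
  also have "\<dots> = 1" using len by (simp add: t_def)
  finally have "c * (1/2) ^ (k + l) * (t ^ k * t ^ l) \<le> moment k l"
    using c(2)[of t t k l] t by simp
  moreover have "0 < c * (1/2) ^ (k + l) * (t ^ k * t ^ l)"
    using c t by simp
  ultimately show ?thesis by linarith
qed

text \<open>
  The curve bounds a logarithmically convex domain. The geometric mean of two points of the curve
  whose \<open>X\<close>-values differ by at least \<open>\<delta>\<close> lies in the domain with room to spare, so
  the product of the values of a monomial at the two points is exponentially smaller than the
  square of its maximum.
\<close>

lemma moment_gap_small:
  assumes \<delta>: "0 < \<delta>"
  obtains N where "\<And>k l. N \<le> k + l \<Longrightarrow>
    moment (Suc (Suc k)) l * moment k l - (moment (Suc k) l)\<^sup>2 \<le> \<delta> * (moment (Suc k) l * moment k l)"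
proof -
  \<comment> \<open>Pairs of points with \<open>X' - X < \<gamma>\<close> cost at most the share
    \<open>\<delta> / 2\<close>. The cap 1 ensures \<open>\<eta> \<le> 1\<close>, as
    \<open>power_sum_room\<close> demands.\<close>
  define \<gamma> where "\<gamma> = min 1 (\<delta> / 2)"
  have \<gamma>: "0 < \<gamma>" "\<gamma> \<le> 1" "\<gamma> \<le> \<delta> / 2" using \<delta> by (auto simp: \<gamma>_def)
  define \<eta> where "\<eta> = \<gamma> ^ (2 * hd ks) / 8"
  have \<eta>: "0 < \<eta>" "\<eta> \<le> 1"
    using \<gamma> power_le_one[of \<gamma> "2 * hd ks"] by (auto simp: \<eta>_def)
  obtain q where q: "0 < q" "q < 1"
    "\<And>x y. 0 \<le> x \<Longrightarrow> 0 \<le> y \<Longrightarrow> power_sum ks x + power_sum ls y \<le> 1 - \<eta> \<Longrightarrow>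
      power_sum ks (x / q) + power_sum ls (y / q) \<le> 1"
    using power_sum_room[OF ks(1) \<eta>] by blast
  \<comment> \<open>Pushing outward by \<open>1 / q\<close> gains \<open>q ^ -(k + l)\<close> in
    each of the two moments, and the lower bound loses \<open>s ^ (k + l)\<close> in each. With
    \<open>s = sqrt q\<close> the product retains the net gain \<open>q ^ -(k + l)\<close>.\<close>
  define s where "s = sqrt q"
  have s: "0 < s" "s < 1" "s\<^sup>2 = q" using q by (auto simp: s_def)
  obtain c where c: "0 < c"
    "\<And>x y k l. 0 \<le> x \<Longrightarrow> 0 \<le> y \<Longrightarrow> power_sum ks x + power_sum ls y \<le> 1 \<Longrightarrow>
      c * s ^ (k + l) * (x ^ k * y ^ l) \<le> moment k l \<and>
      c * s ^ (k + l) * (x ^ k * y ^ l) \<le> moment (Suc k) l"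
    using moment_lower_bound[OF s(1,2)] by blast
  obtain N where N: "q ^ N < \<delta> / 2 * c\<^sup>2"
    using real_arch_pow_inv[of "\<delta> / 2 * c\<^sup>2" q] \<delta> c q by auto
  show thesis
  proof (rule that[of N])
    fix k l assume n: "N \<le> k + l"
    define m m' where "m = moment k l" and "m' = moment (Suc k) l"
    have m: "0 < m" "0 < m'" by (auto simp: m_def m'_def moment_pos)
    define Q where "Q = \<delta> / 2 * (m * m')"
    have Q: "0 \<le> Q" using m \<delta> by (simp add: Q_def)
    \<comment> \<open>The product of the two values is the square of the monomial at the geometric
      mean \<open>(x, y)\<close>. Since \<open>(x / q, y / q)\<close> is still in the closed domain,
      \<open>c(2)\<close> compares it with both moments.\<close>
    have far: "X w ^ k * Y w ^ l * (X w' ^ k * Y w' ^ l) \<le> Q"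
      if w: "w \<in> space M" "w' \<in> space M" "\<gamma> \<le> X w' - X w" for w w'
    proof -
      define x y where "x = sqrt (X w * X w')" and "y = sqrt (Y w * Y w')"
      have xy: "0 \<le> x" "0 \<le> y" using X_nonneg Y_nonneg w by (auto simp: x_def y_def)
      have "power_sum ks x + power_sum ls y \<le> (power_sum ks (X w) + power_sum ks (X w')) / 2 - \<eta>
          + (power_sum ls (Y w) + power_sum ls (Y w')) / 2"
        unfolding x_def y_def \<eta>_def using ks w \<gamma> X_nonneg Y_nonneg X_le_1
        by (intro add_mono power_sum_geometric_mean_gap power_sum_geometric_mean) auto
      also have "\<dots> = 1 - \<eta>"
        using curve[OF w(1)] curve[OF w(2)] by (simp add: field_simps)
      finally have "power_sum ks (x / q) + power_sum ls (y / q) \<le> 1" using q xy by blast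
      with c(2)[of "x / q" "y / q" k l] q xy
      have "c * s ^ (k + l) * ((x / q) ^ k * (y / q) ^ l) \<le> m"
        "c * s ^ (k + l) * ((x / q) ^ k * (y / q) ^ l) \<le> m'"
        by (auto simp: m_def m'_def)
      then have "(c * s ^ (k + l) * ((x / q) ^ k * (y / q) ^ l))\<^sup>2 \<le> m * m'"
        unfolding power2_eq_square using q xy s c by (intro mult_mono) (auto simp: m less_imp_le)
      moreover have "(c * s ^ (k + l) * ((x / q) ^ k * (y / q) ^ l))\<^sup>2
          = c\<^sup>2 * (x\<^sup>2 ^ k * y\<^sup>2 ^ l) / q ^ (k + l)"
      proof -
        define r where "r = q ^ (k + l)"
        have r: "0 < r" using q by (simp add: r_def)
        have s2: "(s ^ (k + l))\<^sup>2 = r"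
          unfolding r_def s(3)[symmetric] by (simp only: power_mult[symmetric] mult.commute)
        have split: "((z / q) ^ j)\<^sup>2 = z\<^sup>2 ^ j / (q ^ j)\<^sup>2" for z :: real and j
          by (simp only: power_divide power_mult[symmetric] mult.commute)
        have r2: "r\<^sup>2 = (q ^ k)\<^sup>2 * (q ^ l)\<^sup>2"
          by (simp only: r_def power_add power_mult_distrib)
        have "(c * s ^ (k + l) * ((x / q) ^ k * (y / q) ^ l))\<^sup>2
            = c\<^sup>2 * r * (x\<^sup>2 ^ k / (q ^ k)\<^sup>2 * (y\<^sup>2 ^ l / (q ^ l)\<^sup>2))"
          by (simp only: power_mult_distrib s2 split)
        also have "\<dots> = c\<^sup>2 * r * (x\<^sup>2 ^ k * y\<^sup>2 ^ l) / r\<^sup>2"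
          unfolding r2 by (simp add: mult.assoc)
        also have "\<dots> = c\<^sup>2 * (x\<^sup>2 ^ k * y\<^sup>2 ^ l) / r"
          using r by (simp add: power2_eq_square)
        finally show ?thesis by (simp only: r_def)
      qed
      ultimately have "c\<^sup>2 * (x\<^sup>2 ^ k * y\<^sup>2 ^ l) / q ^ (k + l) \<le> m * m'" by simp
      then have "c\<^sup>2 * (x\<^sup>2 ^ k * y\<^sup>2 ^ l) \<le> q ^ (k + l) * (m * m')"
        using q by (simp only: pos_divide_le_eq zero_less_power mult.commute)
      also have "\<dots> \<le> q ^ N * (m * m')"
        using q n m by (intro mult_right_mono power_decreasing) auto
      also have "\<dots> \<le> \<delta> / 2 * c\<^sup>2 * (m * m')"
        using N m by (intro mult_right_mono) auto
      also have "\<dots> = c\<^sup>2 * Q" by (simp add: Q_def)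
      finally have "x\<^sup>2 ^ k * y\<^sup>2 ^ l \<le> Q"
        using c(1) by (simp only: mult_le_cancel_left_pos zero_less_power)
      moreover have "x\<^sup>2 = X w * X w'" "y\<^sup>2 = Y w * Y w'"
        using X_nonneg Y_nonneg w by (auto simp: x_def y_def)
      ultimately show ?thesis by (simp add: power_mult_distrib mult_ac)
    qed
    \<comment> \<open>Integration over \<open>w\<close> and then over \<open>w'\<close> turns the
      left side into that of the claim, and the first term on the right into
      \<open>\<delta> / 2\<close> times the product of the two moments.\<close>
    have point: "(X w' - X w) * (X w' * (X w ^ k * Y w ^ l * (X w' ^ k * Y w' ^ l)))
        \<le> \<delta> / 2 * (X w' * (X w ^ k * Y w ^ l * (X w' ^ k * Y w' ^ l))) + Q"
      if w: "w \<in> space M" "w' \<in> space M" for w w'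
    proof (cases "\<gamma> \<le> X w' - X w")
      case True
      define Z where "Z = X w ^ k * Y w ^ l * (X w' ^ k * Y w' ^ l)"
      have Z: "0 \<le> Z" "Z \<le> Q"
        using far[OF w True] monomial_bounds(1) w by (auto simp: Z_def)
      have b: "0 \<le> X w" "0 \<le> X w'" "X w' \<le> 1" using w X_nonneg X_le_1 by auto
      have "(X w' - X w) * (X w' * Z) \<le> 1 * (1 * Z)"
        using b Z True \<gamma> by (intro mult_mono) auto
      moreover have "0 \<le> \<delta> / 2 * (X w' * Z)" using b Z \<delta> by simp
      ultimately show ?thesis using Z unfolding Z_def by linarith
    next
      \<comment> \<open>The difference \<open>X w' - X w\<close> may be negative here; its upper
        bound \<open>\<gamma> \<le> \<delta> / 2\<close> is what counts.\<close>
      case False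
      then have "(X w' - X w) * (X w' * (X w ^ k * Y w ^ l * (X w' ^ k * Y w' ^ l)))
          \<le> \<delta> / 2 * (X w' * (X w ^ k * Y w ^ l * (X w' ^ k * Y w' ^ l)))"
        using \<gamma> monomial_bounds(1) w X_nonneg by (intro mult_right_mono) auto
      with Q show ?thesis by linarith
    qed
    have int: "integrable M (\<lambda>w. X w ^ a * Y w ^ b)" for a b by (rule integrable_monomial)
    \<comment> \<open>Two successive single integrals, the first one with \<open>w'\<close> fixed,
      take the place of a product measure.\<close>
    have inner: "X w' ^ Suc (Suc k) * Y w' ^ l * m - X w' ^ Suc k * Y w' ^ l * m'
        \<le> \<delta> / 2 * m * (X w' ^ Suc k * Y w' ^ l) + Q" if w': "w' \<in> space M" for w'
    proof -
      have "X w' ^ Suc (Suc k) * Y w' ^ l * m - X w' ^ Suc k * Y w' ^ l * m'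
          = (\<integral>w. X w' ^ Suc (Suc k) * Y w' ^ l * (X w ^ k * Y w ^ l)
              - X w' ^ Suc k * Y w' ^ l * (X w ^ Suc k * Y w ^ l) \<partial>M)"
        unfolding m_def m'_def moment_def
        by (subst Bochner_Integration.integral_diff) (intro integrable_mult_right int, intro integrable_mult_right int, simp)
      also have "\<dots> \<le> (\<integral>w. \<delta> / 2 * (X w' ^ Suc k * Y w' ^ l) * (X w ^ k * Y w ^ l) + Q \<partial>M)"
      proof (rule integral_mono)
        fix w assume "w \<in> space M"
        from point[OF this w'] show "X w' ^ Suc (Suc k) * Y w' ^ l * (X w ^ k * Y w ^ l)
              - X w' ^ Suc k * Y w' ^ l * (X w ^ Suc k * Y w ^ l)
            \<le> \<delta> / 2 * (X w' ^ Suc k * Y w' ^ l) * (X w ^ k * Y w ^ l) + Q"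
          by (simp add: algebra_simps)
      qed (intro Bochner_Integration.integrable_diff Bochner_Integration.integrable_add
          integrable_mult_right int integrable_const)+
      also have "\<dots> = \<delta> / 2 * m * (X w' ^ Suc k * Y w' ^ l) + Q"
        using total unfolding m_def moment_def
        by (subst Bochner_Integration.integral_add)
          (intro integrable_mult_right int integrable_const, intro integrable_const, simp)
      finally show ?thesis .
    qed
    have "moment (Suc (Suc k)) l * m - m' * m'
        = (\<integral>w'. X w' ^ Suc (Suc k) * Y w' ^ l * m - X w' ^ Suc k * Y w' ^ l * m' \<partial>M)"
      unfolding m'_def moment_def
      by (subst Bochner_Integration.integral_diff) (intro integrable_mult_left int, intro integrable_mult_left int, simp)
    also have "\<dots> \<le> (\<integral>w'. \<delta> / 2 * m * (X w' ^ Suc k * Y w' ^ l) + Q \<partial>M)"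
      using inner by (intro integral_mono Bochner_Integration.integrable_diff
          Bochner_Integration.integrable_add integrable_mult_right integrable_mult_left int integrable_const) auto
    also have "\<dots> = \<delta> / 2 * m * m' + Q"
      using total unfolding m'_def moment_def
      by (subst Bochner_Integration.integral_add)
        (intro integrable_mult_right int integrable_const, intro integrable_const, simp)
    also have "\<dots> = \<delta> * (m' * m)" by (simp add: Q_def)
    finally show "moment (Suc (Suc k)) l * moment k l - (moment (Suc k) l)\<^sup>2
        \<le> \<delta> * (moment (Suc k) l * moment k l)"
      by (simp add: m_def m'_def power2_eq_square)
  qed
qed

text \<open>At exponent 0 there is no lower neighbouring weight, and the remainder is governed by
  the mean of \<open>X\<close> under the weight \<open>Y ^ l\<close>. This weight peaks at
  \<open>X = 0\<close>: where \<open>X \<ge> \<gamma>\<close>, the point \<open>(0, Y / q)\<close>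
  is still in the closed domain, so \<open>Y ^ l\<close> is exponentially small against the
  moment.\<close>

lemma moment_first_small:
  assumes \<delta>: "0 < \<delta>"
  obtains N where "\<And>l. N \<le> l \<Longrightarrow> moment 1 l \<le> \<delta> * moment 0 l"
proof -
  define \<gamma> where "\<gamma> = min 1 (\<delta> / 2)"
  have \<gamma>: "0 < \<gamma>" "\<gamma> \<le> 1" "\<gamma> \<le> \<delta> / 2" using \<delta> by (auto simp: \<gamma>_def)
  define \<eta> where "\<eta> = \<gamma> ^ hd ks"
  have \<eta>: "0 < \<eta>" "\<eta> \<le> 1"
    using \<gamma> by (auto simp: \<eta>_def intro: power_le_one)
  obtain q where q: "0 < q" "q < 1"
    "\<And>x y. 0 \<le> x \<Longrightarrow> 0 \<le> y \<Longrightarrow> power_sum ks x + power_sum ls y \<le> 1 - \<eta> \<Longrightarrow>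
      power_sum ks (x / q) + power_sum ls (y / q) \<le> 1"
    using power_sum_room[OF ks(1) \<eta>] by blast
  \<comment> \<open>A single moment gains \<open>q ^ -l\<close> and loses \<open>s ^ l\<close>; with
    \<open>q = s * s\<close> the net gain is \<open>s ^ -l\<close>.\<close>
  define s where "s = sqrt q"
  have s: "0 < s" "s < 1" "q = s * s" using q by (auto simp: s_def)
  obtain c where c: "0 < c"
    "\<And>x y k l. 0 \<le> x \<Longrightarrow> 0 \<le> y \<Longrightarrow> power_sum ks x + power_sum ls y \<le> 1 \<Longrightarrow>
      c * s ^ (k + l) * (x ^ k * y ^ l) \<le> moment k l \<and>
      c * s ^ (k + l) * (x ^ k * y ^ l) \<le> moment (Suc k) l"
    using moment_lower_bound[OF s(1,2)] by blast
  obtain N where N: "s ^ N < \<delta> / 2 * c"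
    using real_arch_pow_inv[of "\<delta> / 2 * c" s] \<delta> c s by auto
  show thesis
  proof (rule that[of N])
    fix l assume n: "N \<le> l"
    define m where "m = moment 0 l"
    have m: "0 < m" by (simp add: m_def moment_pos)
    have far: "Y w ^ l \<le> \<delta> / 2 * m" if w: "w \<in> space M" "\<gamma> \<le> X w" for w
    proof -
      have "\<eta> \<le> X w ^ hd ks" unfolding \<eta>_def using \<gamma> w by (intro power_mono) auto
      also have "\<dots> \<le> power_sum ks (X w)" using ks w X_nonneg by (intro power_sum_ge_hd) auto
      finally have "power_sum ks 0 + power_sum ls (Y w) \<le> 1 - \<eta>"
        using curve[OF w(1)] ks by (simp add: power_sum_0)
      from q(3)[OF _ _ this] have "power_sum ks 0 + power_sum ls (Y w / q) \<le> 1"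
        using Y_nonneg w by simp
      \<comment> \<open>The lower bound is taken at first coordinate 0 and exponent 0, where the
        first factor is \<open>0 ^ 0 = 1\<close>.\<close>
      then have "c * s ^ l * (Y w / q) ^ l \<le> m"
        using c(2)[of 0 "Y w / q" 0 l] q Y_nonneg w by (simp add: m_def)
      then have "c * Y w ^ l \<le> s ^ l * m"
        using s by (simp add: power_divide power_mult_distrib field_simps)
      also have "\<dots> \<le> s ^ N * m"
        using s n m by (intro mult_right_mono power_decreasing) auto
      also have "\<dots> \<le> \<delta> / 2 * c * m"
        using N m by (intro mult_right_mono) auto
      also have "\<dots> = c * (\<delta> / 2 * m)" by simp
      finally show ?thesis using c by (simp only: mult_le_cancel_left_pos)
    qed
    have point: "X w * Y w ^ l \<le> \<delta> / 2 * Y w ^ l + \<delta> / 2 * m" if w: "w \<in> space M" for w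
    proof (cases "\<gamma> \<le> X w")
      case True
      have "X w * Y w ^ l \<le> 1 * Y w ^ l"
        using X_le_1[OF w] Y_nonneg[OF w] by (intro mult_right_mono) auto
      moreover have "0 \<le> \<delta> / 2 * Y w ^ l" using Y_nonneg[OF w] \<delta> by simp
      ultimately show ?thesis using far[OF w True] by linarith
    next
      case False
      then have "X w * Y w ^ l \<le> \<delta> / 2 * Y w ^ l"
        using \<gamma> Y_nonneg[OF w] by (intro mult_right_mono) auto
      moreover have "0 \<le> \<delta> / 2 * m" using m \<delta> by simp
      ultimately show ?thesis by linarith
    qed
    have int: "integrable M (\<lambda>w. Y w ^ l)" "integrable M (\<lambda>w. X w * Y w ^ l)"
      using integrable_monomial[of 0 l] integrable_monomial[of 1 l] by simp_all
    have "moment 1 l = (\<integral>w. X w * Y w ^ l \<partial>M)" by (simp add: moment_def)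
    also have "\<dots> \<le> (\<integral>w. \<delta> / 2 * Y w ^ l + \<delta> / 2 * m \<partial>M)"
      using point by (intro integral_mono int Bochner_Integration.integrable_add
          integrable_mult_right integrable_const) auto
    also have "\<dots> = \<delta> / 2 * m + \<delta> / 2 * m"
      using total by (subst Bochner_Integration.integral_add)
        (intro integrable_mult_right int integrable_const, intro integrable_const, simp add: m_def moment_def)
    finally show "moment 1 l \<le> \<delta> * moment 0 l" by (simp add: m_def)
  qed
qed

end

section \<open>Density of the polynomials\<close>

text \<open>One operation covers the rotations of a coordinate, for \<open>norm a = 1\<close>, and
  the discs along which holomorphy is tested, for \<open>norm a \<le> 1\<close>.\<close>

definition dilate :: "'n::finite \<Rightarrow> complex \<Rightarrow> complex^'n \<Rightarrow> complex^'n" where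
  "dilate v a z = (\<chi> u. if u = v then a * z $ u else z $ u)"

lemma dilate_nth [simp]: "dilate v a z $ u = (if u = v then a * z $ u else z $ u)"
  by (simp add: dilate_def)

lemma dilate_1 [simp]: "dilate v 1 z = z"
  by (simp add: vec_eq_iff)

lemma dilate_dilate [simp]: "dilate v a (dilate v b z) = dilate v (a * b) z"
  by (simp add: vec_eq_iff)

lemma dilate_commute: "dilate u a (dilate v b z) = dilate v b (dilate u a z)"
  by (simp add: vec_eq_iff)

lemma continuous_on_dilate [continuous_intros]:
  assumes "continuous_on S f" "continuous_on S g"
  shows "continuous_on S (\<lambda>x. dilate v (f x) (g x))"
  unfolding dilate_def
proof (rule continuous_on_vec_lambda)
  fix u show "continuous_on S (\<lambda>x. if u = v then f x * g x $ u else g x $ u)"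
    using assms by (cases "u = v") (auto intro!: continuous_intros)
qed

lemma dist_dilate: "dist (dilate v a z) z = norm (1 - a) * norm (z $ v)"
proof -
  have "dist (dilate v a z) z = L2_set (\<lambda>u. if u = v then norm (1 - a) * norm (z $ v) else 0) UNIV"
    unfolding dist_vec_def
    by (intro L2_set_cong refl) (auto simp: dist_norm norm_mult[symmetric] algebra_simps norm_minus_commute)
  also have "\<dots> = norm (1 - a) * norm (z $ v)"
    by (simp add: L2_set_def if_distrib[where f = "\<lambda>x. x\<^sup>2"] cong: if_cong)
  finally show ?thesis .
qed

definition monomial :: "('n::finite \<Rightarrow> nat) \<Rightarrow> complex^'n \<Rightarrow> complex" where
  "monomial \<alpha> z = (\<Prod>u\<in>UNIV. z $ u ^ \<alpha> u)"

text \<open>A complete Reinhardt set. The point with all coordinates equal to \<open>\<rho>\<close>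
  lies off the coordinate hyperplanes, and the coefficient of a monomial is read off there.\<close>

locale reinhardt_compact =
  fixes K :: "(complex^'n::finite) set" and \<rho> :: real
  assumes compact_K: "compact K"
    and dilate_in: "z \<in> K \<Longrightarrow> norm a \<le> 1 \<Longrightarrow> dilate v a z \<in> K"
    and \<rho>: "0 < \<rho>" "(\<chi> u. of_real \<rho>) \<in> K"
begin

text \<open>
  Holomorphy on the interior enters only through the discs \<open>a \<mapsto> dilate v a z\<close>, which may also
  be used at boundary points of \<open>K\<close>.
\<close>

definition disc_holomorphic :: "(complex^'n \<Rightarrow> complex) \<Rightarrow> bool" where
  "disc_holomorphic f \<longleftrightarrow> continuous_on K f \<and>
     (\<forall>v. \<forall>z\<in>K. (\<lambda>a. f (dilate v a z)) holomorphic_on ball 0 1)"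

definition homogeneous :: "'n \<Rightarrow> nat \<Rightarrow> (complex^'n \<Rightarrow> complex) \<Rightarrow> bool" where
  "homogeneous v n f \<longleftrightarrow> (\<forall>z\<in>K. \<forall>a. norm a \<le> 1 \<longrightarrow> f (dilate v a z) = a ^ n * f z)"

text \<open>The part of \<open>f\<close> that is homogeneous of degree \<open>n\<close> in the
  coordinate \<open>v\<close>. Taking it from the disc through \<open>z\<close> avoids a division by
  \<open>z $ v\<close>, so it makes sense where this coordinate vanishes.\<close>

definition taylor :: "'n \<Rightarrow> (complex^'n \<Rightarrow> complex) \<Rightarrow> nat \<Rightarrow> complex^'n \<Rightarrow> complex" where
  "taylor v f n z = (deriv ^^ n) (\<lambda>a. f (dilate v a z)) 0 / fact n"

lemma disc_holomorphicD:
  assumes "disc_holomorphic f"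
  shows "continuous_on K f" "z \<in> K \<Longrightarrow> (\<lambda>a. f (dilate v a z)) holomorphic_on ball 0 1"
  using assms by (auto simp: disc_holomorphic_def)

lemma disc_continuous:
  assumes "continuous_on K f" "z \<in> K"
  shows "continuous_on (cball 0 1) (\<lambda>a. f (dilate v a z))"
  by (rule continuous_on_compose2[OF assms(1)])
    (auto intro!: continuous_intros dilate_in assms)

lemma disc_holomorphic_diff:
  "disc_holomorphic f \<Longrightarrow> disc_holomorphic g \<Longrightarrow> disc_holomorphic (\<lambda>z. f z - g z)"
  by (auto simp: disc_holomorphic_def intro!: continuous_intros holomorphic_intros)

lemma disc_holomorphic_sum:
  "(\<And>i. i \<in> A \<Longrightarrow> disc_holomorphic (f i)) \<Longrightarrow> disc_holomorphic (\<lambda>z. \<Sum>i\<in>A. f i z)"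
  by (auto simp: disc_holomorphic_def intro!: continuous_intros holomorphic_intros)

lemma disc_holomorphic_cmult:
  "disc_holomorphic f \<Longrightarrow> disc_holomorphic (\<lambda>z. f z * c)"
  by (auto simp: disc_holomorphic_def intro!: continuous_intros holomorphic_intros)

lemma disc_holomorphic_dilate:
  assumes f: "disc_holomorphic f" and a: "norm a \<le> 1"
  shows "disc_holomorphic (\<lambda>z. f (dilate v a z))"
  unfolding disc_holomorphic_def
proof (intro conjI allI ballI)
  show "continuous_on K (\<lambda>z. f (dilate v a z))"
    by (rule continuous_on_compose2[OF disc_holomorphicD(1)[OF f]])
      (auto intro!: continuous_intros dilate_in a)
  fix u z assume z: "z \<in> K"
  show "(\<lambda>b. f (dilate v a (dilate u b z))) holomorphic_on ball 0 1"
    using disc_holomorphicD(2)[OF f dilate_in[OF z a], of u v]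
    by (simp add: dilate_commute[of v])
qed

lemma disc_holomorphic_uniform_limit:
  assumes F: "\<And>n. disc_holomorphic (F n)" and lim: "uniform_limit K F g sequentially"
  shows "disc_holomorphic g"
  unfolding disc_holomorphic_def
proof (intro conjI allI ballI)
  show "continuous_on K g"
    by (rule uniform_limit_theorem[OF _ lim]) (simp_all add: disc_holomorphicD(1)[OF F])
  fix v z assume z: "z \<in> K"
  have "uniform_limit (cball 0 1) (\<lambda>n a. F n (dilate v a z)) (\<lambda>a. g (dilate v a z)) sequentially"
    by (rule uniform_limit_compose'[OF lim]) (auto intro: dilate_in z)
  then show "(\<lambda>a. g (dilate v a z)) holomorphic_on ball 0 1"
  proof (rule holomorphic_uniform_limit[rotated])
    show "\<forall>\<^sub>F n in sequentially. continuous_on (cball 0 1) (\<lambda>a. F n (dilate v a z)) \<and>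
        (\<lambda>a. F n (dilate v a z)) holomorphic_on ball 0 1"
      using disc_continuous[OF disc_holomorphicD(1)[OF F] z] disc_holomorphicD(2)[OF F z] by simp
  qed auto
qed

lemma taylor_bound:
  assumes f: "disc_holomorphic f" and B: "\<And>z. z \<in> K \<Longrightarrow> norm (f z) \<le> B" and z: "z \<in> K"
  shows "norm (taylor v f n z) \<le> B"
proof -
  have "norm ((deriv ^^ n) (\<lambda>a. f (dilate v a z)) 0) \<le> fact n * B / 1 ^ n"
    using disc_holomorphicD(2)[OF f z] disc_continuous[OF disc_holomorphicD(1)[OF f] z]
    by (rule Cauchy_inequality) (auto intro!: B dilate_in z)
  then show ?thesis
    by (simp add: taylor_def norm_divide field_simps)
qed

text \<open>Cauchy's estimate bounds all coefficients by the supremum over \<open>K\<close>, so a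
  geometric series dominates the tail uniformly in \<open>z\<close>.\<close>

lemma taylor_remainder:
  assumes f: "disc_holomorphic f" and B: "\<And>z. z \<in> K \<Longrightarrow> norm (f z) \<le> B" and z: "z \<in> K"
    and a: "norm a < 1"
  shows "norm (f (dilate v a z) - (\<Sum>n<N. taylor v f n z * a ^ n)) \<le> B * norm a ^ N / (1 - norm a)"
proof -
  have "(\<lambda>n. taylor v f n z * a ^ n) sums f (dilate v a z)"
    using holomorphic_power_series[OF disc_holomorphicD(2)[OF f z], of a v] a
    by (simp add: taylor_def)
  then have "(\<lambda>n. taylor v f (n + N) z * a ^ (n + N)) sums
      (f (dilate v a z) - (\<Sum>n<N. taylor v f n z * a ^ n))"
    by (subst sums_iff_shift) simp
  moreover have "(\<lambda>n. B * norm a ^ N * norm a ^ n) sums (B * norm a ^ N * (1 / (1 - norm a)))"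
    using a by (intro sums_mult geometric_sums) simp
  moreover have "norm (taylor v f (n + N) z * a ^ (n + N)) \<le> B * norm a ^ N * norm a ^ n" for n
  proof -
    have "norm (taylor v f (n + N) z) * norm a ^ (n + N) \<le> B * norm a ^ (n + N)"
      by (intro mult_right_mono taylor_bound[OF f B z]) auto
    then show ?thesis by (simp add: norm_mult norm_power power_add mult_ac)
  qed
  ultimately show ?thesis
    using norm_sums_le by fastforce
qed

lemma disc_holomorphic_bounded:
  assumes "disc_holomorphic f"
  obtains B where "0 < B" "\<And>z. z \<in> K \<Longrightarrow> norm (f z) \<le> B"
  using compact_imp_bounded[OF compact_continuous_image[OF disc_holomorphicD(1)[OF assms] compact_K]]
  by (auto simp: bounded_pos)

text \<open>After subtraction of the lower terms and division by \<open>a ^ n\<close>, the values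
  \<open>f (dilate v a z)\<close> converge to \<open>taylor v f n z\<close> uniformly in
  \<open>z\<close> as \<open>a\<close> tends to 0. The property passes to uniform limits, and
  induction handles the subtracted terms; this avoids differentiation under a parameter.\<close>

lemma disc_holomorphic_taylor:
  assumes f: "disc_holomorphic f"
  shows "disc_holomorphic (taylor v f n)"
proof (induction n rule: less_induct)
  case (less n)
  obtain B where B: "0 < B" "\<And>z. z \<in> K \<Longrightarrow> norm (f z) \<le> B"
    using disc_holomorphic_bounded[OF f] by blast
  \<comment> \<open>Values of at most 1/2 keep the factor \<open>1 / (1 - a k)\<close> of the
    remainder below or equal to 2.\<close>
  define a :: "nat \<Rightarrow> real" where "a k = 1 / (real k + 2)" for k
  have a: "0 < a k" "a k \<le> 1/2" for k by (auto simp: a_def field_simps)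
  define F where "F k z = (f (dilate v (a k) z) - (\<Sum>m<n. taylor v f m z * of_real (a k) ^ m)) * (1 / of_real (a k) ^ n)"
    for k z
  have bound: "norm (F k z - taylor v f n z) \<le> 2 * B * a k" if z: "z \<in> K" for k z
  proof -
    have "norm (f (dilate v (a k) z) - (\<Sum>m<Suc n. taylor v f m z * of_real (a k) ^ m))
        \<le> B * a k ^ Suc n / (1 - a k)"
      using taylor_remainder[OF f B(2) z, of "of_real (a k)" v "Suc n"] a[of k] by simp
    also have "\<dots> \<le> B * a k ^ Suc n / (1/2)"
      using a[of k] B by (intro divide_left_mono) auto
    finally have *: "norm (f (dilate v (a k) z) - (\<Sum>m<Suc n. taylor v f m z * of_real (a k) ^ m))
        \<le> 2 * B * a k * a k ^ n" by simp
    have "F k z - taylor v f n z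
        = (f (dilate v (a k) z) - (\<Sum>m<Suc n. taylor v f m z * of_real (a k) ^ m)) / of_real (a k) ^ n"
      using a[of k] by (simp add: F_def field_simps)
    then have "norm (F k z - taylor v f n z)
        = norm (f (dilate v (a k) z) - (\<Sum>m<Suc n. taylor v f m z * of_real (a k) ^ m)) / a k ^ n"
      using a[of k] by (simp add: norm_divide norm_power)
    also have "\<dots> \<le> 2 * B * a k"
      using * a[of k] by (simp only: pos_divide_le_eq zero_less_power)
    finally show ?thesis .
  qed
  show ?case
  proof (rule disc_holomorphic_uniform_limit)
    show "disc_holomorphic (F k)" for k
      unfolding F_def using a[of k]
      by (intro disc_holomorphic_cmult disc_holomorphic_diff disc_holomorphic_sum
          disc_holomorphic_dilate f less) auto
    have "(\<lambda>k. 1 / real (k + 2)) \<longlonglongrightarrow> 0"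
      by (rule LIMSEQ_ignore_initial_segment[OF lim_1_over_n])
    then have "a \<longlonglongrightarrow> 0" by (simp add: a_def[abs_def] add.commute)
    then have "(\<lambda>k. 2 * B * a k) \<longlonglongrightarrow> 0" by (rule tendsto_mult_right_zero)
    then show "uniform_limit K F (taylor v f n) sequentially"
      unfolding uniform_limit_iff dist_norm
      by (auto dest!: order_tendstoD(2) elim!: eventually_mono intro: le_less_trans[OF bound])
  qed
qed

lemma homogeneous_taylor:
  assumes f: "disc_holomorphic f"
  shows "homogeneous v n (taylor v f n)"
  unfolding homogeneous_def
proof (intro ballI allI impI)
  fix z a assume z: "z \<in> K" and a: "norm (a :: complex) \<le> 1"
  have "(deriv ^^ n) (\<lambda>b. f (dilate v (a * b) z)) 0 = a ^ n * (deriv ^^ n) (\<lambda>b. f (dilate v b z)) (a * 0)"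
    using disc_holomorphicD(2)[OF f z, of v]
  proof (rule higher_deriv_compose_linear)
    fix b :: complex assume "b \<in> ball 0 1"
    then show "a * b \<in> ball 0 1"
      using a mult_left_le_one_le[of "norm b" "norm a"] by (simp add: norm_mult)
  qed auto
  then show "taylor v f n (dilate v a z) = a ^ n * taylor v f n z"
    by (simp add: taylor_def mult.commute)
qed

text \<open>Dilations of different coordinates commute, so the factor \<open>a ^ k\<close> comes out
  of the derivative along \<open>v\<close>. Degrees that are already fixed thus survive the next
  expansion.\<close>

lemma homogeneous_taylor_other:
  assumes f: "disc_holomorphic f" and hom: "homogeneous u k f" and "u \<noteq> v"
  shows "homogeneous u k (taylor v f n)"
  unfolding homogeneous_def
proof (intro ballI allI impI)
  fix z a assume z: "z \<in> K" and a: "norm (a :: complex) \<le> 1"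
  note hol = disc_holomorphicD(2)[OF f]
  have "(deriv ^^ n) (\<lambda>b. f (dilate v b (dilate u a z))) 0 = (deriv ^^ n) (\<lambda>b. a ^ k * f (dilate v b z)) 0"
  proof (rule higher_deriv_transform_within_open[where S = "ball 0 1"])
    show "(\<lambda>b. f (dilate v b (dilate u a z))) holomorphic_on ball 0 1"
      by (intro hol dilate_in z a)
    show "(\<lambda>b. a ^ k * f (dilate v b z)) holomorphic_on ball 0 1"
      by (intro holomorphic_intros hol z)
    show "f (dilate v b (dilate u a z)) = a ^ k * f (dilate v b z)" if "b \<in> ball 0 1" for b
      using hom dilate_in[OF z, of b v] that a
      by (simp add: dilate_commute[of v] homogeneous_def)
  qed auto
  also have "\<dots> = a ^ k * (deriv ^^ n) (\<lambda>b. f (dilate v b z)) 0"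
    by (rule higher_deriv_cmult[OF hol[OF z]]) auto
  finally show "taylor v f n (dilate u a z) = a ^ k * taylor v f n z"
    by (simp add: taylor_def)
qed

lemma homogeneous_all_dilate:
  assumes hom: "\<And>u. homogeneous u (d u) f" and z: "z \<in> K" and a: "\<And>u. norm (a u) \<le> 1"
  shows "f (\<chi> u. a u * z $ u) = (\<Prod>u\<in>UNIV. a u ^ d u) * f z"
proof -
  define D where "D V = (\<chi> u. if u \<in> V then a u * z $ u else z $ u)" for V
  have "D V \<in> K \<and> f (D V) = (\<Prod>u\<in>V. a u ^ d u) * f z" if "finite V" for V
    using that
  proof (induction V)
    case empty
    then show ?case using z by (simp add: D_def)
  next
    case (insert v V)
    have "D (insert v V) = dilate v (a v) (D V)"
      using insert by (simp add: D_def vec_eq_iff)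
    then show ?case
      using insert hom[of v] a[of v] dilate_in by (simp add: homogeneous_def mult.assoc)
  qed
  from this[of UNIV] show ?thesis by (simp add: D_def)
qed

text \<open>A point of \<open>K\<close> close to the origin arises by dilations from the point with
  all coordinates \<open>\<rho>\<close>, which gives the formula there; homogeneity carries it to
  all of \<open>K\<close>.\<close>

lemma homogeneous_all_monomial:
  assumes hom: "\<And>u. homogeneous u (d u) f"
  obtains c where "\<And>z. z \<in> K \<Longrightarrow> f z = c * monomial d z"
proof (rule that)
  fix z assume z: "z \<in> K"
  define e :: "complex^'n" where "e = (\<chi> u. of_real \<rho>)"
  have e: "e \<in> K" using \<rho> by (simp add: e_def)
  \<comment> \<open>Chosen so that every coordinate of \<open>t * z\<close> has modulus at most
    \<open>\<rho>\<close>; the summand 1 covers \<open>z = 0\<close>.\<close>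
  define t where "t = 1 / (1 + norm z / \<rho>)"
  have den: "0 < 1 + norm z / \<rho>" "1 \<le> 1 + norm z / \<rho>" using \<rho> by (auto intro: add_pos_nonneg)
  then have t: "0 < t" "t \<le> 1" by (auto simp: t_def)
  have tz: "norm (of_real t * z $ u / of_real \<rho>) \<le> 1" for u
  proof -
    have "t * (norm (z $ u) / \<rho>) \<le> t * (1 + norm z / \<rho>)"
      using t \<rho> Finite_Cartesian_Product.norm_nth_le[of z u] by (intro mult_left_mono) (auto simp: field_simps)
    also have "\<dots> = 1" using den by (simp add: t_def)
    finally show ?thesis using t \<rho> by (simp add: norm_mult norm_divide)
  qed
  have "(\<Prod>u\<in>UNIV. of_real t ^ d u) * f z = f (\<chi> u. of_real t * z $ u)"
    using t by (intro homogeneous_all_dilate[OF hom z, symmetric]) auto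
  also have "(\<chi> u. of_real t * z $ u) = (\<chi> u. (of_real t * z $ u / of_real \<rho>) * e $ u)"
    using \<rho> by (simp add: e_def vec_eq_iff)
  also have "f \<dots> = (\<Prod>u\<in>UNIV. (of_real t * z $ u / of_real \<rho>) ^ d u) * f e"
    by (rule homogeneous_all_dilate[OF hom e tz])
  also have "\<dots> = (\<Prod>u\<in>UNIV. of_real t ^ d u) * (f e / (\<Prod>u\<in>UNIV. of_real \<rho> ^ d u) * monomial d z)"
    by (simp add: power_divide power_mult_distrib prod.distrib prod_dividef monomial_def)
  finally show "f z = f e / (\<Prod>u\<in>UNIV. of_real \<rho> ^ d u) * monomial d z"
    using t by (subst (asm) mult_cancel_left) (auto simp: e_def)
qed

text \<open>Uniform continuity on the compact \<open>K\<close>. The dilated function is evaluated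
  strictly inside each disc, where its expansion converges geometrically.\<close>

lemma disc_holomorphic_approx_dilate:
  assumes f: "disc_holomorphic f" and e: "0 < e"
  obtains r where "0 < r" "r < 1" "\<And>z. z \<in> K \<Longrightarrow> norm (f z - f (dilate v (of_real r) z)) < e"
proof -
  obtain d where d: "0 < d" "\<And>x y. x \<in> K \<Longrightarrow> y \<in> K \<Longrightarrow> dist x y < d \<Longrightarrow> dist (f x) (f y) < e"
    using compact_uniformly_continuous[OF disc_holomorphicD(1)[OF f] compact_K] e
    unfolding uniformly_continuous_on_def by metis
  obtain R where R: "0 < R" "\<And>z. z \<in> K \<Longrightarrow> norm z \<le> R"
    using compact_imp_bounded[OF compact_K] by (auto simp: bounded_pos)
  define s where "s = min (1/2) (d / (2 * R))"
  have s: "0 < s" "s < 1" "s * R < d" using d R by (auto simp: s_def min_def field_simps)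
  show thesis
  proof (rule that[of "1 - s"])
    fix z assume z: "z \<in> K"
    have "dist (dilate v (of_real (1 - s)) z) z = s * norm (z $ v)"
      using s by (simp add: dist_dilate)
    also have "\<dots> \<le> s * R"
      using s R(2)[OF z] Finite_Cartesian_Product.norm_nth_le[of z v] by (intro mult_left_mono) auto
    finally have "dist z (dilate v (of_real (1 - s)) z) < d"
      using s by (simp add: dist_commute)
    moreover have "dilate v (of_real (1 - s)) z \<in> K"
      using s by (intro dilate_in z) (simp del: of_real_diff)
    ultimately show "norm (f z - f (dilate v (of_real (1 - s)) z)) < e"
      using d(2)[OF z] by (simp add: dist_norm)
  qed (use s in auto)
qed

text \<open>Induction on the set of coordinates in which \<open>f\<close> is not yet known to be homogeneous.\<close>

lemma disc_holomorphic_approx_homogeneous: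
  assumes "finite V"
  shows "disc_holomorphic f \<Longrightarrow> (\<And>u. u \<notin> V \<Longrightarrow> homogeneous u (d u) f) \<Longrightarrow> 0 < e \<Longrightarrow>
    \<exists>q\<in>function_span monomial. \<forall>z\<in>K. norm (f z - q z) < e"
  using assms
proof (induction V arbitrary: f d e)
  case empty
  then obtain c where "\<And>z. z \<in> K \<Longrightarrow> f z = c * monomial d z"
    using homogeneous_all_monomial[of d f] by blast
  then show ?case
    using \<open>0 < e\<close> by (intro bexI[OF _ function_span_base[of c monomial d]]) simp
next
  case (insert v V)
  note f = insert.prems(1) and e = insert.prems(3)
  obtain r where r: "0 < r" "r < 1" "\<And>z. z \<in> K \<Longrightarrow> norm (f z - f (dilate v (of_real r) z)) < e / 3"
    using disc_holomorphic_approx_dilate[OF f, of "e / 3" v] e by auto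
  obtain B where B: "0 < B" "\<And>z. z \<in> K \<Longrightarrow> norm (f z) \<le> B"
    using disc_holomorphic_bounded[OF f] by blast
  obtain N where N: "r ^ N < e / 3 * (1 - r) / B"
    using real_arch_pow_inv[of "e / 3 * (1 - r) / B" r] r e B by auto
  have tail: "norm (f (dilate v (of_real r) z) - (\<Sum>n<N. taylor v f n z * of_real r ^ n)) < e / 3"
    if z: "z \<in> K" for z
  proof -
    have "norm (f (dilate v (of_real r) z) - (\<Sum>n<N. taylor v f n z * of_real r ^ n))
        \<le> B * r ^ N / (1 - r)"
      using taylor_remainder[OF f B(2) z, of "of_real r" v N] r by simp
    also have "\<dots> < e / 3"
      using N r B by (simp add: field_simps)
    finally show ?thesis .
  qed
  \<comment> \<open>An error of \<open>e / 3\<close> is shared among \<open>N\<close> coefficients;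
    the summand 1 covers \<open>N = 0\<close>. The other two thirds are spent on the dilation and on
    the tail.\<close>
  have "\<exists>q\<in>function_span monomial. \<forall>z\<in>K. norm (taylor v f n z - q z) < e / (3 * (real N + 1))" for n
  proof (rule insert.IH)
    show "disc_holomorphic (taylor v f n)" by (rule disc_holomorphic_taylor[OF f])
    \<comment> \<open>The expansion adds the degree \<open>n\<close> in \<open>v\<close> and
      preserves the known degrees, so \<open>v\<close> leaves the set of unknown
      coordinates.\<close>
    show "homogeneous u ((d(v := n)) u) (taylor v f n)" if "u \<notin> V" for u
      using that homogeneous_taylor[OF f] homogeneous_taylor_other[OF f insert.prems(2), of u v n]
      by (cases "u = v") auto
    show "0 < e / (3 * (real N + 1))" using e by simp
  qed
  then obtain q where q: "\<And>n. q n \<in> function_span monomial"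
    "\<And>n z. z \<in> K \<Longrightarrow> norm (taylor v f n z - q n z) < e / (3 * (real N + 1))"
    by metis
  define Q where "Q z = (\<Sum>n<N. of_real r ^ n * q n z)" for z
  have "Q \<in> function_span monomial"
    unfolding Q_def[abs_def] by (intro function_span_sum function_span_cmult q)
  moreover have "norm (f z - Q z) < e" if z: "z \<in> K" for z
  proof -
    have "norm ((\<Sum>n<N. taylor v f n z * of_real r ^ n) - Q z)
        = norm (\<Sum>n<N. of_real r ^ n * (taylor v f n z - q n z))"
      by (simp add: Q_def sum_subtractf[symmetric] algebra_simps)
    also have "\<dots> \<le> (\<Sum>n<N. e / (3 * (real N + 1)))"
    proof (rule sum_norm_le)
      fix n
      have "norm (of_real r ^ n * (taylor v f n z - q n z)) \<le> 1 * (e / (3 * (real N + 1)))"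
        unfolding norm_mult using r q(2)[OF z, of n]
        by (intro mult_mono) (auto simp: norm_power power_le_one less_imp_le)
      then show "norm (of_real r ^ n * (taylor v f n z - q n z)) \<le> e / (3 * (real N + 1))" by simp
    qed
    also have "\<dots> \<le> e / 3" using e by (simp add: field_simps)
    finally have "norm ((\<Sum>n<N. taylor v f n z * of_real r ^ n) - Q z) \<le> e / 3" .
    with r(3)[OF z] tail[OF z] show ?thesis
      using norm_triangle_ineq[of "f z - f (dilate v (of_real r) z)"
          "f (dilate v (of_real r) z) - (\<Sum>n<N. taylor v f n z * of_real r ^ n)"]
        norm_triangle_ineq[of "f z - (\<Sum>n<N. taylor v f n z * of_real r ^ n)"
          "(\<Sum>n<N. taylor v f n z * of_real r ^ n) - Q z"]
      by simp
  qed
  ultimately show ?case by blast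
qed

lemma disc_holomorphic_approx:
  assumes "disc_holomorphic f" "0 < e"
  obtains q where "q \<in> function_span monomial" "\<And>z. z \<in> K \<Longrightarrow> norm (f z - q z) < e"
proof -
  have "\<exists>q\<in>function_span monomial. \<forall>z\<in>K. norm (f z - q z) < e"
    by (rule disc_holomorphic_approx_homogeneous[OF finite[of UNIV] assms(1) _ assms(2)]) simp
  then show thesis using that by blast
qed

end

section \<open>Closed spans of orthonormal families\<close>

lemma L2_inner_commute_0: "L2_inner M f g = 0 \<Longrightarrow> L2_inner M g f = 0"
  using L2_inner_cnj[of M f g] by simp

text \<open>The family is not normalized because the lemma serves both the orthonormal
  \<open>e\<close> and the orthogonal remainders \<open>k\<close>, whose norms vary.\<close>

lemma L2_norm_square_sum_orthogonal:
  assumes k: "\<And>i. k i \<in> square_integrable M"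
    and orth: "\<And>i j. i \<noteq> j \<Longrightarrow> L2_inner M (k i) (k j) = 0"
  shows "finite A \<Longrightarrow> (L2_norm M (\<lambda>x. \<Sum>i\<in>A. c i * k i x))\<^sup>2 = (\<Sum>i\<in>A. (norm (c i))\<^sup>2 * (L2_norm M (k i))\<^sup>2)"
proof (induction A rule: finite_induct)
  case empty
  then show ?case by (simp add: L2_norm_def)
next
  case (insert a A)
  have "L2_inner M (\<lambda>x. \<Sum>i\<in>A. c i * k i x) (k a) = 0"
    using insert.hyps k
    by (subst L2_inner_sum_left)
      (auto simp: L2_inner_cmult_left L2_cmult intro!: sum.neutral orth)
  then have "L2_inner M (\<lambda>x. c a * k a x) (\<lambda>x. \<Sum>i\<in>A. c i * k i x) = 0"
    by (simp add: L2_inner_cmult_left L2_inner_commute_0)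
  then have "(L2_norm M (\<lambda>x. c a * k a x + (\<Sum>i\<in>A. c i * k i x)))\<^sup>2
      = (L2_norm M (\<lambda>x. c a * k a x))\<^sup>2 + (L2_norm M (\<lambda>x. \<Sum>i\<in>A. c i * k i x))\<^sup>2"
    using k by (subst L2_norm_add_square) (auto intro!: L2_sum L2_cmult)
  then show ?case
    using insert by (simp add: L2_norm_cmult power_mult_distrib)
qed

text \<open>Tychonoff in place of a diagonal argument: a product of closed discs is compact, and
  over a countable index set it is first countable, so that sequences suffice.\<close>

lemma convergent_subsequence_pointwise:
  fixes c :: "nat \<Rightarrow> 'i::countable \<Rightarrow> complex"
  assumes "\<And>n i. norm (c n i) \<le> B"
  obtains r l where "strict_mono (r :: nat \<Rightarrow> nat)" "\<forall>i. (\<lambda>n. c (r n) i) \<longlonglongrightarrow> l i"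
proof -
  define S where "S = PiE UNIV (\<lambda>_ :: 'i. cball (0::complex) B)"
  have "compactin (product_topology (\<lambda>_ :: 'i. euclidean :: complex topology) UNIV) S"
    unfolding S_def by (subst compactin_PiE) simp
  then have "compact S" by (simp add: euclidean_product_topology)
  then have "seq_compact S" by (rule compact_imp_seq_compact)
  moreover have "\<forall>n. c n \<in> S" using assms by (simp add: S_def PiE_iff)
  ultimately obtain l r where r: "strict_mono r" "(c \<circ> r) \<longlonglongrightarrow> l"
    by (rule seq_compactE) blast
  have "(\<lambda>n. c (r n) i) \<longlonglongrightarrow> l i" for i
    using continuous_on_tendsto_compose[OF continuous_on_product_coordinates r(2), of i] by (simp add: o_def)
  with r(1) show thesis by (intro that allI)
qed

locale orthonormal_family = finite_measure M for M :: "'a measure" +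
  fixes e :: "'i::countable \<Rightarrow> 'a \<Rightarrow> complex"
  assumes e: "e i \<in> square_integrable M"
    and orthonormal: "L2_inner M (e i) (e j) = (if i = j then 1 else 0)"
begin

definition closed_span :: "('a \<Rightarrow> complex) set" where
  "closed_span = {f \<in> square_integrable M.
     \<forall>\<epsilon>>0. \<exists>q\<in>function_span e. L2_norm M (\<lambda>x. f x - q x) < \<epsilon>}"

text \<open>The choice is determined up to null sets only. Linearity therefore holds almost
  everywhere, and the estimates below use that the projection is a nearest point.\<close>

definition proj :: "('a \<Rightarrow> complex) \<Rightarrow> 'a \<Rightarrow> complex" where
  "proj g = (SOME h. h \<in> closed_span \<and> (\<forall>f\<in>closed_span. L2_inner M (\<lambda>x. g x - h x) f = 0))"

lemma norm_e: "L2_norm M (e i) = 1"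
proof -
  have "of_real ((L2_norm M (e i))\<^sup>2) = (1 :: complex)"
    using orthonormal[of i i] L2_inner_self[of M "e i"] by simp
  then have "(L2_norm M (e i))\<^sup>2 = 1" by (simp only: of_real_eq_1_iff)
  then show ?thesis by (simp add: power2_eq_1_iff) (smt (verit) L2_norm_nonneg)
qed

lemma span_L2: "q \<in> function_span e \<Longrightarrow> q \<in> square_integrable M"
  by (auto simp: function_span_def intro!: L2_sum L2_cmult e)

lemma closed_span_L2: "f \<in> closed_span \<Longrightarrow> f \<in> square_integrable M"
  by (simp add: closed_span_def)

lemma span_closed_span: "q \<in> function_span e \<Longrightarrow> q \<in> closed_span"
  unfolding closed_span_def
  by (auto simp: span_L2 L2_norm_def intro!: bexI[of _ q])

lemma closed_span_cmult:
  assumes f: "f \<in> closed_span" shows "(\<lambda>x. c * f x) \<in> closed_span"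
  unfolding closed_span_def
proof (intro CollectI conjI allI impI)
  show "(\<lambda>x. c * f x) \<in> square_integrable M"
    by (intro L2_cmult closed_span_L2 f)
  fix \<epsilon> :: real assume \<epsilon>: "0 < \<epsilon>"
  then have "0 < \<epsilon> / (norm c + 1)" by (simp add: add_nonneg_pos)
  then obtain q where q: "q \<in> function_span e" "L2_norm M (\<lambda>x. f x - q x) < \<epsilon> / (norm c + 1)"
    using f unfolding closed_span_def by blast
  have "L2_norm M (\<lambda>x. c * f x - c * q x) = norm c * L2_norm M (\<lambda>x. f x - q x)"
    by (simp add: right_diff_distrib[symmetric] L2_norm_cmult)
  also have "\<dots> \<le> (norm c + 1) * L2_norm M (\<lambda>x. f x - q x)"
    by (intro mult_right_mono) auto
  also have "\<dots> < \<epsilon>"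
  proof -
    have "0 < norm c + 1" by (simp add: add_nonneg_pos)
    then show ?thesis using q(2) by (simp only: pos_less_divide_eq mult.commute)
  qed
  finally show "\<exists>q\<in>function_span e. L2_norm M (\<lambda>x. c * f x - q x) < \<epsilon>"
    by - (rule bexI[OF _ function_span_cmult[OF q(1), of c]])
qed

lemma closed_span_add:
  assumes f: "f \<in> closed_span" and g: "g \<in> closed_span"
  shows "(\<lambda>x. f x + g x) \<in> closed_span"
  unfolding closed_span_def
proof (intro CollectI conjI allI impI)
  note si = closed_span_L2[OF f] closed_span_L2[OF g]
  show "(\<lambda>x. f x + g x) \<in> square_integrable M"
    by (intro L2_add si)
  fix \<epsilon> :: real assume \<epsilon>: "0 < \<epsilon>"
  then have "0 < \<epsilon> / 2" by simp
  then obtain q q' where q: "q \<in> function_span e" "L2_norm M (\<lambda>x. f x - q x) < \<epsilon> / 2"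
    and q': "q' \<in> function_span e" "L2_norm M (\<lambda>x. g x - q' x) < \<epsilon> / 2"
    using f g unfolding closed_span_def by blast
  have "L2_norm M (\<lambda>x. (f x - q x) + (g x - q' x))
      \<le> L2_norm M (\<lambda>x. f x - q x) + L2_norm M (\<lambda>x. g x - q' x)"
    by (intro L2_norm_triangle L2_diff si span_L2[OF q(1)] span_L2[OF q'(1)])
  also have "\<dots> < \<epsilon>" using q(2) q'(2) by linarith
  finally have "L2_norm M (\<lambda>x. (f x + g x) - (q x + q' x)) < \<epsilon>"
    by (simp only: add_diff_add)
  then show "\<exists>q\<in>function_span e. L2_norm M (\<lambda>x. f x + g x - q x) < \<epsilon>"
    by - (rule bexI[OF _ function_span_add[OF q(1) q'(1)]])
qed

lemma closed_span_diff:
  assumes "f \<in> closed_span" "g \<in> closed_span" shows "(\<lambda>x. f x - g x) \<in> closed_span"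
  using closed_span_add[OF assms(1) closed_span_cmult[OF assms(2), of "-1"]] by simp

lemma closed_span_sum:
  "(\<And>i. i \<in> A \<Longrightarrow> f i \<in> closed_span) \<Longrightarrow> (\<lambda>x. \<Sum>i\<in>A. f i x) \<in> closed_span"
  by (induction A rule: infinite_finite_induct)
    (auto intro: span_closed_span function_span_0 closed_span_add)

lemma closed_span_approx:
  assumes f: "f \<in> square_integrable M"
    and approx: "\<And>\<epsilon>. 0 < \<epsilon> \<Longrightarrow> \<exists>g\<in>closed_span. L2_norm M (\<lambda>x. f x - g x) < \<epsilon>"
  shows "f \<in> closed_span"
  unfolding closed_span_def
proof (intro CollectI conjI allI impI f)
  fix \<epsilon> :: real assume "0 < \<epsilon>"
  then have \<epsilon>: "0 < \<epsilon> / 2" by simp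
  obtain g where g: "g \<in> closed_span" "L2_norm M (\<lambda>x. f x - g x) < \<epsilon> / 2"
    using approx[OF \<epsilon>] by blast
  obtain q where q: "q \<in> function_span e" "L2_norm M (\<lambda>x. g x - q x) < \<epsilon> / 2"
    using g(1) \<epsilon> unfolding closed_span_def by blast
  have "L2_norm M (\<lambda>x. f x - q x) < \<epsilon>"
    using L2_norm_triangle3[OF f closed_span_L2[OF g(1)] span_L2[OF q(1)]]
      g(2) q(2) by linarith
  with q(1) show "\<exists>q\<in>function_span e. L2_norm M (\<lambda>x. f x - q x) < \<epsilon>" by blast
qed

lemma closed_span_complete:
  assumes u: "\<And>n. u n \<in> closed_span"
    and Cauchy: "\<And>e. e > 0 \<Longrightarrow> \<exists>N. \<forall>m\<ge>N. \<forall>n\<ge>N. L2_norm M (\<lambda>x. u m x - u n x) < e"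
  obtains f where "f \<in> closed_span" "(\<lambda>n. L2_norm M (\<lambda>x. u n x - f x)) \<longlonglongrightarrow> 0"
proof -
  obtain f where f: "f \<in> square_integrable M" "(\<lambda>n. L2_norm M (\<lambda>x. u n x - f x)) \<longlonglongrightarrow> 0"
    using L2_complete[OF finite_measure_axioms closed_span_L2[OF u] Cauchy] by blast
  have "f \<in> closed_span"
  proof (rule closed_span_approx[OF f(1)])
    fix \<epsilon> :: real assume "0 < \<epsilon>"
    from order_tendstoD(2)[OF f(2) this]
    obtain n where "L2_norm M (\<lambda>x. u n x - f x) < \<epsilon>"
      by (auto simp: eventually_sequentially)
    then show "\<exists>g\<in>closed_span. L2_norm M (\<lambda>x. f x - g x) < \<epsilon>"
      using u[of n] L2_norm_minus_commute[of M "u n" f] by (intro bexI[of _ "u n"]) simp_all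
  qed
  then show thesis using f(2) by (rule that)
qed

lemma closed_span_orthogonal:
  assumes g: "g \<in> square_integrable M" and orth: "\<And>i. L2_inner M g (e i) = 0"
    and f: "f \<in> closed_span"
  shows "L2_inner M g f = 0"
proof -
  have "norm (L2_inner M g f) \<le> 0 + \<epsilon>" if \<epsilon>: "0 < \<epsilon>" for \<epsilon>
  proof -
    have pos: "0 < L2_norm M g + 1" by (simp add: add_nonneg_pos)
    with \<epsilon> have "0 < \<epsilon> / (L2_norm M g + 1)" by simp
    then obtain q where q: "q \<in> function_span e" "L2_norm M (\<lambda>x. f x - q x) < \<epsilon> / (L2_norm M g + 1)"
      using f unfolding closed_span_def by blast
    obtain A c where qA: "q = (\<lambda>x. \<Sum>i\<in>A. c i * e i x)"
      using q(1) by (auto simp: function_span_def)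
    have "L2_inner M q g = (\<Sum>i\<in>A. L2_inner M (\<lambda>x. c i * e i x) g)"
      unfolding qA by (intro L2_inner_sum_left L2_cmult e g)
    also have "\<dots> = 0"
      using orth by (intro sum.neutral) (simp add: L2_inner_cmult_left L2_inner_commute_0)
    finally have "L2_inner M g q = 0" by (rule L2_inner_commute_0)
    then have "L2_inner M g f = L2_inner M g (\<lambda>x. f x - q x)"
      using L2_inner_diff_right[OF closed_span_L2[OF f] span_L2[OF q(1)] g]
      by simp
    also have "norm \<dots> \<le> L2_norm M g * L2_norm M (\<lambda>x. f x - q x)"
      by (intro L2_inner_le g L2_diff closed_span_L2[OF f] span_L2[OF q(1)])
    also have "\<dots> \<le> (L2_norm M g + 1) * L2_norm M (\<lambda>x. f x - q x)"
      by (intro mult_right_mono) auto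
    also have "\<dots> < \<epsilon>"
      using q(2) pos by (simp only: pos_less_divide_eq mult.commute)
    finally show ?thesis by simp
  qed
  then have "norm (L2_inner M g f) \<le> 0" by (rule field_le_epsilon)
  then show ?thesis by simp
qed

lemma inner_sum_e:
  assumes "finite A" shows "L2_inner M (\<lambda>x. \<Sum>i\<in>A. c i * e i x) (e j) = (if j \<in> A then c j else 0)"
proof -
  have "L2_inner M (\<lambda>x. \<Sum>i\<in>A. c i * e i x) (e j) = (\<Sum>i\<in>A. L2_inner M (\<lambda>x. c i * e i x) (e j))"
    by (intro L2_inner_sum_left L2_cmult e)
  then show ?thesis using assms
    by (simp add: L2_inner_cmult_left orthonormal if_distrib[where f = "\<lambda>y. _ * y"] cong: if_cong)
qed

lemma norm_sum_e:
  assumes "finite A" shows "(L2_norm M (\<lambda>x. \<Sum>i\<in>A. c i * e i x))\<^sup>2 = (\<Sum>i\<in>A. (norm (c i))\<^sup>2)"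
  using L2_norm_square_sum_orthogonal[of e M A c] assms by (simp add: e orthonormal norm_e)

lemma sum_e_closed_span: "finite A \<Longrightarrow> (\<lambda>x. \<Sum>i\<in>A. c i * e i x) \<in> closed_span"
  by (intro span_closed_span) (auto simp: function_span_def)

text \<open>Pythagoras: the foot of the perpendicular is the nearest point of the closed span.
  Identities between projections can then be replaced by inequalities against a convenient
  competitor \<open>h'\<close>.\<close>

lemma norm_perp_le:
  assumes g: "g \<in> square_integrable M" and h: "h \<in> closed_span" and h': "h' \<in> closed_span"
    and perp: "\<And>f. f \<in> closed_span \<Longrightarrow> L2_inner M (\<lambda>x. g x - h x) f = 0"
  shows "L2_norm M (\<lambda>x. g x - h x) \<le> L2_norm M (\<lambda>x. g x - h' x)"
proof (rule power2_le_imp_le)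
  note si = closed_span_L2[OF h] closed_span_L2[OF h']
  have d: "(\<lambda>x. h x - h' x) \<in> closed_span" by (intro closed_span_diff h h')
  have "(L2_norm M (\<lambda>x. (g x - h x) + (h x - h' x)))\<^sup>2
      = (L2_norm M (\<lambda>x. g x - h x))\<^sup>2 + (L2_norm M (\<lambda>x. h x - h' x))\<^sup>2"
    using perp[OF d] by (subst L2_norm_add_square) (auto intro: L2_diff g si)
  then show "(L2_norm M (\<lambda>x. g x - h x))\<^sup>2 \<le> (L2_norm M (\<lambda>x. g x - h' x))\<^sup>2" by simp
qed simp

lemma bessel:
  assumes g: "g \<in> square_integrable M" and A: "finite A"
  shows "(\<Sum>i\<in>A. (norm (L2_inner M g (e i)))\<^sup>2) \<le> (L2_norm M g)\<^sup>2"
proof -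
  define s where "s x = (\<Sum>i\<in>A. L2_inner M g (e i) * e i x)" for x
  have s: "s \<in> square_integrable M"
    unfolding s_def[abs_def] by (intro L2_sum L2_cmult e)
  define d where "d x = g x - s x" for x
  have d: "d \<in> square_integrable M"
    unfolding d_def[abs_def] by (intro L2_diff g s)
  have "L2_inner M (\<lambda>x. L2_inner M g (e i) * e i x) d = 0" if "i \<in> A" for i
  proof -
    have "L2_inner M s (e i) = L2_inner M g (e i)"
      unfolding s_def[abs_def] inner_sum_e[OF A] using that by simp
    then have "L2_inner M d (e i) = 0"
      unfolding d_def[abs_def] L2_inner_diff_left[OF g s e] by simp
    then show ?thesis by (simp add: L2_inner_cmult_left L2_inner_commute_0)
  qed
  moreover have "L2_inner M s d = (\<Sum>i\<in>A. L2_inner M (\<lambda>x. L2_inner M g (e i) * e i x) d)"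
    unfolding s_def[abs_def] by (intro L2_inner_sum_left L2_cmult e d)
  ultimately have "L2_inner M s d = 0" by simp
  then have "(L2_norm M (\<lambda>x. s x + d x))\<^sup>2 = (L2_norm M s)\<^sup>2 + (L2_norm M d)\<^sup>2"
    by (subst L2_norm_add_square[OF s d]) simp
  then have "(L2_norm M g)\<^sup>2 = (L2_norm M s)\<^sup>2 + (L2_norm M d)\<^sup>2"
    by (simp add: d_def)
  moreover have "(L2_norm M s)\<^sup>2 = (\<Sum>i\<in>A. (norm (L2_inner M g (e i)))\<^sup>2)"
    unfolding s_def[abs_def] by (rule norm_sum_e[OF A])
  ultimately show ?thesis by simp
qed

text \<open>The partial Fourier sums of \<open>g\<close> are Cauchy, since their squared norms
  increase and Bessel's inequality bounds them. Their inner products with a fixed \<open>e i\<close>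
  are eventually constant, so the limit has the Fourier coefficients of \<open>g\<close>.\<close>

lemma proj_exists:
  assumes g: "g \<in> square_integrable M"
  shows "\<exists>h. h \<in> closed_span \<and> (\<forall>f\<in>closed_span. L2_inner M (\<lambda>x. g x - h x) f = 0)"
proof -
  define c where "c i = L2_inner M g (e i)" for i
  \<comment> \<open>Finite sections that exhaust the index set, ordered by the injection
    \<open>to_nat\<close>.\<close>
  define F where "F n = {i :: 'i. to_nat i < n}" for n
  have F: "finite (F n)" for n
    unfolding F_def by (rule finite_imageD[of to_nat]) (auto intro: finite_subset[of _ "{..<n}"] inj_on_subset[OF inj_to_nat])
  have F_mono: "F m \<subseteq> F n" if "m \<le> n" for m n using that by (auto simp: F_def)
  define S where "S n x = (\<Sum>i\<in>F n. c i * e i x)" for n x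
  define s where "s n = (\<Sum>i\<in>F n. (norm (c i))\<^sup>2)" for n
  have S: "S n \<in> closed_span" for n
    unfolding S_def[abs_def] by (rule sum_e_closed_span[OF F])
  have diff: "(L2_norm M (\<lambda>x. S n x - S m x))\<^sup>2 = s n - s m" if "m \<le> n" for m n
  proof -
    have "S n x - S m x = (\<Sum>i\<in>F n - F m. c i * e i x)" for x
      unfolding S_def by (rule sum_diff[OF F F_mono[OF that], symmetric])
    then have "(L2_norm M (\<lambda>x. S n x - S m x))\<^sup>2 = (\<Sum>i\<in>F n - F m. (norm (c i))\<^sup>2)"
      using norm_sum_e[of "F n - F m" c] F by simp
    then show ?thesis
      unfolding s_def by (simp add: sum_diff[OF F F_mono[OF that]])
  qed
  have "incseq s"
    unfolding s_def by (intro monoI sum_mono2 F F_mono) auto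
  moreover have "s n \<le> (L2_norm M g)\<^sup>2" for n
    unfolding s_def c_def by (rule bessel[OF g F])
  ultimately obtain L where "s \<longlonglongrightarrow> L"
    using incseq_convergent[of s "(L2_norm M g)\<^sup>2"] by blast
  then have "Cauchy s" by (rule LIMSEQ_imp_Cauchy)
  have "\<exists>N. \<forall>m\<ge>N. \<forall>n\<ge>N. L2_norm M (\<lambda>x. S m x - S n x) < \<epsilon>" if \<epsilon>: "0 < \<epsilon>" for \<epsilon>
  proof -
    obtain N where N: "\<And>m n. m \<ge> N \<Longrightarrow> n \<ge> N \<Longrightarrow> \<bar>s m - s n\<bar> < \<epsilon>\<^sup>2"
      using \<open>Cauchy s\<close> \<epsilon> unfolding Cauchy_def dist_real_def by (meson zero_less_power)
    have le: "L2_norm M (\<lambda>x. S n x - S m x) < \<epsilon>" if "N \<le> m" "m \<le> n" for m n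
    proof (rule power2_less_imp_less)
      show "(L2_norm M (\<lambda>x. S n x - S m x))\<^sup>2 < \<epsilon>\<^sup>2"
        using N[of n m] that diff[OF that(2)] by linarith
    qed (use \<epsilon> in simp)
    have "L2_norm M (\<lambda>x. S m x - S n x) < \<epsilon>" if "N \<le> m" "N \<le> n" for m n
      using le[of m n] le[of n m] that L2_norm_minus_commute[of M "S m" "S n"]
      by (cases "m \<le> n") auto
    then show ?thesis by blast
  qed
  with S obtain h where h: "h \<in> closed_span" "(\<lambda>n. L2_norm M (\<lambda>x. S n x - h x)) \<longlonglongrightarrow> 0"
    by (rule closed_span_complete) blast
  note h_si = closed_span_L2[OF h(1)] and S_si = closed_span_L2[OF S]
  have perp: "L2_inner M (\<lambda>x. g x - h x) (e i) = 0" for i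
  proof -
    have "(\<lambda>n. L2_inner M (\<lambda>x. S n x - h x) (e i)) \<longlonglongrightarrow> 0"
    proof (rule tendsto_norm_zero_cancel, rule tendsto_sandwich[OF _ _ tendsto_const h(2)])
      show "\<forall>\<^sub>F n in sequentially. norm (L2_inner M (\<lambda>x. S n x - h x) (e i)) \<le> L2_norm M (\<lambda>x. S n x - h x)"
        using L2_inner_le[OF L2_diff[OF S_si h_si] e, of _ i] by (simp add: norm_e)
    qed simp
    moreover have "\<forall>\<^sub>F n in sequentially. L2_inner M (\<lambda>x. S n x - h x) (e i) = L2_inner M (\<lambda>x. g x - h x) (e i)"
    \<comment> \<open>The index \<open>i\<close> belongs to \<open>F n\<close> exactly when
      \<open>to_nat i < n\<close>.\<close>
    proof (rule eventually_sequentiallyI[of "Suc (to_nat i)"])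
      fix n assume "Suc (to_nat i) \<le> n"
      then have "L2_inner M (S n) (e i) = c i"
        unfolding S_def[abs_def] inner_sum_e[OF F] by (simp add: F_def)
      then show "L2_inner M (\<lambda>x. S n x - h x) (e i) = L2_inner M (\<lambda>x. g x - h x) (e i)"
        by (simp add: L2_inner_diff_left S_si h_si g e c_def)
    qed
    ultimately have "(\<lambda>n. L2_inner M (\<lambda>x. g x - h x) (e i)) \<longlonglongrightarrow> 0"
      by (rule Lim_transform_eventually)
    then show ?thesis by (simp add: LIMSEQ_const_iff)
  qed
  show ?thesis
    using h(1) closed_span_orthogonal[OF L2_diff[OF g h_si] perp]
    by (intro exI[of _ h] conjI ballI)
qed

lemma proj:
  assumes "g \<in> square_integrable M"
  shows "proj g \<in> closed_span" "\<And>f. f \<in> closed_span \<Longrightarrow> L2_inner M (\<lambda>x. g x - proj g x) f = 0"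
proof -
  have "proj g \<in> closed_span \<and> (\<forall>f\<in>closed_span. L2_inner M (\<lambda>x. g x - proj g x) f = 0)"
    unfolding proj_def by (rule someI_ex[OF proj_exists[OF assms]])
  then show "proj g \<in> closed_span" "\<And>f. f \<in> closed_span \<Longrightarrow> L2_inner M (\<lambda>x. g x - proj g x) f = 0"
    by blast+
qed

lemma proj_L2: "g \<in> square_integrable M \<Longrightarrow> proj g \<in> square_integrable M"
  by (rule closed_span_L2[OF proj(1)])

lemma proj_unique_AE:
  assumes g: "g \<in> square_integrable M" and h: "h \<in> closed_span"
    and perp: "\<And>f. f \<in> closed_span \<Longrightarrow> L2_inner M (\<lambda>x. g x - h x) f = 0"
  shows "AE x in M. proj g x = h x"
proof -
  define d where "d x = proj g x - h x" for x
  note si = proj_L2[OF g] closed_span_L2[OF h]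
  have d: "d \<in> closed_span" unfolding d_def[abs_def] by (intro closed_span_diff proj(1)[OF g] h)
  note d_si = closed_span_L2[OF d]
  have "L2_inner M d d = L2_inner M (\<lambda>x. (g x - h x) - (g x - proj g x)) d"
    by (rule arg_cong[where f = "\<lambda>u. L2_inner M u d"]) (simp add: d_def fun_eq_iff)
  also have "\<dots> = L2_inner M (\<lambda>x. g x - h x) d - L2_inner M (\<lambda>x. g x - proj g x) d"
    by (intro L2_inner_diff_left L2_diff g si d_si)
  also have "\<dots> = 0" using perp[OF d] proj(2)[OF g d] by simp
  finally have "L2_norm M d = 0" by (simp add: L2_inner_self)
  then have "AE x in M. d x = 0" by (simp add: L2_norm_eq_0_iff[OF d_si])
  then show ?thesis by (rule AE_mp) (simp add: d_def)
qed

lemma inner_proj_right: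
  assumes "g \<in> square_integrable M" "f \<in> closed_span"
  shows "L2_inner M f (proj g) = L2_inner M f g"
proof -
  have "L2_inner M f (\<lambda>x. g x - proj g x) = 0"
    using proj(2)[OF assms] by (rule L2_inner_commute_0)
  then show ?thesis
    using L2_inner_diff_right[OF assms(1) proj_L2[OF assms(1)]
        closed_span_L2[OF assms(2)]] by simp
qed

end

text \<open>An abstract Hankel operator with symbol \<open>b\<close>. Only membership of
  \<open>h i\<close> in \<open>closed_span\<close> is asked: the projection is the nearest point, so
  any such \<open>h i\<close> bounds the distance of \<open>b * e i\<close> from the span.\<close>

locale hankel = orthonormal_family M e for M :: "'a measure" and e :: "'i::countable \<Rightarrow> 'a \<Rightarrow> complex" +
  fixes b :: "'a \<Rightarrow> complex" and h :: "'i \<Rightarrow> 'a \<Rightarrow> complex"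
  assumes b_measurable: "b \<in> borel_measurable M" and b_le_1: "x \<in> space M \<Longrightarrow> norm (b x) \<le> 1"
    and h: "h i \<in> closed_span"
    and k_orthogonal: "i \<noteq> j \<Longrightarrow>
      L2_inner M (\<lambda>x. b x * e i x - h i x) (\<lambda>x. b x * e j x - h j x) = 0"
    and k_small: "0 < \<epsilon> \<Longrightarrow> finite {i. \<epsilon> \<le> L2_norm M (\<lambda>x. b x * e i x - h i x)}"
begin

definition k :: "'i \<Rightarrow> 'a \<Rightarrow> complex" where
  "k i x = b x * e i x - h i x"

definition hankel_op :: "('a \<Rightarrow> complex) \<Rightarrow> 'a \<Rightarrow> complex" where
  "hankel_op f x = b x * f x - proj (\<lambda>x. b x * f x) x"

lemma mult_b:
  assumes "f \<in> square_integrable M"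
  shows "(\<lambda>x. b x * f x) \<in> square_integrable M" "L2_norm M (\<lambda>x. b x * f x) \<le> L2_norm M f"
  using L2_bounded_mult[OF assms b_measurable b_le_1]
    L2_norm_bounded_mult[OF assms b_measurable b_le_1] by auto

lemma hankel_op_L2:
  "f \<in> square_integrable M \<Longrightarrow> hankel_op f \<in> square_integrable M"
  unfolding hankel_op_def[abs_def]
  by (intro L2_diff proj_L2 mult_b)

lemma hankel_op_perp:
  "f \<in> square_integrable M \<Longrightarrow> g \<in> closed_span \<Longrightarrow> L2_inner M (hankel_op f) g = 0"
  unfolding hankel_op_def[abs_def] by (intro proj mult_b)

lemma hankel_op_le:
  assumes "f \<in> square_integrable M" "g \<in> closed_span"
  shows "L2_norm M (hankel_op f) \<le> L2_norm M (\<lambda>x. b x * f x - g x)"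
  unfolding hankel_op_def[abs_def] by (intro norm_perp_le proj mult_b assms)

text \<open>Since \<open>proj\<close> respects differences almost everywhere only, the difference of
  two projections is treated as another foot of the perpendicular and compared by
  \<open>norm_perp_le\<close>.\<close>

lemma hankel_op_diff_le:
  assumes f: "f \<in> square_integrable M" and g: "g \<in> square_integrable M"
  shows "L2_norm M (\<lambda>x. hankel_op f x - hankel_op g x) \<le> L2_norm M (hankel_op (\<lambda>x. f x - g x))"
proof -
  have d: "(\<lambda>x. f x - g x) \<in> square_integrable M" by (intro L2_diff f g)
  have eq: "hankel_op f x - hankel_op g x
      = b x * (f x - g x) - (proj (\<lambda>x. b x * f x) x - proj (\<lambda>x. b x * g x) x)" for x
    by (simp add: hankel_op_def algebra_simps)
  have "L2_norm M (\<lambda>x. b x * (f x - g x) - (proj (\<lambda>x. b x * f x) x - proj (\<lambda>x. b x * g x) x))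
      \<le> L2_norm M (\<lambda>x. b x * (f x - g x) - proj (\<lambda>x. b x * (f x - g x)) x)"
  proof (rule norm_perp_le)
    fix q assume q: "q \<in> closed_span"
    have "L2_inner M (\<lambda>x. hankel_op f x - hankel_op g x) q = 0"
      using hankel_op_perp[OF f q] hankel_op_perp[OF g q]
        L2_inner_diff_left[OF hankel_op_L2[OF f] hankel_op_L2[OF g]
          closed_span_L2[OF q]] by simp
    then show "L2_inner M (\<lambda>x. b x * (f x - g x) - (proj (\<lambda>x. b x * f x) x - proj (\<lambda>x. b x * g x) x)) q = 0"
      by (simp only: eq)
  qed (intro closed_span_diff proj mult_b f g d)+
  then show ?thesis by (simp only: eq) (simp only: hankel_op_def[abs_def])
qed

lemma hankel_op_triangle:
  assumes f: "f \<in> square_integrable M" and g: "g \<in> square_integrable M"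
  shows "L2_norm M (hankel_op (\<lambda>x. f x + g x)) \<le> L2_norm M (hankel_op f) + L2_norm M (hankel_op g)"
proof -
  have "L2_norm M (hankel_op (\<lambda>x. f x + g x))
      \<le> L2_norm M (\<lambda>x. b x * (f x + g x) - (proj (\<lambda>x. b x * f x) x + proj (\<lambda>x. b x * g x) x))"
    by (intro hankel_op_le L2_add closed_span_add proj mult_b f g)
  also have "\<dots> = L2_norm M (\<lambda>x. hankel_op f x + hankel_op g x)"
    by (simp add: hankel_op_def algebra_simps)
  also have "\<dots> \<le> L2_norm M (hankel_op f) + L2_norm M (hankel_op g)"
    by (intro L2_norm_triangle hankel_op_L2 f g)
  finally show ?thesis .
qed

lemma hankel_op_contraction:
  assumes "f \<in> square_integrable M" shows "L2_norm M (hankel_op f) \<le> L2_norm M f"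
proof -
  have "L2_norm M (hankel_op f) \<le> L2_norm M (\<lambda>x. b x * f x - 0)"
    by (intro hankel_op_le assms span_closed_span function_span_0)
  with mult_b(2)[OF assms] show ?thesis by simp
qed

lemma k_L2: "k i \<in> square_integrable M"
  unfolding k_def[abs_def]
  by (intro L2_diff mult_b e closed_span_L2[OF h])

text \<open>A finite combination of the \<open>e i\<close> with \<open>i \<notin> F\<close> has an
  image no longer than the same combination of the \<open>k i\<close>. These are orthogonal with
  norms at most \<open>\<epsilon>\<close>, which gives the factor \<open>\<epsilon>\<close>;
  approximation extends it to \<open>f\<close>.\<close>

lemma hankel_op_tail:
  assumes F: "finite F" and \<epsilon>: "0 \<le> \<epsilon>" and small: "\<And>i. i \<notin> F \<Longrightarrow> L2_norm M (k i) \<le> \<epsilon>"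
    and f: "f \<in> closed_span" and coeff: "\<And>i. i \<in> F \<Longrightarrow> L2_inner M f (e i) = 0"
  shows "L2_norm M (hankel_op f) \<le> \<epsilon> * L2_norm M f"
proof (rule field_le_epsilon)
  fix \<delta> :: real assume \<delta>: "0 < \<delta>"
  note f_si = closed_span_L2[OF f]
  \<comment> \<open>The error \<open>f - p\<close> has norm at most \<open>2 * \<eta>\<close> and
    enters twice: directly, and through the norm of \<open>p\<close> multiplied by
    \<open>\<epsilon>\<close>. The choice makes the total equal to \<open>\<delta>\<close>.\<close>
  define \<eta> where "\<eta> = \<delta> / (2 + 2 * \<epsilon>)"
  have \<eta>: "0 < \<eta>" "2 * \<eta> + \<epsilon> * (2 * \<eta>) = \<delta>"
  proof -
    have pos: "0 < 2 + 2 * \<epsilon>" using \<epsilon> by simp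
    then show "0 < \<eta>" using \<delta> by (simp add: \<eta>_def)
    have "2 * \<eta> + \<epsilon> * (2 * \<eta>) = (2 + 2 * \<epsilon>) * \<eta>" by (simp add: algebra_simps)
    also have "\<dots> = \<delta>" unfolding \<eta>_def using pos by simp
    finally show "2 * \<eta> + \<epsilon> * (2 * \<eta>) = \<delta>" .
  qed
  obtain q where q: "q \<in> function_span e" "L2_norm M (\<lambda>x. f x - q x) < \<eta>"
    using f \<eta>(1) unfolding closed_span_def by blast
  obtain A c where A: "finite A" and qA: "q = (\<lambda>x. \<Sum>i\<in>A. c i * e i x)"
    using q(1) by (auto simp: function_span_def)
  note q_si = span_L2[OF q(1)]
  define p where "p x = (\<Sum>i\<in>A - F. c i * e i x)" for x
  have p_si: "p \<in> square_integrable M"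
    unfolding p_def[abs_def] by (intro L2_sum L2_cmult e)
  \<comment> \<open>The coefficients of \<open>f\<close> in \<open>F\<close> vanish, so those of
    \<open>q\<close> are coefficients of the small error \<open>f - q\<close>, and Bessel's
    inequality allows them to be dropped.\<close>
  have c: "c i = - L2_inner M (\<lambda>x. f x - q x) (e i)" if "i \<in> A \<inter> F" for i
  proof -
    have "L2_inner M q (e i) = c i" unfolding qA inner_sum_e[OF A] using that by simp
    then show ?thesis
      using that coeff[of i] unfolding L2_inner_diff_left[OF f_si q_si e] by simp
  qed
  have "L2_norm M (\<lambda>x. q x - p x) \<le> \<eta>"
  proof (rule power2_le_imp_le)
    have "q x - p x = (\<Sum>i\<in>A \<inter> F. c i * e i x)" for x
      unfolding qA p_def using sum.Int_Diff[OF A, of "\<lambda>i. c i * e i x" F] by simp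
    then have "(L2_norm M (\<lambda>x. q x - p x))\<^sup>2 = (\<Sum>i\<in>A \<inter> F. (norm (c i))\<^sup>2)"
      using norm_sum_e[of "A \<inter> F" c] A by simp
    also have "\<dots> = (\<Sum>i\<in>A \<inter> F. (norm (L2_inner M (\<lambda>x. f x - q x) (e i)))\<^sup>2)"
      using c by (intro sum.cong) simp_all
    also have "\<dots> \<le> (L2_norm M (\<lambda>x. f x - q x))\<^sup>2"
      using A by (intro bessel L2_diff f_si q_si) auto
    also have "\<dots> \<le> \<eta>\<^sup>2"
      using q(2) by (intro power_mono) auto
    finally show "(L2_norm M (\<lambda>x. q x - p x))\<^sup>2 \<le> \<eta>\<^sup>2" .
  qed (use \<eta> in simp)
  then have fp: "L2_norm M (\<lambda>x. f x - p x) \<le> 2 * \<eta>"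
    using L2_norm_triangle3[OF f_si q_si p_si] q(2) by linarith
  have p_le: "L2_norm M p \<le> L2_norm M f + 2 * \<eta>"
    using L2_norm_triangle[OF f_si L2_diff[OF p_si f_si]] fp
      L2_norm_minus_commute[of M f p] by simp
  \<comment> \<open>A competitor for the projection: with it, \<open>b * p - g\<close> is an
    orthogonal sum of the \<open>k i\<close>.\<close>
  define g where "g x = (\<Sum>i\<in>A - F. c i * h i x)" for x
  have g: "g \<in> closed_span"
    unfolding g_def[abs_def] by (intro closed_span_sum closed_span_cmult h)
  have "L2_norm M (\<lambda>x. \<Sum>i\<in>A - F. c i * k i x) \<le> \<epsilon> * L2_norm M p"
  proof (rule power2_le_imp_le)
    have "(L2_norm M (\<lambda>x. \<Sum>i\<in>A - F. c i * k i x))\<^sup>2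
        = (\<Sum>i\<in>A - F. (norm (c i))\<^sup>2 * (L2_norm M (k i))\<^sup>2)"
      using A k_orthogonal
      by (intro L2_norm_square_sum_orthogonal k_L2) (auto simp: k_def[abs_def])
    also have "\<dots> \<le> (\<Sum>i\<in>A - F. (norm (c i))\<^sup>2 * \<epsilon>\<^sup>2)"
      by (intro sum_mono mult_left_mono power_mono small) auto
    also have "\<dots> = (\<epsilon> * L2_norm M p)\<^sup>2"
      unfolding p_def[abs_def] using norm_sum_e[of "A - F" c] A
      by (simp add: power_mult_distrib sum_distrib_left mult.commute)
    finally show "(L2_norm M (\<lambda>x. \<Sum>i\<in>A - F. c i * k i x))\<^sup>2 \<le> (\<epsilon> * L2_norm M p)\<^sup>2" .
  qed (use \<epsilon> in simp)
  also have "(\<lambda>x. \<Sum>i\<in>A - F. c i * k i x) = (\<lambda>x. b x * p x - g x)"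
    by (simp add: p_def g_def k_def sum_distrib_left sum_subtractf algebra_simps)
  finally have bp: "L2_norm M (\<lambda>x. b x * p x - g x) \<le> \<epsilon> * L2_norm M p" .
  have "L2_norm M (hankel_op f) \<le> L2_norm M (\<lambda>x. b x * f x - g x)"
    by (rule hankel_op_le[OF f_si g])
  also have "\<dots> \<le> L2_norm M (\<lambda>x. b x * f x - b x * p x) + L2_norm M (\<lambda>x. b x * p x - g x)"
    by (intro L2_norm_triangle3 mult_b f_si p_si closed_span_L2[OF g])
  also have "L2_norm M (\<lambda>x. b x * f x - b x * p x) \<le> L2_norm M (\<lambda>x. f x - p x)"
    using mult_b(2)[OF L2_diff[OF f_si p_si]] by (simp add: right_diff_distrib)
  also note fp
  also note bp
  also have "\<epsilon> * L2_norm M p \<le> \<epsilon> * (L2_norm M f + 2 * \<eta>)"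
    by (intro mult_left_mono p_le \<epsilon>)
  also have "2 * \<eta> + \<epsilon> * (L2_norm M f + 2 * \<eta>) = \<epsilon> * L2_norm M f + \<delta>"
    unfolding \<eta>(2)[symmetric] by (simp add: algebra_simps)
  finally show "L2_norm M (hankel_op f) \<le> \<epsilon> * L2_norm M f + \<delta>" by simp
qed

text \<open>Along a subsequence all Fourier coefficients converge. The difference of two members
  then splits into a part with finitely many small coefficients and a part without coefficients in
  \<open>F\<close>, to which \<open>hankel_op_tail\<close> applies.\<close>

lemma hankel_op_compact:
  fixes f :: "nat \<Rightarrow> 'a \<Rightarrow> complex"
  assumes f: "\<And>n. f n \<in> closed_span" and B: "\<And>n. L2_norm M (f n) \<le> B"
  obtains r where "strict_mono (r :: nat \<Rightarrow> nat)"
    "\<forall>\<epsilon>>0. \<exists>N. \<forall>m\<ge>N. \<forall>n\<ge>N.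
      L2_norm M (\<lambda>x. hankel_op (f (r m)) x - hankel_op (f (r n)) x) < \<epsilon>"
proof -
  note si = closed_span_L2[OF f]
  have "norm (L2_inner M (f n) (e i)) \<le> B" for n i
    using L2_inner_le[OF si e, of n i] B[of n] by (simp add: norm_e)
  then obtain r l where r: "strict_mono r" "\<forall>i. (\<lambda>n. L2_inner M (f (r n)) (e i)) \<longlonglongrightarrow> l i"
    using convergent_subsequence_pointwise[of "\<lambda>n i. L2_inner M (f n) (e i)" B] by blast
  have B0: "0 \<le> B" using B[of 0] L2_norm_nonneg[of M "f 0"] by linarith
  show thesis
  proof (rule that[OF r(1)], intro allI impI)
    fix \<epsilon> :: real assume \<epsilon>: "0 < \<epsilon>"
    \<comment> \<open>The tail \<open>g - s\<close> has norm at most \<open>4 * B\<close>, so this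
      choice makes it contribute at most \<open>\<epsilon> / 2\<close>; \<open>B + 1\<close>
      prevents division by zero.\<close>
    define \<eta> where "\<eta> = \<epsilon> / (8 * (B + 1))"
    have \<eta>: "0 < \<eta>" using \<epsilon> B0 by (simp add: \<eta>_def)
    have \<eta>B: "\<eta> * (4 * B) \<le> \<epsilon> / 2"
    proof -
      have "\<eta> * (4 * B) \<le> \<eta> * (4 * (B + 1))" using \<eta> by (intro mult_left_mono) auto
      also have "\<dots> = \<epsilon> / 2" using B0 by (simp add: \<eta>_def field_simps)
      finally show ?thesis .
    qed
    define F where "F = {i. \<eta> \<le> L2_norm M (k i)}"
    have F: "finite F" unfolding F_def k_def[abs_def] by (rule k_small[OF \<eta>])
    have "(\<lambda>n. \<Sum>i\<in>F. norm (L2_inner M (f (r n)) (e i) - l i)) \<longlonglongrightarrow> (\<Sum>i\<in>F. norm (l i - l i))"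
      by (intro tendsto_intros r(2)[rule_format])
    then have "\<forall>\<^sub>F n in sequentially. (\<Sum>i\<in>F. norm (L2_inner M (f (r n)) (e i) - l i)) < \<epsilon> / 4"
      using \<epsilon> by (intro order_tendstoD(2)[of _ 0]) simp_all
    then obtain N where N: "\<And>n. N \<le> n \<Longrightarrow> (\<Sum>i\<in>F. norm (L2_inner M (f (r n)) (e i) - l i)) < \<epsilon> / 4"
      by (auto simp: eventually_sequentially)
    have "L2_norm M (\<lambda>x. hankel_op (f (r m)) x - hankel_op (f (r n)) x) < \<epsilon>"
      if mn: "N \<le> m" "N \<le> n" for m n
    proof -
      define g where "g x = f (r m) x - f (r n) x" for x
      have g: "g \<in> closed_span" unfolding g_def[abs_def] by (intro closed_span_diff f)
      note g_si = closed_span_L2[OF g]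
      have g_le: "L2_norm M g \<le> 2 * B"
        using L2_norm_triangle[OF si L2_cmult[OF si, of "-1"], of "r m" "r n"]
          L2_norm_cmult[of M "-1" "f (r n)"] B[of "r m"] B[of "r n"] by (simp add: g_def[abs_def])
      define s where "s x = (\<Sum>i\<in>F. L2_inner M g (e i) * e i x)" for x
      have s: "s \<in> closed_span" unfolding s_def[abs_def] by (rule sum_e_closed_span[OF F])
      note s_si = closed_span_L2[OF s]
      have coeff: "L2_inner M (\<lambda>x. g x - s x) (e i) = 0" if "i \<in> F" for i
      proof -
        have "L2_inner M s (e i) = L2_inner M g (e i)"
          unfolding s_def[abs_def] inner_sum_e[OF F] using that by simp
        then show ?thesis unfolding L2_inner_diff_left[OF g_si s_si e] by simp
      qed
      have s_le: "L2_norm M s \<le> L2_norm M g"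
      proof (rule power2_le_imp_le)
        show "(L2_norm M s)\<^sup>2 \<le> (L2_norm M g)\<^sup>2"
          unfolding s_def[abs_def] norm_sum_e[OF F] by (rule bessel[OF g_si F])
      qed simp
      have gs: "L2_norm M (\<lambda>x. g x - s x) \<le> 4 * B"
        using L2_norm_triangle[OF g_si L2_cmult[OF s_si, of "-1"]]
          L2_norm_cmult[of M "-1" s] s_le g_le by simp
      have "L2_norm M (hankel_op (\<lambda>x. g x - s x)) \<le> \<eta> * L2_norm M (\<lambda>x. g x - s x)"
        by (rule hankel_op_tail[OF F _ _ closed_span_diff[OF g s] coeff]) (use \<eta> in \<open>auto simp: F_def\<close>)
      also have "\<dots> \<le> \<epsilon> / 2"
        using mult_left_mono[OF gs, of \<eta>] \<eta> \<eta>B by linarith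
      finally have 1: "L2_norm M (hankel_op (\<lambda>x. g x - s x)) \<le> \<epsilon> / 2" .
      have "L2_norm M s \<le> (\<Sum>i\<in>F. L2_norm M (\<lambda>x. L2_inner M g (e i) * e i x))"
        unfolding s_def[abs_def] by (intro L2_norm_sum_le L2_cmult e)
      also have "\<dots> = (\<Sum>i\<in>F. norm (L2_inner M g (e i)))"
        by (simp add: L2_norm_cmult norm_e)
      also have "\<dots> \<le> (\<Sum>i\<in>F. norm (L2_inner M (f (r m)) (e i) - l i)
          + norm (L2_inner M (f (r n)) (e i) - l i))"
      proof (rule sum_mono)
        fix i
        have "L2_inner M g (e i) = (L2_inner M (f (r m)) (e i) - l i) - (L2_inner M (f (r n)) (e i) - l i)"
          by (simp add: g_def[abs_def] L2_inner_diff_left[OF si si e])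
        then show "norm (L2_inner M g (e i)) \<le> norm (L2_inner M (f (r m)) (e i) - l i)
            + norm (L2_inner M (f (r n)) (e i) - l i)"
          by (simp only: norm_triangle_ineq4)
      qed
      also have "\<dots> < \<epsilon> / 2"
        using N[OF mn(1)] N[OF mn(2)] by (simp add: sum.distrib)
      finally have 2: "L2_norm M (hankel_op s) < \<epsilon> / 2"
        using hankel_op_contraction[OF s_si] by linarith
      have "L2_norm M (\<lambda>x. hankel_op (f (r m)) x - hankel_op (f (r n)) x) \<le> L2_norm M (hankel_op g)"
        unfolding g_def[abs_def] by (rule hankel_op_diff_le[OF si si])
      also have "\<dots> \<le> L2_norm M (hankel_op (\<lambda>x. g x - s x)) + L2_norm M (hankel_op s)"
        using hankel_op_triangle[OF L2_diff[OF g_si s_si] s_si] by simp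
      finally show ?thesis using 1 2 by linarith
    qed
    then show "\<exists>N. \<forall>m\<ge>N. \<forall>n\<ge>N. L2_norm M (\<lambda>x. hankel_op (f (r m)) x - hankel_op (f (r n)) x) < \<epsilon>"
      by blast
  qed
qed

text \<open>Up to null sets \<open>C g\<close> is the projection of \<open>w * hankel_op g\<close>,
  which is used in weak form: both have the same inner products with \<open>closed_span\<close>.
  Differences of values of \<open>C\<close> are therefore no longer than those of
  \<open>hankel_op\<close>, and Cauchy subsequences carry over.\<close>

lemma commutator_compact:
  fixes w :: "'a \<Rightarrow> complex" and f :: "nat \<Rightarrow> 'a \<Rightarrow> complex"
  assumes w: "w \<in> borel_measurable M" "\<And>x. x \<in> space M \<Longrightarrow> norm (w x) \<le> 1"
    and w_in: "\<And>g. g \<in> closed_span \<Longrightarrow> (\<lambda>x. w x * g x) \<in> closed_span"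
    and f: "\<And>n. f n \<in> closed_span" and B: "\<And>n. L2_norm M (f n) \<le> B"
  defines "C \<equiv> \<lambda>g x. proj (\<lambda>x. b x * (w x * g x)) x - w x * proj (\<lambda>x. b x * g x) x"
  obtains r y where "strict_mono (r :: nat \<Rightarrow> nat)" "y \<in> closed_span"
    "(\<lambda>n. L2_norm M (\<lambda>x. C (f (r n)) x - y x)) \<longlonglongrightarrow> 0"
proof -
  note si = closed_span_L2
  have wsi: "(\<lambda>x. w x * g x) \<in> square_integrable M" if "g \<in> square_integrable M" for g
    using L2_bounded_mult[OF that w] .
  have C: "C g \<in> closed_span" if g: "g \<in> closed_span" for g
    unfolding C_def by (intro closed_span_diff proj w_in mult_b si[OF g] wsi)
  have C_inner: "L2_inner M (C g) q = L2_inner M (\<lambda>x. w x * hankel_op g x) q"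
    if g: "g \<in> closed_span" and q: "q \<in> closed_span" for g q
  proof -
    note bw = mult_b(1)[OF wsi[OF si[OF g]]] and pb = wsi[OF proj_L2[OF mult_b(1)[OF si[OF g]]]]
    have "L2_inner M (C g) q = L2_inner M (proj (\<lambda>x. b x * (w x * g x))) q - L2_inner M (\<lambda>x. w x * proj (\<lambda>x. b x * g x) x) q"
      unfolding C_def by (intro L2_inner_diff_left proj_L2 bw pb si[OF q])
    also have "L2_inner M (proj (\<lambda>x. b x * (w x * g x))) q = L2_inner M (\<lambda>x. b x * (w x * g x)) q"
      using inner_proj_right[OF bw q] by (metis L2_inner_cnj)
    also have "\<dots> - L2_inner M (\<lambda>x. w x * proj (\<lambda>x. b x * g x) x) q
        = L2_inner M (\<lambda>x. b x * (w x * g x) - w x * proj (\<lambda>x. b x * g x) x) q"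
      by (rule L2_inner_diff_left[OF bw pb si[OF q], symmetric])
    finally show ?thesis by (simp add: hankel_op_def algebra_simps)
  qed
  have C_diff: "L2_norm M (\<lambda>x. C g x - C g' x) \<le> L2_norm M (\<lambda>x. hankel_op g x - hankel_op g' x)"
    if g: "g \<in> closed_span" "g' \<in> closed_span" for g g'
  proof -
    \<comment> \<open>As \<open>D\<close> lies in \<open>closed_span\<close>, it can be tested
      against itself, which gives
      \<open>(L2_norm M D)\<^sup>2 \<le> L2_norm M R * L2_norm M D\<close>.\<close>
    define D where "D x = C g x - C g' x" for x
    define R where "R x = hankel_op g x - hankel_op g' x" for x
    have D: "D \<in> closed_span" unfolding D_def[abs_def] by (intro closed_span_diff C g)
    note hs = hankel_op_L2[OF si[OF g(1)]] hankel_op_L2[OF si[OF g(2)]]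
    have R: "R \<in> square_integrable M" unfolding R_def[abs_def] by (intro L2_diff hs)
    have "L2_inner M D D = L2_inner M (C g) D - L2_inner M (C g') D"
      using L2_inner_diff_left[OF si[OF C[OF g(1)]] si[OF C[OF g(2)]] si[OF D]]
      by (simp only: D_def[abs_def, symmetric])
    also have "\<dots> = L2_inner M (\<lambda>x. w x * hankel_op g x - w x * hankel_op g' x) D"
      unfolding C_inner[OF g(1) D] C_inner[OF g(2) D]
      by (rule L2_inner_diff_left[OF wsi[OF hs(1)] wsi[OF hs(2)] si[OF D], symmetric])
    also have "\<dots> = L2_inner M (\<lambda>x. w x * R x) D"
      by (simp only: R_def right_diff_distrib)
    finally have "L2_inner M D D = L2_inner M (\<lambda>x. w x * R x) D" .
    moreover have "norm (L2_inner M D D) = (L2_norm M D)\<^sup>2"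
      unfolding L2_inner_self by (simp add: norm_power)
    ultimately have "(L2_norm M D)\<^sup>2 = norm (L2_inner M (\<lambda>x. w x * R x) D)" by simp
    also have "\<dots> \<le> L2_norm M (\<lambda>x. w x * R x) * L2_norm M D"
      by (intro L2_inner_le wsi R si[OF D])
    also have "\<dots> \<le> L2_norm M R * L2_norm M D"
      using L2_norm_bounded_mult[OF R w] by (intro mult_right_mono) auto
    finally have "L2_norm M D * L2_norm M D \<le> L2_norm M R * L2_norm M D"
      by (simp only: power2_eq_square)
    then have "L2_norm M D \<le> L2_norm M R"
      using L2_norm_nonneg[of M D] L2_norm_nonneg[of M R]
      by (cases "L2_norm M D = 0") (auto simp: mult_le_cancel_right)
    then show ?thesis by (simp only: D_def[abs_def] R_def[abs_def])
  qed
  obtain r where r: "strict_mono (r :: nat \<Rightarrow> nat)" "\<forall>\<epsilon>>0. \<exists>N. \<forall>m\<ge>N. \<forall>n\<ge>N.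
      L2_norm M (\<lambda>x. hankel_op (f (r m)) x - hankel_op (f (r n)) x) < \<epsilon>"
    by (rule hankel_op_compact[of f B, OF f B])
  have "\<exists>N. \<forall>m\<ge>N. \<forall>n\<ge>N. L2_norm M (\<lambda>x. C (f (r m)) x - C (f (r n)) x) < \<epsilon>" if "0 < \<epsilon>" for \<epsilon>
  proof -
    from r(2)[rule_format, OF that]
    obtain N where "\<forall>m\<ge>N. \<forall>n\<ge>N. L2_norm M (\<lambda>x. hankel_op (f (r m)) x - hankel_op (f (r n)) x) < \<epsilon>" ..
    then show ?thesis
      using le_less_trans[OF C_diff[OF f f]] by (intro exI[of _ N]) simp
  qed
  with C[OF f] obtain y where "y \<in> closed_span" "(\<lambda>n. L2_norm M (\<lambda>x. C (f (r n)) x - y x)) \<longlonglongrightarrow> 0"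
    by (rule closed_span_complete[of "\<lambda>n. C (f (r n))"]) blast
  with r(1) show thesis by (rule that)
qed

end

section \<open>Multiplication operators on classes of functions\<close>

lemma representative_ae_class:
  assumes f: "f \<in> square_integrable M"
  shows "representative (ae_class M f) \<in> square_integrable M"
    and "AE x in M. representative (ae_class M f) x = f x"
proof -
  have "f \<in> ae_class M f" using f by (simp add: ae_class_def)
  then have "representative (ae_class M f) \<in> ae_class M f"
    unfolding representative_def by (rule someI[where P = "\<lambda>g. g \<in> ae_class M f"])
  then show "representative (ae_class M f) \<in> square_integrable M"
    "AE x in M. representative (ae_class M f) x = f x"
    by (simp_all add: ae_class_def)
qed

lemma ae_class_eqI:
  assumes "AE x in M. f x = g x" shows "ae_class M f = ae_class M g"
proof -
  have "(AE x in M. h x = f x) \<longleftrightarrow> (AE x in M. h x = g x)" for h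
    using assms by (intro iffI; elim AE_mp) (auto elim: AE_mp)
  then show ?thesis by (simp add: ae_class_def)
qed

lemma L2_space_hadd:
  assumes "f \<in> square_integrable M" "g \<in> square_integrable M"
  shows "hadd (L2_space M) (ae_class M f) (ae_class M g) = ae_class M (\<lambda>x. f x + g x)"
  unfolding L2_space_def
  using representative_ae_class(2)[OF assms(1)] representative_ae_class(2)[OF assms(2)]
  by (simp, intro ae_class_eqI) (elim AE_mp, auto)

lemma L2_space_hscale:
  assumes "f \<in> square_integrable M"
  shows "hscale (L2_space M) c (ae_class M f) = ae_class M (\<lambda>x. c * f x)"
  unfolding L2_space_def using representative_ae_class(2)[OF assms]
  by (simp, intro ae_class_eqI) (elim AE_mp, auto)

lemma L2_space_hdiff:
  assumes "f \<in> square_integrable M" "g \<in> square_integrable M"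
  shows "hdiff (L2_space M) (ae_class M f) (ae_class M g) = ae_class M (\<lambda>x. f x - g x)"
  using L2_space_hadd[OF assms(1) L2_cmult[OF assms(2), of "-1"]]
  by (simp add: hdiff_def L2_space_hscale assms)

lemma L2_space_hinner:
  assumes "f \<in> square_integrable M" "g \<in> square_integrable M"
  shows "hinner (L2_space M) (ae_class M f) (ae_class M g) = L2_inner M f g"
proof -
  have "hinner (L2_space M) (ae_class M f) (ae_class M g)
      = L2_inner M (representative (ae_class M f)) (representative (ae_class M g))"
    by (simp add: L2_space_def L2_inner_def)
  also have "\<dots> = L2_inner M f g"
    by (intro L2_inner_cong_AE L2_measurable representative_ae_class assms)
  finally show ?thesis .
qed

lemma L2_space_hnorm:
  assumes "f \<in> square_integrable M"
  shows "hnorm (L2_space M) (ae_class M f) = L2_norm M f"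
  by (simp add: hnorm_def L2_space_hinner assms L2_inner_self)

lemma hnorm_carrier_update: "hnorm (H\<lparr>hcarrier := C\<rparr>) = hnorm H"
  by (simp add: fun_eq_iff hnorm_def)

lemma hdiff_carrier_update: "hdiff (H\<lparr>hcarrier := C\<rparr>) = hdiff H"
  by (simp add: fun_eq_iff hdiff_def)

context orthonormal_family
begin

lemma proj_add_AE:
  assumes f: "f \<in> square_integrable M" and g: "g \<in> square_integrable M"
  shows "AE x in M. proj (\<lambda>x. f x + g x) x = proj f x + proj g x"
proof (rule proj_unique_AE)
  fix q assume q: "q \<in> closed_span"
  have "L2_inner M (\<lambda>x. (f x - proj f x) + (g x - proj g x)) q = 0"
    using proj(2)[OF f q] proj(2)[OF g q]
    by (subst L2_inner_add_left)
      (auto intro: L2_diff proj_L2 f g closed_span_L2[OF q])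
  then show "L2_inner M (\<lambda>x. f x + g x - (proj f x + proj g x)) q = 0"
    by (simp add: algebra_simps)
qed (intro L2_add closed_span_add proj(1) f g)+

lemma proj_cmult_AE:
  assumes f: "f \<in> square_integrable M"
  shows "AE x in M. proj (\<lambda>x. c * f x) x = c * proj f x"
proof (rule proj_unique_AE)
  fix q assume q: "q \<in> closed_span"
  show "L2_inner M (\<lambda>x. c * f x - c * proj f x) q = 0"
    using proj(2)[OF f q] by (simp add: right_diff_distrib[symmetric] L2_inner_cmult_left)
qed (intro L2_cmult closed_span_cmult proj(1) f)+

end

text \<open>
  Writing \<open>H\<^sub>i f = cnj (z i) * f - proj (cnj (z i) * f)\<close>, the commutator of \<open>T\<^sub>i\<^sup>*\<close> and \<open>T\<^sub>j\<close> is
  \<open>f \<mapsto> proj (z j * H\<^sub>i f)\<close>, so that compactness of the operators \<open>H\<^sub>i\<close> is enough.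
\<close>

locale coordinate_multipliers = orthonormal_family M e
  for M :: "'a measure" and e :: "'k::countable \<Rightarrow> 'a \<Rightarrow> complex" +
  fixes z :: "'i::finite \<Rightarrow> 'a \<Rightarrow> complex" and h :: "'i \<Rightarrow> 'k \<Rightarrow> 'a \<Rightarrow> complex"
  assumes z_measurable: "z i \<in> borel_measurable M"
    and z_le_1: "x \<in> space M \<Longrightarrow> norm (z i x) \<le> 1"
    and z_closed_span: "f \<in> closed_span \<Longrightarrow> (\<lambda>x. z i x * f x) \<in> closed_span"
    and hankel: "hankel M e (\<lambda>x. cnj (z i x)) (h i)"
begin

definition space_H :: "('a \<Rightarrow> complex) set inner_space" where
  "space_H = (L2_space M)\<lparr>hcarrier := ae_class M ` closed_span\<rparr>"

definition mult :: "'i \<Rightarrow> ('a \<Rightarrow> complex) set \<Rightarrow> ('a \<Rightarrow> complex) set" where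
  "mult i F = ae_class M (\<lambda>x. z i x * representative F x)"

lemma carrier_space_H: "hcarrier space_H = ae_class M ` closed_span"
  by (simp add: space_H_def)

lemma hadd_class:
  assumes "f \<in> square_integrable M" "g \<in> square_integrable M"
  shows "hadd space_H (ae_class M f) (ae_class M g) = ae_class M (\<lambda>x. f x + g x)"
  using L2_space_hadd[OF assms] by (simp add: space_H_def)

lemma hdiff_class:
  assumes "f \<in> square_integrable M" "g \<in> square_integrable M"
  shows "hdiff space_H (ae_class M f) (ae_class M g) = ae_class M (\<lambda>x. f x - g x)"
  using L2_space_hdiff[OF assms] by (simp add: space_H_def hdiff_carrier_update)

lemma hinner_class:
  assumes "f \<in> square_integrable M" "g \<in> square_integrable M"
  shows "hinner space_H (ae_class M f) (ae_class M g) = L2_inner M f g"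
  using L2_space_hinner[OF assms] by (simp add: space_H_def)

context
  fixes f :: "'a \<Rightarrow> complex"
  assumes f: "f \<in> square_integrable M"
begin

lemma hscale_class: "hscale space_H c (ae_class M f) = ae_class M (\<lambda>x. c * f x)"
  using L2_space_hscale[OF f] by (simp add: space_H_def)

lemma hnorm_class: "hnorm space_H (ae_class M f) = L2_norm M f"
  using L2_space_hnorm[OF f] by (simp add: space_H_def hnorm_carrier_update)

lemma mult_class: "mult i (ae_class M f) = ae_class M (\<lambda>x. z i x * f x)"
  unfolding mult_def using representative_ae_class(2)[OF f]
  by (intro ae_class_eqI) (elim AE_mp, auto)

lemma z_L2: "(\<lambda>x. z i x * f x) \<in> square_integrable M"
  by (rule L2_bounded_mult[OF f z_measurable z_le_1])

lemma cnj_z_L2: "(\<lambda>x. cnj (z i x) * f x) \<in> square_integrable M"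
  by (rule hankel.mult_b(1)[OF hankel f])

end

text \<open>Linearity on classes asks for additivity and homogeneity of \<open>t\<close> almost
  everywhere, which is what chosen projections satisfy.\<close>

lemma linear_op_class:
  assumes T: "\<And>f. f \<in> closed_span \<Longrightarrow> T (ae_class M f) = ae_class M (t f)"
    and t: "\<And>f. f \<in> closed_span \<Longrightarrow> t f \<in> closed_span"
    and t_add: "\<And>f g. f \<in> closed_span \<Longrightarrow> g \<in> closed_span \<Longrightarrow>
      AE x in M. t (\<lambda>x. f x + g x) x = t f x + t g x"
    and t_scale: "\<And>c f. f \<in> closed_span \<Longrightarrow> AE x in M. t (\<lambda>x. c * f x) x = c * t f x"
  shows "linear_op space_H T"
proof -
  note si = closed_span_L2
  have "T (hadd space_H (ae_class M f) (ae_class M g)) = hadd space_H (T (ae_class M f)) (T (ae_class M g))"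
    if f: "f \<in> closed_span" and g: "g \<in> closed_span" for f g
    using ae_class_eqI[OF t_add[OF f g]]
    by (simp add: hadd_class[OF si[OF f] si[OF g]] T f g closed_span_add
        hadd_class[OF si[OF t[OF f]] si[OF t[OF g]]])
  moreover have "T (hscale space_H c (ae_class M f)) = hscale space_H c (T (ae_class M f))"
    if f: "f \<in> closed_span" for c f
    using ae_class_eqI[OF t_scale[OF f]]
    by (simp add: hscale_class[OF si[OF f]] T f closed_span_cmult
        hscale_class[OF si[OF t[OF f]]])
  ultimately show ?thesis
    unfolding linear_op_def carrier_space_H using T t by auto
qed

lemma bounded_mult: "bounded_op space_H (mult i)"
proof -
  note si = closed_span_L2
  have "linear_op space_H (mult i)"
    by (rule linear_op_class[where t = "\<lambda>f x. z i x * f x"])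
      (auto simp: mult_class[OF si] z_closed_span distrib_left mult.left_commute)
  moreover have "hnorm space_H (mult i F) \<le> 1 * hnorm space_H F" if F: "F \<in> hcarrier space_H" for F
  proof -
    obtain f where f: "f \<in> closed_span" "F = ae_class M f"
      using F unfolding carrier_space_H by blast
    note f_si = si[OF f(1)]
    show ?thesis
      unfolding f(2) mult_class[OF f_si] hnorm_class[OF f_si]
        hnorm_class[OF z_L2[OF f_si]]
      by (intro L2_norm_bounded_mult f_si z_measurable z_le_1) simp_all
  qed
  ultimately show ?thesis unfolding bounded_op_def by blast
qed

text \<open>The Toeplitz operator with symbol \<open>cnj (z i)\<close>, on functions.\<close>

definition coadjoint :: "'i \<Rightarrow> ('a \<Rightarrow> complex) \<Rightarrow> 'a \<Rightarrow> complex" where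
  "coadjoint i g = proj (\<lambda>x. cnj (z i x) * g x)"

lemma coadjoint_closed_span: "g \<in> square_integrable M \<Longrightarrow> coadjoint i g \<in> closed_span"
  unfolding coadjoint_def by (intro proj(1) cnj_z_L2)

lemma coadjoint_inner:
  assumes f: "f \<in> closed_span" and g: "g \<in> square_integrable M"
  shows "L2_inner M (\<lambda>x. z i x * f x) g = L2_inner M f (coadjoint i g)"
proof -
  have "L2_inner M (\<lambda>x. z i x * f x) g = L2_inner M f (\<lambda>x. cnj (z i x) * g x)"
    by (simp add: L2_inner_def mult_ac)
  also have "\<dots> = L2_inner M f (coadjoint i g)"
    unfolding coadjoint_def by (rule inner_proj_right[OF cnj_z_L2[OF g] f, symmetric])
  finally show ?thesis .
qed

text \<open>\<open>THE\<close> asks for uniqueness besides the adjoint identity: the difference of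
  two candidates is orthogonal to the whole space and belongs to it.\<close>

lemma adjoint_mult:
  assumes g: "g \<in> closed_span"
  shows "adjoint_op space_H (mult i) (ae_class M g) = ae_class M (coadjoint i g)"
  unfolding adjoint_op_def
proof (rule the_equality)
  note si = closed_span_L2
  note g_si = si[OF g] and c = coadjoint_closed_span[OF si[OF g], of i]
  have inner: "hinner space_H (mult i (ae_class M f)) (ae_class M g) = L2_inner M f (coadjoint i g)"
    if f: "f \<in> closed_span" for f
    unfolding mult_class[OF si[OF f]] hinner_class[OF z_L2[OF si[OF f]] g_si]
    by (rule coadjoint_inner[OF f g_si])
  have "hinner space_H (ae_class M f) (ae_class M (coadjoint i g)) = L2_inner M f (coadjoint i g)"
    if f: "f \<in> closed_span" for f
    by (rule hinner_class[OF si[OF f] si[OF c]])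
  then show "ae_class M (coadjoint i g) \<in> hcarrier space_H \<and> (\<forall>F\<in>hcarrier space_H.
      hinner space_H (mult i F) (ae_class M g) = hinner space_H F (ae_class M (coadjoint i g)))"
    unfolding carrier_space_H using c inner by simp
  fix W assume W: "W \<in> hcarrier space_H \<and> (\<forall>F\<in>hcarrier space_H.
      hinner space_H (mult i F) (ae_class M g) = hinner space_H F W)"
  then obtain w where w: "w \<in> closed_span" "W = ae_class M w"
    unfolding carrier_space_H by blast
  define d where "d x = w x - coadjoint i g x" for x
  have d: "d \<in> closed_span" unfolding d_def[abs_def] by (intro closed_span_diff w c)
  have "L2_inner M d (coadjoint i g) = L2_inner M d w"
  proof -
    have "hinner space_H (mult i (ae_class M d)) (ae_class M g) = hinner space_H (ae_class M d) W"
      using W d unfolding carrier_space_H by blast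
    then show ?thesis
      unfolding inner[OF d] w(2) hinner_class[OF si[OF d] si[OF w(1)]] .
  qed
  then have "L2_inner M d d = 0"
    using L2_inner_diff_right[OF si[OF w(1)] si[OF c] si[OF d]]
    by (simp add: d_def[abs_def, symmetric])
  then have "L2_norm M d = 0" by (simp add: L2_inner_self)
  then have "AE x in M. d x = 0" by (simp add: L2_norm_eq_0_iff[OF si[OF d]])
  then have "AE x in M. w x = coadjoint i g x" by (rule AE_mp) (simp add: d_def)
  then show "W = ae_class M (coadjoint i g)" unfolding w(2) by (rule ae_class_eqI)
qed

lemma coadjoint_add_AE:
  assumes "f \<in> square_integrable M" "g \<in> square_integrable M"
  shows "AE x in M. coadjoint i (\<lambda>x. f x + g x) x = coadjoint i f x + coadjoint i g x"
  using proj_add_AE[OF cnj_z_L2[OF assms(1)] cnj_z_L2[OF assms(2)], of i i]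
  by (simp add: coadjoint_def distrib_left)

lemma coadjoint_cmult_AE:
  assumes "f \<in> square_integrable M"
  shows "AE x in M. coadjoint i (\<lambda>x. c * f x) x = c * coadjoint i f x"
  using proj_cmult_AE[OF cnj_z_L2[OF assms], of c i]
  by (simp add: coadjoint_def mult.left_commute)

definition commutator :: "'i \<Rightarrow> 'i \<Rightarrow> ('a \<Rightarrow> complex) \<Rightarrow> 'a \<Rightarrow> complex" where
  "commutator i j f x = coadjoint i (\<lambda>x. z j x * f x) x - z j x * coadjoint i f x"

lemma commutator_closed_span:
  assumes f: "f \<in> closed_span" shows "commutator i j f \<in> closed_span"
  unfolding commutator_def[abs_def]
  by (intro closed_span_diff coadjoint_closed_span z_closed_span z_L2
      closed_span_L2[OF f])

lemma commutator_class:
  assumes f: "f \<in> closed_span"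
  shows "hdiff space_H (adjoint_op space_H (mult i) (mult j (ae_class M f)))
      (mult j (adjoint_op space_H (mult i) (ae_class M f))) = ae_class M (commutator i j f)"
proof -
  note f_si = closed_span_L2[OF f]
  note c = coadjoint_closed_span[OF f_si, of i] and zf = z_closed_span[OF f, of j]
  note c_si = closed_span_L2[OF c]
  show ?thesis
    unfolding mult_class[OF f_si] adjoint_mult[OF f] adjoint_mult[OF zf] mult_class[OF c_si]
      commutator_def[abs_def]
    by (intro hdiff_class closed_span_L2[OF coadjoint_closed_span]
        closed_span_L2[OF zf] z_L2[OF c_si])
qed

lemma compact_commutator:
  "compact_op space_H (\<lambda>F. hdiff space_H (adjoint_op space_H (mult i) (mult j F))
      (mult j (adjoint_op space_H (mult i) F)))" (is "compact_op _ ?T")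
proof -
  note si = closed_span_L2
  have "linear_op space_H ?T"
  proof (rule linear_op_class[where t = "commutator i j"])
    fix f g assume f: "f \<in> closed_span" and g: "g \<in> closed_span"
    note z_si = z_L2[OF si[OF f], of j] z_L2[OF si[OF g], of j]
    have "AE x in M. coadjoint i (\<lambda>x. z j x * f x + z j x * g x) x
        = coadjoint i (\<lambda>x. z j x * f x) x + coadjoint i (\<lambda>x. z j x * g x) x"
      by (rule coadjoint_add_AE[OF z_si])
    moreover have "AE x in M. coadjoint i (\<lambda>x. f x + g x) x = coadjoint i f x + coadjoint i g x"
      by (rule coadjoint_add_AE[OF si[OF f] si[OF g]])
    ultimately show "AE x in M. commutator i j (\<lambda>x. f x + g x) x = commutator i j f x + commutator i j g x"
      by eventually_elim (simp add: commutator_def algebra_simps)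
  next
    fix c f assume f: "f \<in> closed_span"
    have "AE x in M. coadjoint i (\<lambda>x. c * (z j x * f x)) x = c * coadjoint i (\<lambda>x. z j x * f x) x"
      by (rule coadjoint_cmult_AE[OF z_L2[OF si[OF f]]])
    moreover have "AE x in M. coadjoint i (\<lambda>x. c * f x) x = c * coadjoint i f x"
      by (rule coadjoint_cmult_AE[OF si[OF f]])
    ultimately show "AE x in M. commutator i j (\<lambda>x. c * f x) x = c * commutator i j f x"
      by eventually_elim (simp add: commutator_def algebra_simps)
  qed (simp_all add: commutator_class commutator_closed_span)
  moreover have "\<exists>r y. strict_mono r \<and> y \<in> hcarrier space_H \<and>
      (\<lambda>n. hnorm space_H (hdiff space_H (?T (F (r n))) y)) \<longlonglongrightarrow> 0"
    if F: "\<forall>n. F n \<in> hcarrier space_H" and B: "\<forall>n. hnorm space_H (F n) \<le> B" for F :: "nat \<Rightarrow> _" and B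
  proof -
    have "\<forall>n. \<exists>f. f \<in> closed_span \<and> F n = ae_class M f"
      using F unfolding carrier_space_H by blast
    then obtain f where "\<forall>n. f n \<in> closed_span \<and> F n = ae_class M (f n)"
      by (rule choice[THEN exE])
    then have f: "f n \<in> closed_span" "F n = ae_class M (f n)" for n by simp_all
    have f_B: "L2_norm M (f n) \<le> B" for n
      using B[rule_format, of n] unfolding f(2) hnorm_class[OF si[OF f(1)]] .
    obtain r y where r: "strict_mono (r :: nat \<Rightarrow> nat)" "y \<in> closed_span"
      "(\<lambda>n. L2_norm M (\<lambda>x. proj (\<lambda>x. cnj (z i x) * (z j x * f (r n) x)) x
          - z j x * proj (\<lambda>x. cnj (z i x) * f (r n) x) x - y x)) \<longlonglongrightarrow> 0"
      by (rule hankel.commutator_compact[OF hankel z_measurable[of j] z_le_1[of _ j]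
            z_closed_span[of _ j] f(1) f_B, of i])
    have r3: "(\<lambda>n. L2_norm M (\<lambda>x. commutator i j (f (r n)) x - y x)) \<longlonglongrightarrow> 0"
      using r(3) unfolding commutator_def coadjoint_def .
    have "hnorm space_H (hdiff space_H (?T (F (r n))) (ae_class M y))
        = L2_norm M (\<lambda>x. commutator i j (f (r n)) x - y x)" for n
    proof -
      note c = si[OF commutator_closed_span[OF f(1)], of i j "r n"]
      show ?thesis
        unfolding f(2) commutator_class[OF f(1)] hdiff_class[OF c si[OF r(2)]]
        by (rule hnorm_class[OF L2_diff[OF c si[OF r(2)]]])
    qed
    with r(1,2) r3 show ?thesis
      unfolding carrier_space_H by (intro exI[of _ r] exI[of _ "ae_class M y"]) simp
  qed
  ultimately show ?thesis unfolding compact_op_def by blast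
qed

theorem essentially_normal_mult: "essentially_normal space_H mult"
proof -
  have "mult i (mult j F) = mult j (mult i F)" if F: "F \<in> hcarrier space_H" for i j F
  proof -
    obtain f where f: "f \<in> closed_span" "F = ae_class M f"
      using F unfolding carrier_space_H by blast
    note f_si = closed_span_L2[OF f(1)]
    note z_si = z_L2[OF f_si]
    show ?thesis
      unfolding f(2) mult_class[OF f_si] mult_class[OF z_si] by (simp only: mult.left_commute)
  qed
  with bounded_mult compact_commutator show ?thesis
    unfolding essentially_normal_def by blast
qed

end

section \<open>The Hardy space of the domain\<close>

text \<open>The model of the null case, in which the Hardy space consists of a single class.\<close>

lemma essentially_normal_singleton:
  assumes carrier: "hcarrier H = {c}"
    and ops: "hadd H c c = c" "\<And>a. hscale H a c = c" "hinner H c c = 0" "\<And>i. T i c = c"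
  shows "essentially_normal H (T :: 'i::finite \<Rightarrow> 'a \<Rightarrow> 'a)"
proof -
  have norm: "hnorm H c = 0" and diff: "hdiff H c c = c"
    using ops by (simp_all add: hnorm_def hdiff_def)
  have adj: "adjoint_op H (T i) c = c" for i
    unfolding adjoint_op_def by (rule the_equality) (auto simp: carrier ops)
  have "bounded_op H (T i)" for i
    by (auto simp: bounded_op_def linear_op_def carrier ops norm)
  moreover have "compact_op H (\<lambda>x. hdiff H (adjoint_op H (T i) (T j x)) (T j (adjoint_op H (T i) x)))" for i j
    unfolding compact_op_def linear_op_def carrier
    by (auto simp: ops adj diff norm intro!: exI[of _ "\<lambda>n. n"] strict_monoI)
  ultimately show ?thesis
    by (simp add: essentially_normal_def carrier ops(4))
qed

section \<open>Monomials and holomorphic functions in several variables\<close>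

lemma function_span_subset:
  assumes "\<And>i. e i \<in> function_span e'" shows "function_span e \<subseteq> function_span e'"
proof
  fix f assume "f \<in> function_span e"
  then have "(\<lambda>x. 1 * f x) \<in> function_span e'"
    by (rule function_span_linear_image) (use assms in simp)
  then show "f \<in> function_span e'" by simp
qed

lemma UNIV_2_eq: "i \<noteq> j \<Longrightarrow> (UNIV :: 2 set) = {i, j}"
  using exhaust_2[of i] exhaust_2[of j] by (auto simp: UNIV_2)

lemma exists_other_2: "\<exists>j. i \<noteq> (j :: 2)"
  using exhaust_2[of i] by (metis one_neq_zero zero_neq_one add_left_cancel add.right_neutral)

lemma sum_list_power_sum: "(\<Sum>k\<leftarrow>ks. norm x ^ (2 * k)) = power_sum ks ((norm x)\<^sup>2)"
  by (simp add: power_sum_def power_mult)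

lemma monomial_remove: "monomial \<alpha> z = z $ i ^ \<alpha> i * (\<Prod>u\<in>UNIV - {i}. z $ u ^ \<alpha> u)"
  unfolding monomial_def by (rule prod.remove) auto

lemma coord_mult_monomial: "z $ i * monomial \<alpha> z = monomial (\<alpha>(i := Suc (\<alpha> i))) z"
proof -
  have "(\<Prod>u\<in>UNIV - {i}. z $ u ^ (\<alpha>(i := Suc (\<alpha> i))) u) = (\<Prod>u\<in>UNIV - {i}. z $ u ^ \<alpha> u)"
    by (intro prod.cong) auto
  then show ?thesis by (simp add: monomial_remove[of _ z i])
qed

lemma monomial_dilate: "monomial \<alpha> (dilate v w z) = w ^ \<alpha> v * monomial \<alpha> z"
proof -
  have "(\<Prod>u\<in>UNIV - {v}. dilate v w z $ u ^ \<alpha> u) = (\<Prod>u\<in>UNIV - {v}. z $ u ^ \<alpha> u)"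
    by (intro prod.cong) auto
  then show ?thesis by (simp add: monomial_remove[of _ _ v] power_mult_distrib)
qed

lemma norm_monomial:
  assumes "i \<noteq> (j :: 2)"
  shows "(norm (monomial \<alpha> z))\<^sup>2 = ((norm (z $ i))\<^sup>2) ^ \<alpha> i * ((norm (z $ j))\<^sup>2) ^ \<alpha> j"
  using assms by (simp add: monomial_def UNIV_2_eq[OF assms] norm_mult norm_power power_mult_distrib
      power_mult[symmetric] mult.commute)

lemma continuous_on_monomial: "continuous_on A (monomial \<alpha>)"
  unfolding monomial_def[abs_def] by (intro continuous_intros)

lemma continuous_on_function_span_monomial:
  assumes "q \<in> function_span monomial" shows "continuous_on A q"
proof -
  obtain B c where q: "q = (\<lambda>z. \<Sum>\<alpha>\<in>B. c \<alpha> * monomial \<alpha> z)"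
    using assms by (auto simp: function_span_def)
  show ?thesis unfolding q by (intro continuous_intros continuous_on_monomial)
qed

lemma holomorphic_several_const: "holomorphic_several U (\<lambda>_. c)"
  unfolding holomorphic_several_def by (auto intro!: exI[of _ "\<lambda>_. 0"] derivative_eq_intros)

lemma holomorphic_several_coord:
  fixes i :: "'n::finite" and U :: "(complex^'n) set"
  shows "holomorphic_several U (\<lambda>z. z $ i)"
proof -
  have "((\<lambda>z :: complex^'n. z $ i) has_derivative (\<lambda>z. z $ i)) (at z)" for z
    by (rule bounded_linear_imp_has_derivative[OF bounded_linear_vec_nth])
  then show ?thesis
    unfolding holomorphic_several_def by (auto intro!: exI[of _ "\<lambda>z. z $ i"])
qed

lemma holomorphic_several_add:
  assumes "holomorphic_several U f" "holomorphic_several U g"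
  shows "holomorphic_several U (\<lambda>z. f z + g z)"
  unfolding holomorphic_several_def
proof
  fix z assume "z \<in> U"
  then obtain D E where D: "(f has_derivative D) (at z)" "\<forall>c v. D (c *s v) = c * D v"
    and E: "(g has_derivative E) (at z)" "\<forall>c v. E (c *s v) = c * E v"
    using assms unfolding holomorphic_several_def by blast
  then show "\<exists>D. ((\<lambda>z. f z + g z) has_derivative D) (at z) \<and> (\<forall>c v. D (c *s v) = c * D v)"
    by (intro exI[of _ "\<lambda>v. D v + E v"] conjI has_derivative_add) (auto simp: distrib_left)
qed

lemma holomorphic_several_mult:
  assumes "holomorphic_several U f" "holomorphic_several U g"
  shows "holomorphic_several U (\<lambda>z. f z * g z)"
  unfolding holomorphic_several_def
proof
  fix z assume "z \<in> U"
  then obtain D E where D: "(f has_derivative D) (at z)" "\<forall>c v. D (c *s v) = c * D v"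
    and E: "(g has_derivative E) (at z)" "\<forall>c v. E (c *s v) = c * E v"
    using assms unfolding holomorphic_several_def by blast
  have "((\<lambda>z. f z * g z) has_derivative (\<lambda>v. f z * E v + D v * g z)) (at z)"
    by (rule has_derivative_mult[OF D(1) E(1)])
  then show "\<exists>D. ((\<lambda>z. f z * g z) has_derivative D) (at z) \<and> (\<forall>c v. D (c *s v) = c * D v)"
    by (intro exI[of _ "\<lambda>v. f z * E v + D v * g z"] conjI) (auto simp: D(2) E(2) algebra_simps)
qed

lemma holomorphic_several_monomial: "holomorphic_several U (monomial \<alpha>)"
proof -
  have power: "holomorphic_several U (\<lambda>z. z $ u ^ n)" for u and n :: nat
    by (induction n) (auto intro: holomorphic_several_const holomorphic_several_coord holomorphic_several_mult)
  have "holomorphic_several U (\<lambda>z. \<Prod>u\<in>A. z $ u ^ \<alpha> u)" if "finite A" for A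
    using that by induction (auto intro: holomorphic_several_const holomorphic_several_mult power)
  from this[of UNIV] show ?thesis by (simp add: monomial_def[abs_def])
qed

lemma holomorphic_several_function_span_monomial:
  assumes "q \<in> function_span monomial" shows "holomorphic_several U q"
proof -
  obtain B c where B: "finite B" and q: "q = (\<lambda>z. \<Sum>\<alpha>\<in>B. c \<alpha> * monomial \<alpha> z)"
    using assms by (auto simp: function_span_def)
  show ?thesis unfolding q using B
  proof induction
    case empty
    show ?case by (simp add: holomorphic_several_const)
  next
    case (insert \<alpha> B)
    then show ?case
      by (simp, intro holomorphic_several_add holomorphic_several_mult holomorphic_several_const
          holomorphic_several_monomial)
  qed
qed

text \<open>The disc \<open>a \<mapsto> dilate v a z\<close> is affine with direction along the
  coordinate \<open>v\<close>. By the chain rule and complex linearity of the derivative, the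
  composition has as derivative the multiplication by \<open>D w\<close>.\<close>

lemma holomorphic_several_disc:
  assumes f: "holomorphic_several U f" and z: "dilate v a z \<in> U"
  shows "(\<lambda>a. f (dilate v a z)) field_differentiable (at a)"
proof -
  define w where "w = axis v (z $ v)"
  have "bounded_linear (\<lambda>a :: complex. a *s w)"
    unfolding linear_conv_bounded_linear[symmetric]
    by (rule linearI) (simp_all add: vec_eq_iff distrib_right)
  then have "((\<lambda>a. a *s w + dilate v 0 z) has_derivative (\<lambda>a. a *s w)) (at a)"
    by (intro has_derivative_add_const bounded_linear_imp_has_derivative)
  moreover have "a *s w + dilate v 0 z = dilate v a z" for a
    by (simp add: vec_eq_iff w_def axis_def)
  ultimately have dil: "((\<lambda>a. dilate v a z) has_derivative (\<lambda>a. a *s w)) (at a)" by simp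
  obtain D where D: "(f has_derivative D) (at (dilate v a z))" "\<forall>c u. D (c *s u) = c * D u"
    using f z unfolding holomorphic_several_def by blast
  have "((\<lambda>a. f (dilate v a z)) has_derivative (\<lambda>a. D (a *s w))) (at a)"
    by (rule has_derivative_compose[OF dil D(1)])
  then have "((\<lambda>a. f (dilate v a z)) has_derivative (\<lambda>a. D w * a)) (at a)"
    by (simp add: D(2) mult.commute)
  then show ?thesis
    unfolding field_differentiable_def has_field_derivative_def by blast
qed

section \<open>The domain as a complete Reinhardt set, and rotations of its boundary\<close>

locale omega_exponents =
  fixes p :: "2 \<Rightarrow> nat list"
  assumes nonempty: "p i \<noteq> []" and positive: "\<forall>k\<in>set (p i). 0 < k"
begin

definition level :: "complex^2 \<Rightarrow> real" where
  "level z = (\<Sum>i\<in>UNIV. power_sum (p i) ((norm (z $ i))\<^sup>2))"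

lemma Omega_level: "Omega p = {z. level z < 1}"
  by (simp add: Omega_def level_def sum_list_power_sum)

lemma closure_level: "closure (Omega p) = {z. level z \<le> 1}"
  using closure_frontier_Omega(1)[OF positive] by (simp add: level_def sum_list_power_sum)

lemma frontier_level: "frontier (Omega p) = {z. level z = 1}"
  using closure_frontier_Omega(2)[OF positive] by (simp add: level_def sum_list_power_sum)

lemma level_two:
  "i \<noteq> j \<Longrightarrow> level z = power_sum (p i) ((norm (z $ i))\<^sup>2) + power_sum (p j) ((norm (z $ j))\<^sup>2)"
  by (simp add: level_def UNIV_2_eq)

lemma coord_le_1:
  fixes z :: "complex^2"
  assumes "z \<in> closure (Omega p)" shows "norm (z $ i) \<le> 1"
proof -
  have "power_sum (p i) ((norm (z $ i))\<^sup>2) \<le> level z"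
    unfolding level_def by (rule member_le_sum) (auto intro: power_sum_nonneg)
  with assms have "power_sum (p i) ((norm (z $ i))\<^sup>2) \<le> 1"
    by (simp add: closure_level)
  then have "(norm (z $ i))\<^sup>2 \<le> 1\<^sup>2"
    using power_sum_le_1_imp[OF nonempty positive] by simp
  then show ?thesis by (rule power2_le_imp_le) simp
qed

lemma level_dilate_le: "norm a \<le> 1 \<Longrightarrow> level (dilate v a z) \<le> level z"
  unfolding level_def
  by (intro sum_mono power_sum_mono power_mono) (auto simp: norm_mult intro: mult_left_le_one_le)

text \<open>The term of a nonzero coordinate is positive and shrinks at least by the factor
  \<open>(norm a)\<^sup>2\<close>. Strictness places the open discs through boundary points inside
  the domain.\<close>

lemma level_dilate_less:
  fixes z :: "complex^2"
  assumes "norm a < 1" "z $ v \<noteq> 0" shows "level (dilate v a z) < level z"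
  unfolding level_def
proof (rule sum_strict_mono_ex1)
  show "\<forall>i\<in>UNIV. power_sum (p i) ((norm (dilate v a z $ i))\<^sup>2) \<le> power_sum (p i) ((norm (z $ i))\<^sup>2)"
    using assms
    by (intro ballI power_sum_mono power_mono) (auto simp: norm_mult intro: mult_left_le_one_le)
  define y where "y = (norm (z $ v))\<^sup>2"
  have y: "0 < y" using assms by (simp add: y_def)
  then have pos: "0 < power_sum (p v) y"
    using power_sum_ge_hd[OF nonempty, of y v] zero_less_power[OF y, of "hd (p v)"] by linarith
  have a: "(norm a)\<^sup>2 < 1" using assms by (simp add: abs_square_less_1)
  have "power_sum (p v) ((norm a)\<^sup>2 * y) \<le> (norm a)\<^sup>2 * power_sum (p v) y"
    using a y positive by (intro power_sum_scale_le) auto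
  also have "\<dots> < power_sum (p v) y" using a pos by simp
  finally have "power_sum (p v) ((norm (dilate v a z $ v))\<^sup>2) < power_sum (p v) ((norm (z $ v))\<^sup>2)"
    by (simp add: y_def norm_mult power_mult_distrib)
  then show "\<exists>i\<in>UNIV. power_sum (p i) ((norm (dilate v a z $ i))\<^sup>2) < power_sum (p i) ((norm (z $ i))\<^sup>2)"
    by blast
qed simp

text \<open>With \<open>L\<close> the total number of exponents, the point whose coordinates all
  equal \<open>radius\<close> has level at most
  \<open>L * radius\<^sup>2 \<le> L * radius \<le> 1\<close>, so it lies in the closed
  domain.\<close>

definition radius :: real where
  "radius = 1 / (1 + (\<Sum>i\<in>UNIV. real (length (p i))))"

sublocale reinhardt_compact "closure (Omega p)" radius
proof
  have "norm z \<le> 2" if "z \<in> closure (Omega p)" for z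
  proof -
    have "norm z \<le> (\<Sum>i\<in>UNIV. norm (z $ i))"
      unfolding norm_vec_def by (rule L2_set_le_sum) simp
    also have "\<dots> \<le> (\<Sum>i\<in>(UNIV :: 2 set). 1)"
      by (intro sum_mono coord_le_1 that)
    finally show ?thesis by simp
  qed
  then show "compact (closure (Omega p))"
    by (auto simp: compact_eq_bounded_closed bounded_iff)
  show "dilate v a z \<in> closure (Omega p)" if "z \<in> closure (Omega p)" "norm a \<le> 1" for z a v
    using level_dilate_le[OF that(2), of v z] that(1) by (simp add: closure_level)
  define L where "L = (\<Sum>i\<in>UNIV. real (length (p i)))"
  have L: "0 \<le> L" unfolding L_def by (rule sum_nonneg) simp
  then have r: "0 < radius" "radius \<le> 1" by (simp_all add: radius_def L_def[symmetric])
  show "0 < radius" by (fact r)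
  have "level (\<chi> u. of_real radius) \<le> (\<Sum>i\<in>UNIV. real (length (p i)) * radius\<^sup>2)"
    unfolding level_def using r positive
    by (intro sum_mono) (auto intro!: power_sum_le_length simp: power_le_one)
  also have "\<dots> = L * radius\<^sup>2" by (simp add: L_def sum_distrib_right)
  also have "\<dots> \<le> L * radius"
    using r L by (intro mult_left_mono) (auto simp: power2_eq_square mult_left_le)
  also have "\<dots> \<le> 1" using L by (simp add: radius_def L_def[symmetric])
  finally show "(\<chi> u. of_real radius) \<in> closure (Omega p)" by (simp add: closure_level)
qed

text \<open>If \<open>z $ v = 0\<close> the disc is a single point. Otherwise it lies in the open
  domain by \<open>level_dilate_less\<close>, even when \<open>z\<close> is a boundary
  point.\<close>

lemma A_algebra_disc_holomorphic:
  assumes "f \<in> A_algebra (Omega p)" shows "disc_holomorphic f"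
  unfolding disc_holomorphic_def
proof (intro conjI allI ballI)
  have f: "continuous_on (closure (Omega p)) f" "holomorphic_several (Omega p) f"
    using assms by (auto simp: A_algebra_def)
  show "continuous_on (closure (Omega p)) f" by (fact f)
  fix v z assume z: "z \<in> closure (Omega p)"
  show "(\<lambda>a. f (dilate v a z)) holomorphic_on ball 0 1"
  proof (cases "z $ v = 0")
    case True
    then have "dilate v a z = z" for a by (simp add: vec_eq_iff)
    then show ?thesis by simp
  next
    case False
    have "(\<lambda>a. f (dilate v a z)) field_differentiable (at a)" if "a \<in> ball 0 1" for a
    proof (rule holomorphic_several_disc[OF f(2)])
      show "dilate v a z \<in> Omega p"
        using level_dilate_less[OF _ False, of a] that z
        unfolding closure_level unfolding Omega_level by simp
    qed
    then show ?thesis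
      by (auto simp: holomorphic_on_def intro: field_differentiable_at_within)
  qed
qed

lemma function_span_monomial_A_algebra: "q \<in> function_span monomial \<Longrightarrow> q \<in> A_algebra (Omega p)"
  by (simp add: A_algebra_def continuous_on_function_span_monomial holomorphic_several_function_span_monomial)

lemma frontier_borel: "frontier (Omega p) \<in> sets borel"
  by (intro borel_closed frontier_closed)

lemma space_\<sigma>: "space (\<sigma> p) = frontier (Omega p)"
  unfolding \<sigma>_def by (rule space_normalized_surface_measure[OF frontier_borel])

lemma sets_\<sigma>: "sets (\<sigma> p) = sets (restrict_space borel (frontier (Omega p)))"
  unfolding \<sigma>_def by (rule sets_normalized_surface_measure[OF frontier_borel])

lemma frontier_subset_closure: "frontier (Omega p) \<subseteq> closure (Omega p)"
  by (auto simp: frontier_def)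

lemma measurable_\<sigma>:
  assumes "continuous_on (closure (Omega p)) f" shows "f \<in> borel_measurable (\<sigma> p)"
proof -
  have "f \<in> borel_measurable (restrict_space borel (frontier (Omega p)))"
    by (intro borel_measurable_continuous_on_restrict continuous_on_subset[OF assms frontier_subset_closure])
  then show ?thesis by (simp cong: measurable_cong_sets add: sets_\<sigma>)
qed

lemma rotation:
  assumes "norm w = 1"
  shows "dilate v w \<in> measurable (\<sigma> p) (\<sigma> p)" "distr (\<sigma> p) (\<sigma> p) (dilate v w) = \<sigma> p"
proof -
  have iso: "dist (dilate v w x) (dilate v w y) = dist x y" for x y
    unfolding dist_vec_def using assms
    by (intro L2_set_cong refl) (auto simp: dist_norm right_diff_distrib[symmetric] norm_mult)
  have "w * cnj w = 1" using assms by (simp add: complex_norm_square[symmetric])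
  then have inv: "dilate v (cnj w) (dilate v w x) = x" "dilate v w (dilate v (cnj w) x) = x" for x
    by (simp_all add: mult.commute)
  have "level (dilate v w x) = level x" for x
    unfolding level_def using assms by (intro sum.cong refl) (simp add: norm_mult)
  then have fr: "dilate v w x \<in> frontier (Omega p) \<longleftrightarrow> x \<in> frontier (Omega p)" for x
    by (simp add: frontier_level)
  show "dilate v w \<in> measurable (\<sigma> p) (\<sigma> p)" "distr (\<sigma> p) (\<sigma> p) (dilate v w) = \<sigma> p"
    unfolding \<sigma>_def
    using distr_normalized_surface_measure_isometry[OF frontier_borel iso inv fr] by simp_all
qed

text \<open>A rotation by an angle \<open>\<theta>\<close> with
  \<open>(a - b) * \<theta> = pi\<close> changes the sign of \<open>F\<close> and preserves the
  measure, so the integral equals its own negative.\<close>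

lemma integral_weight_0:
  assumes F: "F \<in> borel_measurable (\<sigma> p)"
    and weight: "\<And>w z. norm w = 1 \<Longrightarrow> F (dilate v w z) = w ^ a * cnj w ^ b * F z" and "a \<noteq> b"
  shows "(\<integral>z. F z \<partial>\<sigma> p) = (0 :: complex)"
proof -
  define \<theta> where "\<theta> = pi / (real a - real b)"
  have "real a - real b \<noteq> 0" using \<open>a \<noteq> b\<close> by simp
  then have "real a * \<theta> - real b * \<theta> = pi"
    unfolding left_diff_distrib[symmetric] by (simp add: \<theta>_def)
  then have w: "cis \<theta> ^ a * cnj (cis \<theta>) ^ b = -1"
    by (simp add: cis_cnj Complex.DeMoivre cis_mult)
  have "(\<integral>z. F z \<partial>\<sigma> p) = (\<integral>z. F z \<partial>distr (\<sigma> p) (\<sigma> p) (dilate v (cis \<theta>)))"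
    by (simp add: rotation(2))
  also have "\<dots> = (\<integral>z. F (dilate v (cis \<theta>) z) \<partial>\<sigma> p)"
    by (rule integral_distr) (auto intro: rotation F)
  also have "\<dots> = (\<integral>z. - F z \<partial>\<sigma> p)"
    using weight[of "cis \<theta>"] w by simp
  also have "\<dots> = - (\<integral>z. F z \<partial>\<sigma> p)" by simp
  finally have "2 * (\<integral>z. F z \<partial>\<sigma> p) = 0"
    unfolding mult_2 by (simp only: eq_neg_iff_add_eq_0)
  then show ?thesis by simp
qed

end

text \<open>The alternative of \<open>normalized_surface_measure_cases\<close> in which the measure
  is not null; 3 is the real dimension of the boundary.\<close>

locale omega_surface = omega_exponents +
  assumes total: "emeasure (\<sigma> p) (frontier (Omega p)) = 1"
    and positive_measure: "A \<subseteq> frontier (Omega p) \<Longrightarrow> A \<in> sets borel \<Longrightarrow>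
      0 < hausdorff_outer 3 A \<Longrightarrow> 0 < emeasure (\<sigma> p) A"
begin

sublocale finite_measure "\<sigma> p"
  by standard (simp add: space_\<sigma> total)

lemma coord_measurable: "(\<lambda>z. z $ i) \<in> borel_measurable (\<sigma> p)"
  by (intro measurable_\<sigma> continuous_intros)

lemma coord_le_1_space: "z \<in> space (\<sigma> p) \<Longrightarrow> norm (z $ i) \<le> 1"
  using coord_le_1 frontier_subset_closure by (auto simp: space_\<sigma>)

text \<open>The map \<open>z \<mapsto> (z $ i, Re (z $ j))\<close> is a contraction to a space of
  real dimension 3. The image of the band contains a nonempty open set, because the missing
  imaginary part can be solved for from the equation of the boundary;
  \<open>hausdorff_outer_pos\<close> then applies.\<close>

lemma support:
  assumes "i \<noteq> j" and ab: "0 \<le> a" "a < b" "b \<le> 1"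
  shows "0 < measure (\<sigma> p) {z\<in>space (\<sigma> p). a \<le> power_sum (p i) ((norm (z $ i))\<^sup>2) \<and>
    power_sum (p i) ((norm (z $ i))\<^sup>2) \<le> b}"
proof -
  let ?I = "\<lambda>x. power_sum (p i) x" and ?J = "\<lambda>x. power_sum (p j) x"
  define A where "A = {z\<in>frontier (Omega p). a \<le> ?I ((norm (z $ i))\<^sup>2) \<and> ?I ((norm (z $ i))\<^sup>2) \<le> b}"
  define f where "f z = (z $ i, Re (z $ j))" for z :: "complex^2"
  define U where "U = {(w :: complex, t :: real). a < ?I ((norm w)\<^sup>2) \<and> ?I ((norm w)\<^sup>2) < b \<and>
    ?J (t\<^sup>2) < 1 - ?I ((norm w)\<^sup>2)}"
  have one: "1 \<le> power_sum (p k) 1" for k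
    using power_sum_ge_hd[OF nonempty, of 1 k] by simp
  have "closed A"
  proof -
    have "A = frontier (Omega p) \<inter> ({z. a \<le> ?I ((norm (z $ i))\<^sup>2)} \<inter> {z. ?I ((norm (z $ i))\<^sup>2) \<le> b})"
      by (auto simp: A_def)
    also have "closed \<dots>"
      by (intro closed_Int frontier_closed closed_Collect_le continuous_intros)
    finally show ?thesis .
  qed
  then have A: "A \<subseteq> frontier (Omega p)" "A \<in> sets borel"
    by (auto simp: A_def)
  have "dist (f x) (f y) \<le> dist x y" for x y
  proof -
    have "dist (f x) (f y) = sqrt ((dist (x $ i) (y $ i))\<^sup>2 + (dist (Re (x $ j)) (Re (y $ j)))\<^sup>2)"
      by (simp add: f_def dist_Pair_Pair)
    also have "\<dots> \<le> sqrt ((dist (x $ i) (y $ i))\<^sup>2 + (dist (x $ j) (y $ j))\<^sup>2)"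
      using abs_Re_le_cmod[of "x $ j - y $ j"]
      by (intro real_sqrt_le_mono add_left_mono power_mono) (auto simp: dist_norm)
    also have "\<dots> = dist x y"
      using \<open>i \<noteq> j\<close> by (simp add: dist_vec_def L2_set_def UNIV_2_eq[OF \<open>i \<noteq> j\<close>])
    finally show ?thesis .
  qed
  moreover have "open U"
    unfolding U_def case_prod_beta
    by (intro open_Collect_conj open_Collect_less continuous_intros)
  moreover have "U \<noteq> {}"
  proof -
    have "\<exists>x\<ge>0. x \<le> 1 \<and> ?I x = (a + b) / 2"
      using ab one[of i] positive[of i] by (intro IVT') (auto simp: power_sum_0 intro!: continuous_intros)
    then obtain x where "0 \<le> x" "?I x = (a + b) / 2" by blast
    then have "(of_real (sqrt x), 0) \<in> U"
      using ab positive[of j] by (simp add: U_def power_sum_0)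
    then show ?thesis by blast
  qed
  moreover have "U \<subseteq> f ` A"
  proof
    fix wt assume "wt \<in> U"
    then obtain w t where wt: "wt = (w, t)" "a < ?I ((norm w)\<^sup>2)" "?I ((norm w)\<^sup>2) < b"
      "?J (t\<^sup>2) < 1 - ?I ((norm w)\<^sup>2)"
      by (auto simp: U_def)
    \<comment> \<open>This supplies the upper end \<open>s = 1\<close> for the intermediate value
      theorem, as \<open>?J 1\<close> is at least 1. The value \<open>s\<close> found is the square
      of the imaginary part.\<close>
    have "?J 1 \<le> ?J (t\<^sup>2 + 1)" by (intro power_sum_mono) auto
    moreover have "0 \<le> ?I ((norm w)\<^sup>2)" by (intro power_sum_nonneg) simp
    ultimately have "\<exists>s\<ge>0. s \<le> 1 \<and> ?J (t\<^sup>2 + s) = 1 - ?I ((norm w)\<^sup>2)"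
      using wt one[of j] by (intro IVT') (auto intro!: continuous_intros)
    then obtain s where s: "0 \<le> s" "?J (t\<^sup>2 + s) = 1 - ?I ((norm w)\<^sup>2)" by blast
    define z :: "complex^2" where "z = (\<chi> k. if k = i then w else Complex t (sqrt s))"
    have z: "z $ i = w" "z $ j = Complex t (sqrt s)"
      using \<open>i \<noteq> j\<close> by (simp_all add: z_def)
    have "(norm (z $ j))\<^sup>2 = t\<^sup>2 + s"
      using s by (simp add: z cmod_power2)
    then have "z \<in> A"
      using s wt by (simp add: A_def frontier_level level_two[OF \<open>i \<noteq> j\<close>] z(1))
    moreover have "f z = wt" by (simp add: f_def z wt)
    ultimately show "wt \<in> f ` A" by blast
  qed
  ultimately have "0 < hausdorff_outer DIM(complex \<times> real) A"
    by (rule hausdorff_outer_pos)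
  then have "0 < emeasure (\<sigma> p) A"
    by (intro positive_measure A) simp
  then have "0 < measure (\<sigma> p) A" by (simp add: emeasure_eq_measure)
  then show ?thesis by (simp add: A_def space_\<sigma>)
qed

lemma curve_measure:
  assumes "i \<noteq> j"
  shows "power_curve_measure (\<sigma> p) (\<lambda>z. (norm (z $ i))\<^sup>2) (\<lambda>z. (norm (z $ j))\<^sup>2) (p i) (p j)"
proof
  show "measure (\<sigma> p) (space (\<sigma> p)) = 1" by (simp add: measure_def space_\<sigma> total)
  show "power_sum (p i) ((norm (w $ i))\<^sup>2) + power_sum (p j) ((norm (w $ j))\<^sup>2) = 1"
    if "w \<in> space (\<sigma> p)" for w
    using that level_two[OF assms] by (simp add: space_\<sigma> frontier_level)
qed (use coord_measurable[measurable] nonempty positive support[OF assms] in auto)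

definition monomial_norm :: "(2 \<Rightarrow> nat) \<Rightarrow> real" where
  "monomial_norm \<alpha> = L2_norm (\<sigma> p) (monomial \<alpha>)"

text \<open>Subtraction truncates at 0, so this is the neighbouring exponent only if
  \<open>\<alpha> i > 0\<close>; \<open>h\<close> treats the other case separately.\<close>

definition lower :: "2 \<Rightarrow> (2 \<Rightarrow> nat) \<Rightarrow> 2 \<Rightarrow> nat" where
  "lower i \<alpha> = \<alpha>(i := \<alpha> i - 1)"

definition e :: "(2 \<Rightarrow> nat) \<Rightarrow> complex^2 \<Rightarrow> complex" where
  "e \<alpha> z = monomial \<alpha> z / of_real (monomial_norm \<alpha>)"

text \<open>The projection of \<open>cnj (z $ i) * e \<alpha> z\<close> onto the Hardy space.\<close>

definition h :: "2 \<Rightarrow> (2 \<Rightarrow> nat) \<Rightarrow> complex^2 \<Rightarrow> complex" where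
  "h i \<alpha> z = (if \<alpha> i = 0 then 0 else of_real (monomial_norm \<alpha> / monomial_norm (lower i \<alpha>)) * e (lower i \<alpha>) z)"

lemma monomial_norm_square:
  assumes "i \<noteq> j"
  shows "(monomial_norm \<alpha>)\<^sup>2
    = power_curve_measure.moment (\<sigma> p) (\<lambda>z. (norm (z $ i))\<^sup>2) (\<lambda>z. (norm (z $ j))\<^sup>2) (\<alpha> i) (\<alpha> j)"
  by (simp add: monomial_norm_def L2_norm_square norm_monomial[OF assms]
      power_curve_measure.moment_def[OF curve_measure[OF assms]])

lemma monomial_norm_pos: "0 < monomial_norm \<alpha>"
proof -
  obtain j where j: "(1 :: 2) \<noteq> j" using exists_other_2 by blast
  have "0 < (monomial_norm \<alpha>)\<^sup>2"
    unfolding monomial_norm_square[OF j] by (rule power_curve_measure.moment_pos[OF curve_measure[OF j]])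
  moreover have "0 \<le> monomial_norm \<alpha>" by (simp add: monomial_norm_def)
  ultimately show ?thesis by (simp add: less_le)
qed

lemma monomial_measurable: "monomial \<alpha> \<in> borel_measurable (\<sigma> p)"
  by (intro measurable_\<sigma> continuous_on_monomial)

lemma monomial_le_1: "z \<in> space (\<sigma> p) \<Longrightarrow> norm (monomial \<alpha> z) \<le> 1"
  using coord_le_1_space
  by (auto simp: monomial_def prod_norm[symmetric] norm_power intro!: prod_le_1 power_le_one)

lemma monomial_L2: "monomial \<alpha> \<in> square_integrable (\<sigma> p)"
  by (rule L2_bounded[OF finite_measure_axioms monomial_measurable monomial_le_1])

lemma e_eq: "e \<alpha> = (\<lambda>z. (1 / of_real (monomial_norm \<alpha>)) * monomial \<alpha> z)"
  by (simp add: e_def[abs_def])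

lemma e_dilate: "e \<alpha> (dilate v w z) = w ^ \<alpha> v * e \<alpha> z"
  by (simp add: e_def monomial_dilate)

text \<open>The common factor \<open>c\<close>, of modulus 1 on rotations, cancels in the inner
  product. It keeps the exponents natural for functions of weight \<open>\<alpha> i - 1\<close>,
  which is negative when \<open>\<alpha> i = 0\<close>.\<close>

lemma inner_weight_0:
  assumes f: "f \<in> borel_measurable (\<sigma> p)" "\<And>w z. norm w = 1 \<Longrightarrow> f (dilate v w z) = c w * w ^ a * f z"
    and g: "g \<in> borel_measurable (\<sigma> p)" "\<And>w z. norm w = 1 \<Longrightarrow> g (dilate v w z) = c w * w ^ b * g z"
    and c: "\<And>w. norm w = 1 \<Longrightarrow> c w * cnj (c w) = 1" and "a \<noteq> b"
  shows "L2_inner (\<sigma> p) f g = 0"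
  unfolding L2_inner_def
proof (rule integral_weight_0[where v = v and a = a and b = b])
  note [measurable] = f(1) g(1)
  show "(\<lambda>z. f z * cnj (g z)) \<in> borel_measurable (\<sigma> p)" by simp
  fix w :: complex and z assume w: "norm w = 1"
  have "f (dilate v w z) * cnj (g (dilate v w z)) = (c w * cnj (c w)) * (w ^ a * cnj w ^ b * (f z * cnj (g z)))"
    by (simp add: f(2)[OF w] g(2)[OF w])
  then show "f (dilate v w z) * cnj (g (dilate v w z)) = w ^ a * cnj w ^ b * (f z * cnj (g z))"
    by (simp add: c[OF w])
qed (fact \<open>a \<noteq> b\<close>)

sublocale orthonormal_family "\<sigma> p" e
proof
  show e: "e \<alpha> \<in> square_integrable (\<sigma> p)" for \<alpha>
    unfolding e_eq by (intro L2_cmult monomial_L2)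
  show "L2_inner (\<sigma> p) (e \<alpha>) (e \<beta>) = (if \<alpha> = \<beta> then 1 else 0)" for \<alpha> \<beta>
  proof (cases "\<alpha> = \<beta>")
    case True
    have "L2_norm (\<sigma> p) (e \<alpha>) = 1"
      using monomial_norm_pos[of \<alpha>] unfolding e_eq L2_norm_cmult monomial_norm_def[symmetric]
      by (simp add: norm_divide)
    with True show ?thesis by (simp add: L2_inner_self)
  next
    case False
    then obtain v where v: "\<alpha> v \<noteq> \<beta> v" by blast
    have "L2_inner (\<sigma> p) (e \<alpha>) (e \<beta>) = 0"
      by (rule inner_weight_0[OF _ _ _ _ _ v, where c = "\<lambda>_. 1"])
        (auto intro: L2_measurable[OF e] simp: e_dilate)
    with False show ?thesis by simp
  qed
qed

lemma finite_bounded_exponents: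
  assumes "i \<noteq> (j :: 2)" shows "finite {\<alpha> :: 2 \<Rightarrow> nat. \<alpha> i + \<alpha> j \<le> N}"
proof (rule finite_subset)
  show "{\<alpha>. \<alpha> i + \<alpha> j \<le> N} \<subseteq> PiE UNIV (\<lambda>_. {..N})"
  proof (clarsimp simp: PiE_iff)
    fix \<alpha> :: "2 \<Rightarrow> nat" and u assume "\<alpha> i + \<alpha> j \<le> N"
    moreover have "u = i \<or> u = j" using UNIV_2_eq[OF assms] by blast
    ultimately show "\<alpha> u \<le> N" by auto
  qed
  show "finite (PiE (UNIV :: 2 set) (\<lambda>_. {..N}))" by (intro finite_PiE) auto
qed

lemma h_closed_span: "h i \<alpha> \<in> closed_span"
proof (cases "\<alpha> i = 0")
  case True
  then have "h i \<alpha> = (\<lambda>_. 0)" by (simp add: h_def fun_eq_iff)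
  then show ?thesis by (simp add: span_closed_span function_span_0)
next
  case False
  then have "h i \<alpha> = (\<lambda>z. of_real (monomial_norm \<alpha> / monomial_norm (lower i \<alpha>)) * e (lower i \<alpha>) z)"
    by (simp add: h_def fun_eq_iff)
  then show ?thesis by (simp only: span_closed_span function_span_base)
qed

text \<open>On the unit circle \<open>cnj w\<close> is the inverse of \<open>w\<close>, so lowering
  the exponent at \<open>i\<close> and multiplying by \<open>cnj (z $ i)\<close> produce the same
  weight. Distinct exponents thereby give orthogonal remainders.\<close>

lemma remainder_dilate:
  assumes w: "norm w = 1"
  shows "cnj (dilate v w z $ i) * e \<alpha> (dilate v w z) - h i \<alpha> (dilate v w z)
    = (if v = i then cnj w else 1) * w ^ \<alpha> v * (cnj (z $ i) * e \<alpha> z - h i \<alpha> z)"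
proof -
  have w1: "cnj w * w = 1" using w by (simp add: complex_norm_square[symmetric] mult.commute)
  have "h i \<alpha> (dilate v w z) = (if v = i then cnj w else 1) * w ^ \<alpha> v * h i \<alpha> z"
  proof (cases "\<alpha> i")
    case (Suc n)
    have "w ^ lower i \<alpha> v = (if v = i then cnj w else 1) * w ^ \<alpha> v"
      using Suc w1 by (auto simp: lower_def mult.assoc[symmetric])
    then show ?thesis by (simp add: h_def e_dilate)
  qed (simp add: h_def)
  then show ?thesis by (simp add: e_dilate algebra_simps)
qed

text \<open>For \<open>\<alpha> i = Suc n\<close> the remainder is
  \<open>(X - \<tau>) * monomial \<gamma>\<close> divided by the norm of
  \<open>monomial \<alpha>\<close>, where \<open>X = (norm (z $ i))^2\<close> and
  \<open>\<gamma>\<close> is the lowered exponent. Its squared norm is a variance of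
  \<open>X\<close> up to normalization, and expanding the square gives moments.\<close>

lemma remainder_norm:
  assumes "i \<noteq> j"
  defines "m \<equiv> power_curve_measure.moment (\<sigma> p) (\<lambda>z. (norm (z $ i))\<^sup>2) (\<lambda>z. (norm (z $ j))\<^sup>2)"
  shows "\<alpha> i = 0 \<Longrightarrow> (L2_norm (\<sigma> p) (\<lambda>z. cnj (z $ i) * e \<alpha> z - h i \<alpha> z))\<^sup>2 = m 1 (\<alpha> j) / m 0 (\<alpha> j)"
    and "\<alpha> i = Suc n \<Longrightarrow> (L2_norm (\<sigma> p) (\<lambda>z. cnj (z $ i) * e \<alpha> z - h i \<alpha> z))\<^sup>2
      = (m (Suc (Suc n)) (\<alpha> j) * m n (\<alpha> j) - (m (Suc n) (\<alpha> j))\<^sup>2) / (m (Suc n) (\<alpha> j) * m n (\<alpha> j))"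
proof -
  interpret C: power_curve_measure "\<sigma> p" "\<lambda>z. (norm (z $ i))\<^sup>2" "\<lambda>z. (norm (z $ j))\<^sup>2" "p i" "p j"
    by (rule curve_measure[OF assms(1)])
  let ?X = "\<lambda>z :: complex^2. (norm (z $ i))\<^sup>2" and ?Y = "\<lambda>z :: complex^2. (norm (z $ j))\<^sup>2"
  define l where "l = \<alpha> j"
  have m_def': "m = C.moment" by (simp add: m_def)
  have m_pos: "0 < m a b" for a b unfolding m_def' by (rule C.moment_pos)
  have norm2: "(monomial_norm \<beta>)\<^sup>2 = m (\<beta> i) (\<beta> j)" for \<beta>
    unfolding m_def by (rule monomial_norm_square[OF assms(1)])
  note int = C.integrable_monomial
  {
    assume 0: "\<alpha> i = 0"
    have "(norm (cnj (z $ i) * e \<alpha> z - h i \<alpha> z))\<^sup>2 = ?X z ^ 1 * ?Y z ^ l / m 0 l" for z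
      using 0 norm2[of \<alpha>] norm_monomial[OF assms(1), of \<alpha> z]
      by (simp add: h_def e_def norm_mult norm_divide power_mult_distrib power_divide l_def)
    then have "(L2_norm (\<sigma> p) (\<lambda>z. cnj (z $ i) * e \<alpha> z - h i \<alpha> z))\<^sup>2 = (\<integral>z. ?X z ^ 1 * ?Y z ^ l \<partial>\<sigma> p) / m 0 l"
      unfolding L2_norm_square by simp
    then show "(L2_norm (\<sigma> p) (\<lambda>z. cnj (z $ i) * e \<alpha> z - h i \<alpha> z))\<^sup>2 = m 1 (\<alpha> j) / m 0 (\<alpha> j)"
      by (simp add: m_def' C.moment_def l_def)
  next
    assume n: "\<alpha> i = Suc n"
    define \<gamma> where "\<gamma> = lower i \<alpha>"
    have \<gamma>: "\<gamma> i = n" "\<gamma> j = l" "\<alpha> = \<gamma>(i := Suc (\<gamma> i))"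
      using n assms(1) by (auto simp: \<gamma>_def lower_def l_def fun_eq_iff)
    \<comment> \<open>The mean of \<open>X\<close> under the weight given by the squared modulus of
      \<open>monomial \<gamma>\<close>, and at the same time the squared ratio of the two monomial
      norms.\<close>
    define \<tau> where "\<tau> = m (Suc n) l / m n l"
    have pos: "0 < monomial_norm \<alpha>" "0 < monomial_norm \<gamma>" by (rule monomial_norm_pos)+
    have \<tau>: "\<tau> = (monomial_norm \<alpha>)\<^sup>2 / (monomial_norm \<gamma>)\<^sup>2"
      unfolding norm2 \<tau>_def by (simp add: n \<gamma>(1,2) l_def)
    have k: "cnj (z $ i) * e \<alpha> z - h i \<alpha> z
        = of_real ((?X z - \<tau>) / monomial_norm \<alpha>) * monomial \<gamma> z" for z
    proof -
      have "cnj (z $ i) * e \<alpha> z = cnj (z $ i) * (z $ i) * monomial \<gamma> z / of_real (monomial_norm \<alpha>)"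
        unfolding e_def using coord_mult_monomial[of z i \<gamma>] \<gamma>(3) by (simp add: mult.assoc)
      also have "cnj (z $ i) * (z $ i) = of_real (?X z)"
        by (simp only: complex_norm_square mult.commute)
      finally have 1: "cnj (z $ i) * e \<alpha> z = of_real (?X z / monomial_norm \<alpha>) * monomial \<gamma> z"
        by simp
      have "h i \<alpha> z = of_real (monomial_norm \<alpha> / monomial_norm \<gamma> / monomial_norm \<gamma>) * monomial \<gamma> z"
        using n by (simp add: h_def e_def \<gamma>_def[symmetric])
      also have "monomial_norm \<alpha> / monomial_norm \<gamma> / monomial_norm \<gamma> = \<tau> / monomial_norm \<alpha>"
        unfolding \<tau> using pos by (simp add: power2_eq_square)
      finally have "h i \<alpha> z = of_real (\<tau> / monomial_norm \<alpha>) * monomial \<gamma> z" .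
      with 1 show ?thesis by (simp add: left_diff_distrib diff_divide_distrib)
    qed
    have "(norm (cnj (z $ i) * e \<alpha> z - h i \<alpha> z))\<^sup>2
        = (?X z ^ Suc (Suc n) * ?Y z ^ l - 2 * \<tau> * (?X z ^ Suc n * ?Y z ^ l) + \<tau>\<^sup>2 * (?X z ^ n * ?Y z ^ l))
          / m (Suc n) l" for z
    proof -
      have "(norm (cnj (z $ i) * e \<alpha> z - h i \<alpha> z))\<^sup>2
          = (?X z - \<tau>)\<^sup>2 / (monomial_norm \<alpha>)\<^sup>2 * (norm (monomial \<gamma> z))\<^sup>2"
        unfolding k norm_mult power_mult_distrib norm_of_real power2_abs power_divide ..
      also have "\<dots> = (?X z - \<tau>)\<^sup>2 * (?X z ^ n * ?Y z ^ l) / m (Suc n) l"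
        unfolding norm2 norm_monomial[OF assms(1)] by (simp add: n \<gamma>(1,2) l_def)
      also have "(?X z - \<tau>)\<^sup>2 * (?X z ^ n * ?Y z ^ l)
          = ?X z ^ Suc (Suc n) * ?Y z ^ l - 2 * \<tau> * (?X z ^ Suc n * ?Y z ^ l) + \<tau>\<^sup>2 * (?X z ^ n * ?Y z ^ l)"
        by (simp add: power2_eq_square algebra_simps)
      finally show ?thesis .
    qed
    then have "(L2_norm (\<sigma> p) (\<lambda>z. cnj (z $ i) * e \<alpha> z - h i \<alpha> z))\<^sup>2
        = (\<integral>z. ?X z ^ Suc (Suc n) * ?Y z ^ l - 2 * \<tau> * (?X z ^ Suc n * ?Y z ^ l)
            + \<tau>\<^sup>2 * (?X z ^ n * ?Y z ^ l) \<partial>\<sigma> p) / m (Suc n) l"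
      unfolding L2_norm_square by simp
    also have "(\<integral>z. ?X z ^ Suc (Suc n) * ?Y z ^ l - 2 * \<tau> * (?X z ^ Suc n * ?Y z ^ l)
            + \<tau>\<^sup>2 * (?X z ^ n * ?Y z ^ l) \<partial>\<sigma> p)
        = m (Suc (Suc n)) l - 2 * \<tau> * m (Suc n) l + \<tau>\<^sup>2 * m n l"
      unfolding m_def' C.moment_def
      by (subst Bochner_Integration.integral_add, intro Bochner_Integration.integrable_diff integrable_mult_right int,
          intro integrable_mult_right int, subst Bochner_Integration.integral_diff, intro int,
          intro integrable_mult_right int, simp)
    also have "(m (Suc (Suc n)) l - 2 * \<tau> * m (Suc n) l + \<tau>\<^sup>2 * m n l) / m (Suc n) l
        = (m (Suc (Suc n)) l * m n l - (m (Suc n) l)\<^sup>2) / (m (Suc n) l * m n l)"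
      using m_pos[of n l] m_pos[of "Suc n" l] by (simp add: \<tau>_def field_simps power2_eq_square)
    finally show "(L2_norm (\<sigma> p) (\<lambda>z. cnj (z $ i) * e \<alpha> z - h i \<alpha> z))\<^sup>2
      = (m (Suc (Suc n)) (\<alpha> j) * m n (\<alpha> j) - (m (Suc n) (\<alpha> j))\<^sup>2) / (m (Suc n) (\<alpha> j) * m n (\<alpha> j))"
      by (simp only: l_def)
  }
qed

lemma remainder_small:
  assumes \<epsilon>: "0 < \<epsilon>"
  shows "finite {\<alpha>. \<epsilon> \<le> L2_norm (\<sigma> p) (\<lambda>z. cnj (z $ i) * e \<alpha> z - h i \<alpha> z)}"
proof -
  obtain j where j: "i \<noteq> j" using exists_other_2 by blast
  interpret C: power_curve_measure "\<sigma> p" "\<lambda>z. (norm (z $ i))\<^sup>2" "\<lambda>z. (norm (z $ j))\<^sup>2" "p i" "p j"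
    by (rule curve_measure[OF j])
  \<comment> \<open>Half of \<open>\<epsilon>^2\<close>, so that the upper bound strictly
    contradicts \<open>big\<close>.\<close>
  have \<delta>: "0 < \<epsilon>\<^sup>2 / 2" using \<epsilon> by simp
  obtain N1 where N1: "\<And>k l. N1 \<le> k + l \<Longrightarrow>
    C.moment (Suc (Suc k)) l * C.moment k l - (C.moment (Suc k) l)\<^sup>2
      \<le> \<epsilon>\<^sup>2 / 2 * (C.moment (Suc k) l * C.moment k l)"
    using C.moment_gap_small[OF \<delta>] by blast
  obtain N2 where N2: "\<And>l. N2 \<le> l \<Longrightarrow> C.moment 1 l \<le> \<epsilon>\<^sup>2 / 2 * C.moment 0 l"
    using C.moment_first_small[OF \<delta>] by blast
  have "\<alpha> i + \<alpha> j \<le> N1 + N2" if big: "\<epsilon> \<le> L2_norm (\<sigma> p) (\<lambda>z. cnj (z $ i) * e \<alpha> z - h i \<alpha> z)" for \<alpha>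
  proof (rule ccontr)
    assume far: "\<not> ?thesis"
    have "(L2_norm (\<sigma> p) (\<lambda>z. cnj (z $ i) * e \<alpha> z - h i \<alpha> z))\<^sup>2 \<le> \<epsilon>\<^sup>2 / 2"
    proof (cases "\<alpha> i")
      case 0
      then have "C.moment 1 (\<alpha> j) \<le> \<epsilon>\<^sup>2 / 2 * C.moment 0 (\<alpha> j)"
        using far by (intro N2) simp
      then show ?thesis
        unfolding remainder_norm(1)[where \<alpha> = \<alpha>, OF j 0] by (simp only: pos_divide_le_eq C.moment_pos)
    next
      case (Suc n)
      \<comment> \<open>The estimate is used at \<open>n\<close>, one below
        \<open>\<alpha> i\<close>; the strict inequality in \<open>far\<close> makes up for
        this.\<close>
      then have "C.moment (Suc (Suc n)) (\<alpha> j) * C.moment n (\<alpha> j) - (C.moment (Suc n) (\<alpha> j))\<^sup>2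
          \<le> \<epsilon>\<^sup>2 / 2 * (C.moment (Suc n) (\<alpha> j) * C.moment n (\<alpha> j))"
        using far by (intro N1) simp
      then show ?thesis
        unfolding remainder_norm(2)[where \<alpha> = \<alpha>, OF j Suc]
        by (simp only: pos_divide_le_eq mult_pos_pos C.moment_pos)
    qed
    moreover have "\<epsilon>\<^sup>2 \<le> (L2_norm (\<sigma> p) (\<lambda>z. cnj (z $ i) * e \<alpha> z - h i \<alpha> z))\<^sup>2"
      using big \<epsilon> by (intro power_mono) auto
    ultimately show False using \<delta> by linarith
  qed
  then show ?thesis
    by (intro finite_subset[OF _ finite_bounded_exponents[OF j, of "N1 + N2"]]) blast
qed

lemma hankel_coord: "hankel (\<sigma> p) e (\<lambda>z. cnj (z $ i)) (h i)"
proof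
  note [measurable] = coord_measurable[of i]
  show cnj: "(\<lambda>z. cnj (z $ i)) \<in> borel_measurable (\<sigma> p)" by simp
  show le: "norm (cnj (z $ i)) \<le> 1" if "z \<in> space (\<sigma> p)" for z
    using coord_le_1_space[OF that] by simp
  show "h i \<alpha> \<in> closed_span" for \<alpha> by (rule h_closed_span)
  show "finite {\<alpha>. \<epsilon> \<le> L2_norm (\<sigma> p) (\<lambda>z. cnj (z $ i) * e \<alpha> z - h i \<alpha> z)}" if "0 < \<epsilon>" for \<epsilon>
    by (rule remainder_small[OF that])
  fix \<alpha> \<beta> :: "2 \<Rightarrow> nat" assume "\<alpha> \<noteq> \<beta>"
  then obtain v where v: "\<alpha> v \<noteq> \<beta> v" by blast
  have meas: "(\<lambda>z. cnj (z $ i) * e \<alpha> z - h i \<alpha> z) \<in> borel_measurable (\<sigma> p)" for \<alpha>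
    using L2_measurable[OF e] L2_measurable[OF closed_span_L2[OF h_closed_span]]
    by (intro borel_measurable_diff borel_measurable_times cnj) auto
  show "L2_inner (\<sigma> p) (\<lambda>z. cnj (z $ i) * e \<alpha> z - h i \<alpha> z) (\<lambda>z. cnj (z $ i) * e \<beta> z - h i \<beta> z) = 0"
  proof (rule inner_weight_0[where v = v and c = "\<lambda>w. if v = i then cnj w else 1" and a = "\<alpha> v" and b = "\<beta> v"])
    show "(if v = i then cnj w else 1) * cnj (if v = i then cnj w else 1) = 1" if "norm w = 1" for w
      using that by (auto simp: complex_norm_square[symmetric] mult.commute)
  qed (rule meas remainder_dilate v, assumption?)+
qed

text \<open>Multiplication by a coordinate sends each \<open>e \<alpha>\<close> to a multiple of
  another basis function and does not increase norms, so it preserves the closure of the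
  span.\<close>

lemma coord_closed_span:
  assumes f: "f \<in> closed_span" shows "(\<lambda>z. z $ i * f z) \<in> closed_span"
proof (rule closed_span_approx)
  note f_si = closed_span_L2[OF f]
  show "(\<lambda>z. z $ i * f z) \<in> square_integrable (\<sigma> p)"
    by (rule L2_bounded_mult[OF f_si coord_measurable coord_le_1_space])
  have base: "(\<lambda>z. z $ i * e \<alpha> z) \<in> function_span e" for \<alpha>
  proof -
    have "(\<lambda>z. z $ i * e \<alpha> z) = (\<lambda>z. of_real (monomial_norm (\<alpha>(i := Suc (\<alpha> i))) / monomial_norm \<alpha>)
        * e (\<alpha>(i := Suc (\<alpha> i))) z)"
      using monomial_norm_pos[of "\<alpha>(i := Suc (\<alpha> i))"]
      by (simp add: e_def fun_eq_iff coord_mult_monomial[symmetric])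
    then show ?thesis by (simp only: function_span_base)
  qed
  fix \<epsilon> :: real assume "0 < \<epsilon>"
  then obtain q where q: "q \<in> function_span e" "L2_norm (\<sigma> p) (\<lambda>z. f z - q z) < \<epsilon>"
    using f unfolding closed_span_def by blast
  have "L2_norm (\<sigma> p) (\<lambda>z. z $ i * (f z - q z)) \<le> 1 * L2_norm (\<sigma> p) (\<lambda>z. f z - q z)"
    by (rule L2_norm_bounded_mult[OF L2_diff[OF f_si span_L2[OF q(1)]]
          coord_measurable coord_le_1_space]) simp_all
  then have "L2_norm (\<sigma> p) (\<lambda>z. z $ i * f z - z $ i * q z) < \<epsilon>"
    using q(2) by (simp add: right_diff_distrib)
  then show "\<exists>g\<in>closed_span. L2_norm (\<sigma> p) (\<lambda>z. z $ i * f z - g z) < \<epsilon>"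
    by - (rule bexI[OF _ span_closed_span[OF function_span_linear_image[OF q(1) base]]])
qed

sublocale coordinate_multipliers "\<sigma> p" e "\<lambda>i (z :: complex^2). z $ i" h
  by (intro coordinate_multipliers.intro coordinate_multipliers_axioms.intro orthonormal_family_axioms
      coord_measurable coord_le_1_space coord_closed_span hankel_coord)

text \<open>Uniform approximation by polynomials on the closed domain gives approximation in
  \<open>L^2\<close>, since the measure has mass 1.\<close>

lemma A_algebra_closed_span:
  assumes f: "f \<in> A_algebra (Omega p)" shows "f \<in> closed_span"
proof (rule closed_span_approx)
  have cont: "continuous_on (closure (Omega p)) f" using f by (simp add: A_algebra_def)
  note disc = A_algebra_disc_holomorphic[OF f]
  have meas: "f \<in> borel_measurable (\<sigma> p)" by (rule measurable_\<sigma>[OF cont])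
  have sub: "z \<in> closure (Omega p)" if "z \<in> space (\<sigma> p)" for z
    using that frontier_subset_closure by (auto simp: space_\<sigma>)
  obtain B where B: "\<And>z. z \<in> closure (Omega p) \<Longrightarrow> norm (f z) \<le> B"
    using disc_holomorphic_bounded[OF disc] by blast
  show f_si: "f \<in> square_integrable (\<sigma> p)"
    using B sub by (intro L2_bounded[OF finite_measure_axioms meas]) blast
  fix \<epsilon> :: real assume \<epsilon>: "0 < \<epsilon>"
  then have "0 < \<epsilon> / 2" by simp
  then obtain q where q: "q \<in> function_span monomial"
    "\<And>z. z \<in> closure (Omega p) \<Longrightarrow> norm (f z - q z) < \<epsilon> / 2"
    using disc_holomorphic_approx[OF disc] by blast
  have q_span: "q \<in> function_span e"
  proof -
    have "monomial \<alpha> \<in> function_span e" for \<alpha>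
    proof -
      have "monomial \<alpha> = (\<lambda>z. of_real (monomial_norm \<alpha>) * e \<alpha> z)"
        using monomial_norm_pos[of \<alpha>] by (simp add: e_def fun_eq_iff)
      then show ?thesis by (simp only: function_span_base)
    qed
    then show ?thesis using function_span_subset q(1) by blast
  qed
  have "L2_norm (\<sigma> p) (\<lambda>z. f z - q z) \<le> \<epsilon> / 2 * sqrt (measure (\<sigma> p) (space (\<sigma> p)))"
    using q(2) sub \<epsilon> L2_measurable[OF span_L2[OF q_span]]
    by (intro L2_norm_uniform_bound finite_measure_axioms borel_measurable_diff meas) (auto intro: less_imp_le)
  also have "\<dots> < \<epsilon>" using \<epsilon> by (simp add: measure_def space_\<sigma> total)
  finally show "\<exists>g\<in>closed_span. L2_norm (\<sigma> p) (\<lambda>z. f z - g z) < \<epsilon>"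
    using span_closed_span[OF q_span] by blast
qed

lemma function_span_e_A_algebra: "q \<in> function_span e \<Longrightarrow> q \<in> A_algebra (Omega p)"
proof -
  have "e \<alpha> \<in> function_span monomial" for \<alpha>
    unfolding e_eq by (rule function_span_base)
  then show "q \<in> function_span e \<Longrightarrow> q \<in> A_algebra (Omega p)"
    using function_span_subset function_span_monomial_A_algebra by blast
qed

text \<open>\<open>A_algebra\<close> lies in \<open>closed_span\<close> by density of the
  polynomials; conversely, the finite combinations that approximate elements of
  \<open>closed_span\<close> are polynomials and lie in \<open>A_algebra\<close>.\<close>

lemma hclosure_A_algebra:
  "hclosure (L2_space (\<sigma> p)) (ae_class (\<sigma> p) ` A_algebra (Omega p)) = ae_class (\<sigma> p) ` closed_span"
proof -
  note si = closed_span_L2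
  have norm_diff: "hnorm (L2_space (\<sigma> p)) (hdiff (L2_space (\<sigma> p)) (ae_class (\<sigma> p) f) (ae_class (\<sigma> p) a))
      = L2_norm (\<sigma> p) (\<lambda>z. f z - a z)"
    if f: "f \<in> square_integrable (\<sigma> p)" and a: "a \<in> A_algebra (Omega p)" for f a
    using f si[OF A_algebra_closed_span[OF a]]
    by (simp add: L2_space_hdiff L2_space_hnorm L2_diff)
  have "f \<in> closed_span"
    if f: "f \<in> square_integrable (\<sigma> p)"
      and approx: "\<forall>\<epsilon>>0. \<exists>a\<in>A_algebra (Omega p). L2_norm (\<sigma> p) (\<lambda>z. f z - a z) < \<epsilon>" for f
    using approx A_algebra_closed_span by (intro closed_span_approx[OF f]) blast
  moreover have "\<exists>a\<in>A_algebra (Omega p). L2_norm (\<sigma> p) (\<lambda>z. f z - a z) < \<epsilon>"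
    if "f \<in> closed_span" "0 < \<epsilon>" for f \<epsilon>
    using that function_span_e_A_algebra unfolding closed_span_def by blast
  ultimately show ?thesis
    \<comment> \<open>Only the carrier of \<open>L2_space\<close> is unfolded, so that
      \<open>norm_diff\<close> still matches its norm.\<close>
    unfolding hclosure_def L2_space_def[of "\<sigma> p", THEN arg_cong[where f = hcarrier]]
    by (auto simp: norm_diff si)
qed

lemma essentially_normal_Hardy: "essentially_normal (Hardy_space p) (mult_coord p)"
proof -
  have "Hardy_space p = space_H"
    by (simp add: Hardy_space_def space_H_def hclosure_A_algebra)
  moreover have "mult_coord p = mult"
    by (simp add: fun_eq_iff mult_coord_def mult_def)
  ultimately show ?thesis using essentially_normal_mult by simp
qed

end

text \<open>On a null space every property holds almost everywhere, so all functions share one class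
  and all inner products vanish.\<close>

lemma essentially_normal_null:
  assumes "emeasure (\<sigma> p) (space (\<sigma> p)) = 0"
  shows "essentially_normal (Hardy_space p) (mult_coord p)"
proof -
  have AE: "AE z in \<sigma> p. P z" for P
    using assms by (intro AE_I'[of "space (\<sigma> p)"]) (auto simp: null_sets_def)
  define c where "c = square_integrable (\<sigma> p)"
  have c: "ae_class (\<sigma> p) f = c" for f
    by (simp add: ae_class_def c_def AE)
  have inner: "hinner (L2_space (\<sigma> p)) F G = 0" for F G
  proof -
    have "(\<integral>x. representative F x * cnj (representative G x) \<partial>\<sigma> p) = 0"
      by (rule integral_eq_zero_AE[OF AE])
    then show ?thesis by (simp add: L2_space_def)
  qed
  have "(\<lambda>_. 0) \<in> A_algebra (Omega p)"
    by (simp add: A_algebra_def holomorphic_several_const)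
  moreover have "(\<lambda>_. 0) \<in> square_integrable (\<sigma> p)"
    by (simp add: square_integrable_def)
  ultimately have "hclosure (L2_space (\<sigma> p)) (ae_class (\<sigma> p) ` A_algebra (Omega p)) = {c}"
    by (auto simp: hclosure_def hnorm_def inner L2_space_def[of "\<sigma> p", THEN arg_cong[where f = hcarrier]] c)
  then show ?thesis
    by (intro essentially_normal_singleton[of _ c])
      (simp_all add: Hardy_space_def inner, simp_all add: L2_space_def mult_coord_def c)
qed

theorem proposition3p7:
  fixes p :: "2 \<Rightarrow> nat list"
  assumes "\<And>i. length (p i) \<ge> 2"
    and "\<And>i k. k \<in> set (p i) \<Longrightarrow> k > 0"
    and "\<And>i. Gcd (set (p i)) = 1"
  shows "essentially_normal (Hardy_space p) (mult_coord p)"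
proof -
  interpret omega_exponents p
  proof
    show "p i \<noteq> []" for i using assms(1)[of i] by auto
    show "\<forall>k\<in>set (p i). 0 < k" for i using assms(2) by blast
  qed
  show ?thesis
  proof (rule normalized_surface_measure_cases[OF frontier_borel])
    assume 0: "emeasure (normalized_surface_measure (frontier (Omega p))) (frontier (Omega p)) = 0"
    show ?thesis
      by (rule essentially_normal_null) (unfold space_\<sigma>, unfold \<sigma>_def, rule 0)
  next
    assume "emeasure (normalized_surface_measure (frontier (Omega p))) (frontier (Omega p)) = 1"
      and "\<And>A. A \<subseteq> frontier (Omega p) \<Longrightarrow> A \<in> sets borel \<Longrightarrow>
        0 < hausdorff_outer (DIM(complex^2) - 1) A \<Longrightarrow>
        0 < emeasure (normalized_surface_measure (frontier (Omega p))) A"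
    then interpret omega_surface p
      by unfold_locales (simp_all add: \<sigma>_def)
    show ?thesis by (rule essentially_normal_Hardy)
  qed
qed

end
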